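(* Let $0<\sigma_1^2<\sigma_2^2$ and assume Assumption (A) stated in the context. Then \[ \lim_{n \to \infty} \frac{\bar{\mathsf{R}}_n(\sigma_1^2,\sigma_2^2)}{\sqrt{n}}=c(\sigma_1^2,\sigma_2^2), \] where $c(\sigma_1^2,\sigma_2^2)$ is the solution $c$ of \[ \int_{\sigma_1^2}^{\sigma_2^2} \frac{ \frac{c^2 }{ \left( \frac{\sqrt{s}}{2}+\sqrt{ \frac{s}{4} + c^2} \right)^2} + \frac{ c^2 (c^2+ s)}{ \left( \frac{s}{2}+\sqrt{ \frac{s^2}{4} +c^2( c^2+ s) } \right)^2} -1}{s^2}\, \mathrm{d} s =0. \]
   Context: Vector Gaussian wiretap channel: $\mathbf{Y}_1=\mathbf{X}+\mathbf{N}_1$, $\mathbf{Y}_2=\mathbf{X}+\mathbf{N}_2$, with $\mathbf{X}\in\mathbb{R}^n$, $\mathbf{N}_1\sim\mathcal{N}(\mathbf{0}_n,\sigma_1^2\mathbf{I}_n)$, $\mathbf{N}_2\sim\mathcal{N}(\mathbf{0}_n,\sigma_2^2\mathbf{I}_n)$, mutually independent with $\mathbf{X}$. $C_s(\sigma_1^2,\sigma_2^2,\mathsf{R},n)=\max I(\mathbf{X};\mathbf{Y}_1)-I(\mathbf{X};\mathbf{Y}_2)$ over distributions of $\mathbf{X}$ supported in $\{\|\mathbf{x}\|\le\mathsf{R}\}$. $P_{\mathbf{X}_{\mathsf{R}}}$ is the uniform distribution on $\{\|\mathbf{x}\|=\mathsf{R}\}$, and $\bar{\mathsf{R}}_n(\sigma_1^2,\sigma_2^2)=\max\{\mathsf{R}: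 P_{\mathbf{X}_{\mathsf{R}}}\text{ attains }C_s(\sigma_1^2,\sigma_2^2,\mathsf{R},n)\}$ ($0$ if empty). $\mathsf{I}_v$ is the modified Bessel function of the first kind and $\mathsf{h}_v(x)=\mathsf{I}_v(x)/\mathsf{I}_{v-1}(x)$. Assumption (A): for all $\mathsf{R}\ge0$, $0\le\sigma_1\le\sigma_2$, $n\in\mathbb{N}$, the function $y\mapsto \frac{1}{\sigma_2^2}\mathbb{E}\left[\frac{\mathsf{R}}{\|y\mathbf{e}_1+\mathbf{W}\|}\mathsf{h}_{\frac{n}{2}}\left(\frac{\mathsf{R}}{\sigma_2^2}\|y\mathbf{e}_1+\mathbf{W}\|\right)-1\right]-\frac{1}{\sigma_1^2}\left(\frac{\mathsf{R}}{y}\mathsf{h}_{\frac{n}{2}}\left(\frac{\mathsf{R}}{\sigma_1^2}y\right)-1\right)$ has at most one sign change on $y>0$, where $\mathbf{W}\sim\mathcal{N}(\mathbf{0}_{n+2},(\sigma_2^2-\sigma_1^2)\mathbf{I}_{n+2})$ and $\mathbf{e}_1$ is the first unit vector of $\mathbb{R}^{n+2}$. *)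

theory Defs
  imports "HOL-Probability.Probability"
begin

definition Rn :: "nat \<Rightarrow> (nat \<Rightarrow> real) measure" where
  "Rn n = PiM {..<n} (\<lambda>_. borel)"

definition Ln :: "nat \<Rightarrow> (nat \<Rightarrow> real) measure" where
  "Ln n = PiM {..<n} (\<lambda>_. lborel)"

definition vnorm :: "nat \<Rightarrow> (nat \<Rightarrow> real) \<Rightarrow> real" where
  "vnorm n x = sqrt (\<Sum>i<n. (x i)\<^sup>2)"

definition vadd :: "nat \<Rightarrow> (nat \<Rightarrow> real) \<Rightarrow> (nat \<Rightarrow> real) \<Rightarrow> (nat \<Rightarrow> real)" where
  "vadd n x z = (\<lambda>i\<in>{..<n}. x i + z i)"

definition gauss_density :: "nat \<Rightarrow> real \<Rightarrow> (nat \<Rightarrow> real) \<Rightarrow> real" where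
  "gauss_density n v x = (2 * pi * v) powr (- real n / 2) * exp (- (vnorm n x)\<^sup>2 / (2 * v))"

definition gaussM :: "nat \<Rightarrow> real \<Rightarrow> (nat \<Rightarrow> real) measure" where
  "gaussM n v = density (Ln n) (\<lambda>x. ennreal (gauss_density n v x))"

definition minfo :: "nat \<Rightarrow> real \<Rightarrow> (nat \<Rightarrow> real) measure \<Rightarrow> real" where
  "minfo n v P = prob_space.mutual_information (P \<Otimes>\<^sub>M gaussM n v) (exp 1) (Rn n) (Rn n)
      fst (\<lambda>(x, z). vadd n x z)"

definition admissible :: "nat \<Rightarrow> real \<Rightarrow> (nat \<Rightarrow> real) measure \<Rightarrow> bool" where
  "admissible n R P \<longleftrightarrow> prob_space P \<and> sets P = sets (Rn n) \<and> (AE x in P. vnorm n x \<le> R)"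

definition secrecy_rate :: "nat \<Rightarrow> real \<Rightarrow> real \<Rightarrow> (nat \<Rightarrow> real) measure \<Rightarrow> real" where
  "secrecy_rate n v1 v2 P = minfo n v1 P - minfo n v2 P"

text \<open>Uniform distribution on the sphere of radius R: the image of the uniform
  distribution on the unit ball under the radial map y |-> R y / |y|
  (the normalized cone measure, which equals normalized surface measure).\<close>
definition sphere_unif :: "nat \<Rightarrow> real \<Rightarrow> (nat \<Rightarrow> real) measure" where
  "sphere_unif n R = distr (uniform_measure (Ln n) {x \<in> space (Ln n). vnorm n x \<le> 1}) (Rn n)
      (\<lambda>y. \<lambda>i\<in>{..<n}. R * y i / vnorm n y)"

definition attains :: "nat \<Rightarrow> real \<Rightarrow> real \<Rightarrow> real \<Rightarrow> bool" where
  "attains n v1 v2 R \<longleftrightarrow> admissible n R (sphere_unif n R) \<and>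
     (\<forall>P. admissible n R P \<longrightarrow> secrecy_rate n v1 v2 P \<le> secrecy_rate n v1 v2 (sphere_unif n R))"

definition Rbar :: "nat \<Rightarrow> real \<Rightarrow> real \<Rightarrow> real" where
  "Rbar n v1 v2 = (if {R. 0 \<le> R \<and> attains n v1 v2 R} = {} then 0
                   else Sup {R. 0 \<le> R \<and> attains n v1 v2 R})"

definition besselI :: "real \<Rightarrow> real \<Rightarrow> real" where
  "besselI v x = (\<Sum>k. (x / 2) powr (2 * real k + v) * rGamma (real k + v + 1) / fact k)"

definition besselh :: "real \<Rightarrow> real \<Rightarrow> real" where
  "besselh v x = besselI v x / besselI (v - 1) x"

definition gauss_expect :: "nat \<Rightarrow> real \<Rightarrow> ((nat \<Rightarrow> real) \<Rightarrow> real) \<Rightarrow> real" where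
  "gauss_expect m s f = (if s = 0 then f (\<lambda>_. 0) else \<integral>w. f w \<partial>gaussM m s)"

definition at_most_one_sign_change :: "(real \<Rightarrow> real) \<Rightarrow> bool" where
  "at_most_one_sign_change g \<longleftrightarrow>
     \<not> (\<exists>a b c. 0 < a \<and> a < b \<and> b < c \<and>
          ((g a > 0 \<and> g b < 0 \<and> g c > 0) \<or> (g a < 0 \<and> g b > 0 \<and> g c < 0)))"

text \<open>The function of Assumption (A), written with variances u1 = sigma_1^2, u2 = sigma_2^2.\<close>
definition assumptionA_fun :: "real \<Rightarrow> real \<Rightarrow> real \<Rightarrow> nat \<Rightarrow> real \<Rightarrow> real" where
  "assumptionA_fun R u1 u2 n y =
     (1 / u2) * gauss_expect (n + 2) (u2 - u1)
        (\<lambda>w. let r = vnorm (n + 2) (\<lambda>i. (if i = 0 then y else 0) + w i)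
             in R / r * besselh (real n / 2) (R / u2 * r) - 1)
     - (1 / u1) * (R / y * besselh (real n / 2) (R / u1 * y) - 1)"

definition assumptionA :: bool where
  "assumptionA \<longleftrightarrow> (\<forall>R u1 u2 n. 0 \<le> R \<and> 0 < u1 \<and> u1 \<le> u2 \<and> 1 \<le> n \<longrightarrow>
       at_most_one_sign_change (assumptionA_fun R u1 u2 n))"

definition cfun :: "real \<Rightarrow> real \<Rightarrow> real \<Rightarrow> real" where
  "cfun v1 v2 c = integral {v1..v2} (\<lambda>s.
      (c\<^sup>2 / (sqrt s / 2 + sqrt (s / 4 + c\<^sup>2))\<^sup>2
       + c\<^sup>2 * (c\<^sup>2 + s) / (s / 2 + sqrt (s\<^sup>2 / 4 + c\<^sup>2 * (c\<^sup>2 + s)))\<^sup>2 - 1) / s\<^sup>2)"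

end

theory Submission
  imports Defs
begin

text \<open>
Since the channel is degraded, data processing for relative entropy makes the first-order optimality
condition sufficient: the uniform law on the sphere of radius \<open>R\<close> is optimal iff
\<open>\<Xi> x = E ln f\<^sub>2 (x + N\<^sub>2) - E ln f\<^sub>1 (x + N\<^sub>1)\<close>, with \<open>f\<^sub>i\<close> the output densities of that law, satisfies
\<open>\<Xi> x \<le> \<Xi> R\<close> on the ball. \<open>\<Xi>\<close> is radial. The law of \<open>|x + N|\<close> is a Poisson mixture of chi laws with
\<open>n + 2 j\<close> degrees of freedom, and in this form differentiating in the radius amounts to raising the
dimension by 2; hence \<open>\<Xi>'(r) / r\<close> is the radial mean in dimension \<open>n + 2\<close> of the function in
Assumption (A). That function is positive at infinity, and both the chi and the Poisson kernels preserve
a single sign change, so \<open>\<Xi>\<close> first decreases and then increases on \<open>[0, R]\<close>, and the optimality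
condition reduces to \<open>\<Xi> 0 \<le> \<Xi> R\<close>.

With \<open>x = R\<^sup>2 / (n v)\<close>, the concentration of \<open>|x + N|\<close> and Turan-type bounds on the Bessel quotient show
that the contribution of each receiver to \<open>\<Xi> R - \<Xi> 0\<close>, divided by \<open>n\<close>, is within
\<open>8 (sqrt x + x) / sqrt n\<close> of an explicit function \<open>\<beta> x\<close>. The error is uniform in \<open>R\<close>, so no monotonicity
in \<open>R\<close> of the optimality condition is required. Finally
\<open>cfun v1 v2 c = 2 / c\<^sup>2 * (\<beta> (c\<^sup>2 / v1) - \<beta> (c\<^sup>2 / v2))\<close>, and this is strictly increasing in \<open>c\<close>.
\<close>

subsection \<open>Modified Bessel functions\<close>

text \<open>Under Assumption (A), \<open>attainsI\<close> and \<open>attainsD\<close> reduce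
  optimality at fixed \<open>n > 2\<close> and \<open>R > 0\<close> to one inequality between the
  values of \<open>\<Xi>\<close> at the centre and on the sphere. Necessity is tested at the centre:
  moving mass \<open>e\<close> there changes the mean of \<open>\<Xi>\<close> to first order, while
  the divergence that works against it is of order \<open>e\<^sup>2\<close>, because the Gaussian
  density around the centre is at most a constant times the output density. Sign arguments need one
  averaging kernel for both receivers, so the second noise is split into \<open>N\<^sub>1\<close>
  and an independent Gaussian of variance \<open>v2 - v1\<close>; this is the origin of the mean in
  Assumption (A), and its dimension \<open>n + 2\<close> reflects one differentiation in the radius.
  In the limit the obstacle is the supremum in \<open>Rbar\<close>: all radii beyond
  \<open>(c + d) * sqrt n\<close> must be excluded by a single \<open>n\<close>. This works since
  the error grows like \<open>sqrt x + x\<close>, and hence, away from \<open>x = 0\<close>, no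
  faster than the main term, which is of order \<open>x\<close>.\<close>

definition bessel_coeff :: "real \<Rightarrow> nat \<Rightarrow> real" where
  "bessel_coeff \<nu> k = rGamma (\<nu> + real k) / fact k"

text \<open>The entire part of a Bessel function: I_{\<nu>-1}(x) is
  \<open>(x / 2) powr (\<nu> - 1) * bessel_ser \<nu> (x\<^sup>2 / 4)\<close>. The index is shifted
  by one so that the half dimension \<open>n / 2\<close> is the parameter \<nu> itself.\<close>

definition bessel_ser :: "real \<Rightarrow> real \<Rightarrow> real" where
  "bessel_ser \<nu> z = (\<Sum>k. bessel_coeff \<nu> k * z ^ k)"

lemma rGamma_rec: "\<nu> > 0 \<Longrightarrow> rGamma \<nu> = \<nu> * rGamma (\<nu> + 1)" for \<nu> :: real
  by (metis rGamma_plus1)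

lemma bessel_coeff_pos: "\<nu> > 0 \<Longrightarrow> bessel_coeff \<nu> k > 0"
  by (simp add: bessel_coeff_def rGamma_inverse_Gamma Gamma_real_pos add_pos_nonneg)

lemma bessel_coeff_Suc:
  assumes "\<nu> > 0"
  shows "bessel_coeff \<nu> (Suc k) * (real (Suc k) * (\<nu> + real k)) = bessel_coeff \<nu> k"
proof -
  have "rGamma (\<nu> + real k) = (\<nu> + real k) * rGamma (\<nu> + real k + 1)"
    using assms by (intro rGamma_rec) simp
  then show ?thesis
    by (simp add: bessel_coeff_def add_ac)
qed

lemma summable_bessel:
  assumes "\<nu> > 0"
  shows "summable (\<lambda>k. bessel_coeff \<nu> k * z ^ k)"
proof -
  obtain N :: nat where N: "real N > 2 * \<bar>z\<bar> / \<nu>"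
    using reals_Archimedean2 by blast
  show ?thesis
  proof (rule summable_ratio_test[of "1/2" N])
    fix k assume k: "N \<le> k"
    have "2 * \<bar>z\<bar> \<le> real N * \<nu>"
      using N assms by (simp add: field_simps)
    also have "\<dots> \<le> real (Suc k) * (\<nu> + real k)"
      using k assms by (intro mult_mono) auto
    finally have le: "2 * \<bar>z\<bar> \<le> real (Suc k) * (\<nu> + real k)" .
    have p: "bessel_coeff \<nu> (Suc k) > 0" "bessel_coeff \<nu> k > 0"
      using assms bessel_coeff_pos by auto
    have "norm (bessel_coeff \<nu> (Suc k) * z ^ Suc k)
        = bessel_coeff \<nu> (Suc k) * \<bar>z\<bar> * \<bar>z\<bar> ^ k"
      using p by (simp add: abs_mult power_abs)
    also have "\<dots> \<le> bessel_coeff \<nu> (Suc k) * (real (Suc k) * (\<nu> + real k) / 2) * \<bar>z\<bar> ^ k"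
      using p le by (intro mult_right_mono mult_left_mono) auto
    also have "\<dots> = 1 / 2 * (bessel_coeff \<nu> k * \<bar>z\<bar> ^ k)"
      using bessel_coeff_Suc[OF assms, of k] by (simp add: field_simps)
    also have "\<dots> = 1 / 2 * norm (bessel_coeff \<nu> k * z ^ k)"
      using p by (simp add: abs_mult power_abs)
    finally show "norm (bessel_coeff \<nu> (Suc k) * z ^ Suc k) \<le> 1 / 2 * norm (bessel_coeff \<nu> k * z ^ k)" .
  qed simp
qed

lemma diffs_bessel_coeff: "diffs (bessel_coeff \<nu>) = bessel_coeff (\<nu> + 1)"
  by (rule ext) (simp add: diffs_def bessel_coeff_def add_ac)

lemma DERIV_bessel_ser:
  assumes "\<nu> > 0"
  shows "(bessel_ser \<nu> has_field_derivative bessel_ser (\<nu> + 1) z) (at z)"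
  using termdiffs_strong_converges_everywhere[of "bessel_coeff \<nu>" z] summable_bessel[OF assms]
  by (simp add: bessel_ser_def[abs_def] diffs_bessel_coeff)

lemma bessel_ser_pos:
  assumes "\<nu> > 0" "z \<ge> 0"
  shows "bessel_ser \<nu> z > 0"
  unfolding bessel_ser_def
proof (rule suminf_pos2[OF summable_bessel[OF assms(1)], of _ 0])
  show "0 \<le> bessel_coeff \<nu> n * z ^ n" for n
    using bessel_coeff_pos[OF assms(1), of n] assms(2) by simp
  show "0 < bessel_coeff \<nu> 0 * z ^ 0"
    using bessel_coeff_pos[OF assms(1), of 0] by simp
qed

lemma bessel_ser_0: "bessel_ser \<nu> 0 = rGamma \<nu>"
  unfolding bessel_ser_def by (subst powser_zero) (simp add: bessel_coeff_def)

text \<open>The unnormalised mean of \<open>k\<close> under the weights of the series: the factor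
  \<open>k\<close> cancels against the factorial, which raises the index by one.\<close>

lemma sums_bessel_shift:
  assumes "\<nu> > 0"
  shows "(\<lambda>k. bessel_coeff \<nu> k * real k * z ^ k) sums (z * bessel_ser (\<nu> + 1) z)"
proof -
  have "(\<lambda>k. z * (bessel_coeff (\<nu> + 1) k * z ^ k)) sums (z * bessel_ser (\<nu> + 1) z)"
    unfolding bessel_ser_def using assms by (intro sums_mult summable_sums summable_bessel) simp
  moreover have "z * (bessel_coeff (\<nu> + 1) k * z ^ k) = bessel_coeff \<nu> (Suc k) * real (Suc k) * z ^ Suc k" for k
    by (simp add: bessel_coeff_def add_ac)
  ultimately have "(\<lambda>k. bessel_coeff \<nu> (Suc k) * real (Suc k) * z ^ Suc k) sums (z * bessel_ser (\<nu> + 1) z)"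
    by simp
  then show ?thesis
    by (subst (asm) sums_Suc_iff) simp
qed

text \<open>The three-term recurrence of Bessel functions. It holds termwise through
  \<open>bessel_coeff \<nu> k = (\<nu> + k) * bessel_coeff (\<nu> + 1) k\<close>, where the part
  with \<nu> stays at index \<open>\<nu> + 1\<close> and the part with \<open>k\<close> raises the
  index once more.\<close>

lemma bessel_ser_rec:
  assumes "\<nu> > 0"
  shows "bessel_ser \<nu> z = \<nu> * bessel_ser (\<nu> + 1) z + z * bessel_ser (\<nu> + 2) z"
proof -
  have "(\<lambda>k. \<nu> * (bessel_coeff (\<nu> + 1) k * z ^ k) + bessel_coeff (\<nu> + 1) k * real k * z ^ k)
      sums (\<nu> * bessel_ser (\<nu> + 1) z + z * bessel_ser (\<nu> + 1 + 1) z)"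
    using assms unfolding bessel_ser_def[of "\<nu> + 1"]
    by (intro sums_add sums_mult summable_sums summable_bessel sums_bessel_shift) auto
  moreover have "\<nu> * (bessel_coeff (\<nu> + 1) k * z ^ k) + bessel_coeff (\<nu> + 1) k * real k * z ^ k
      = bessel_coeff \<nu> k * z ^ k" for k
  proof -
    have "rGamma (\<nu> + real k) = (\<nu> + real k) * rGamma (\<nu> + real k + 1)"
      using assms by (intro rGamma_rec) simp
    then have "bessel_coeff \<nu> k = (\<nu> + real k) * bessel_coeff (\<nu> + 1) k"
      by (simp add: bessel_coeff_def algebra_simps)
    then show ?thesis by (simp add: algebra_simps)
  qed
  ultimately have "(\<lambda>k. bessel_coeff \<nu> k * z ^ k) sums (\<nu> * bessel_ser (\<nu> + 1) z + z * bessel_ser (\<nu> + 2) z)"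
    by (simp add: add.assoc)
  then show ?thesis
    unfolding bessel_ser_def[of \<nu>] by (rule sums_unique[symmetric])
qed

text \<open>Jensen's inequality for \<open>1 / (\<nu> + k)\<close> under the weights of the series, via the tangent line.\<close>

lemma bessel_ser_jensen:
  assumes "\<nu> > 0" "z \<ge> 0"
  shows "(bessel_ser \<nu> z)\<^sup>2 \<le> bessel_ser (\<nu> + 1) z * (\<nu> * bessel_ser \<nu> z + z * bessel_ser (\<nu> + 1) z)"
proof -
  let ?a = "bessel_ser \<nu> z" and ?b = "bessel_ser (\<nu> + 1) z"
  \<comment> \<open>The mean of \<nu> + k under the weights. The mean of the reciprocal is
    \<open>?b / ?a\<close>, so the claim amounts to \<open>?b / ?a \<ge> 1 / m\<close>.\<close>
  define m where "m = (\<nu> * ?a + z * ?b) / ?a"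
  have a: "?a > 0" and b: "?b > 0" using assms by (auto intro!: bessel_ser_pos)
  have m: "m > 0"
    unfolding m_def using a b assms by (intro divide_pos_pos add_pos_nonneg mult_pos_pos) auto
  have s: "(\<lambda>k. (2 / m - \<nu> / m\<^sup>2) * (bessel_coeff \<nu> k * z ^ k) - 1 / m\<^sup>2 * (bessel_coeff \<nu> k * real k * z ^ k))
     sums ((2 / m - \<nu> / m\<^sup>2) * ?a - 1 / m\<^sup>2 * (z * ?b))"
    unfolding bessel_ser_def[of \<nu>] using assms
    by (intro sums_diff sums_mult summable_sums summable_bessel sums_bessel_shift) auto
  have s': "(\<lambda>k. bessel_coeff (\<nu> + 1) k * z ^ k) sums ?b"
    unfolding bessel_ser_def using assms by (intro summable_sums summable_bessel) auto
  have "(2 / m - \<nu> / m\<^sup>2) * ?a - 1 / m\<^sup>2 * (z * ?b) \<le> ?b"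
  proof (rule sums_le[OF _ s s'])
    fix k
    have nk: "\<nu> + real k > 0" using assms by simp
    have "rGamma (\<nu> + real k) = (\<nu> + real k) * rGamma (\<nu> + real k + 1)"
      using nk by (rule rGamma_rec)
    then have e: "bessel_coeff \<nu> k = (\<nu> + real k) * bessel_coeff (\<nu> + 1) k"
      by (simp add: bessel_coeff_def algebra_simps)
    \<comment> \<open>The tangent to 1/t at m is 2/m - t/m^2. Multiplied by t = \<nu> + k, its
      distance to 1 is a square.\<close>
    have "(2 / m - \<nu> / m\<^sup>2 - real k / m\<^sup>2) * (\<nu> + real k) = 1 - (1 - (\<nu> + real k) / m)\<^sup>2"
      using m by (simp add: power2_eq_square field_simps)
    then have "(2 / m - \<nu> / m\<^sup>2 - real k / m\<^sup>2) * (\<nu> + real k) \<le> 1" by simp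
    then have "((2 / m - \<nu> / m\<^sup>2 - real k / m\<^sup>2) * (\<nu> + real k)) * (bessel_coeff (\<nu> + 1) k * z ^ k)
        \<le> 1 * (bessel_coeff (\<nu> + 1) k * z ^ k)"
      using bessel_coeff_pos[of "\<nu> + 1" k] assms by (intro mult_right_mono) auto
    then show "(2 / m - \<nu> / m\<^sup>2) * (bessel_coeff \<nu> k * z ^ k) - 1 / m\<^sup>2 * (bessel_coeff \<nu> k * real k * z ^ k)
        \<le> bessel_coeff (\<nu> + 1) k * z ^ k"
      unfolding e by (simp add: algebra_simps add_divide_distrib)
  qed
  moreover have "(2 / m - \<nu> / m\<^sup>2) * ?a - 1 / m\<^sup>2 * (z * ?b) = ?a / m"
  proof -
    have "\<nu> * ?a + z * ?b = m * ?a" using a by (simp add: m_def)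
    then have "2 * ?a / m - (m * ?a) / m\<^sup>2 = (2 / m - \<nu> / m\<^sup>2) * ?a - 1 / m\<^sup>2 * (z * ?b)"
      by (metis (no_types) add_divide_distrib diff_diff_eq left_diff_distrib mult_1 times_divide_eq_left)
    then have "(2 / m - \<nu> / m\<^sup>2) * ?a - 1 / m\<^sup>2 * (z * ?b) = 2 * ?a / m - (m * ?a) / m\<^sup>2"
      by simp
    then show ?thesis using m by (simp add: power2_eq_square)
  qed
  ultimately have "?a / m \<le> ?b" by simp
  then have "?a \<le> ?b * m" using m by (simp add: field_simps)
  then have "?a * ?a \<le> (?b * m) * ?a" using a by (intro mult_right_mono) auto
  then show ?thesis using a by (simp add: m_def power2_eq_square)
qed

text \<open>Inserting the recurrence for one factor of the square in the Jensen bound makes the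
  terms with \<nu> cancel; what remains is the Turan inequality multiplied by
  \<open>z\<close>.\<close>

lemma bessel_ser_turan:
  assumes "\<nu> > 0" "z > 0"
  shows "bessel_ser \<nu> z * bessel_ser (\<nu> + 2) z \<le> (bessel_ser (\<nu> + 1) z)\<^sup>2"
proof -
  let ?a = "bessel_ser \<nu> z" and ?b = "bessel_ser (\<nu> + 1) z" and ?c = "bessel_ser (\<nu> + 2) z"
  have r: "?a = \<nu> * ?b + z * ?c" by (rule bessel_ser_rec[OF assms(1)])
  have "?a * (\<nu> * ?b + z * ?c) \<le> ?b * (\<nu> * ?a + z * ?b)"
    using bessel_ser_jensen[of \<nu> z] assms by (subst r[symmetric]) (simp add: power2_eq_square)
  then have "z * (?a * ?c) \<le> z * ?b\<^sup>2"
    by (simp add: algebra_simps power2_eq_square)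
  then show ?thesis using assms by simp
qed

lemma besselI_eq_ser:
  assumes "x > 0" "\<nu> > 0"
  shows "besselI (\<nu> - 1) x = (x / 2) powr (\<nu> - 1) * bessel_ser \<nu> (x\<^sup>2 / 4)"
proof -
  have "(x / 2) powr (2 * real k + (\<nu> - 1)) = (x / 2) powr (\<nu> - 1) * (x\<^sup>2 / 4) ^ k" for k
  proof -
    have "(x / 2) powr (2 * real k + (\<nu> - 1)) = (x / 2) powr (\<nu> - 1) * (x / 2) powr (real (2 * k))"
      by (subst powr_add[symmetric]) (simp add: add.commute)
    also have "(x / 2) powr (real (2 * k)) = (x / 2) ^ (2 * k)"
      using assms by (subst powr_realpow) auto
    also have "\<dots> = (x\<^sup>2 / 4) ^ k"
      by (simp add: power_mult power_divide)
    finally show ?thesis .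
  qed
  then have "besselI (\<nu> - 1) x = (\<Sum>k. (x / 2) powr (\<nu> - 1) * (bessel_coeff \<nu> k * (x\<^sup>2 / 4) ^ k))"
    unfolding besselI_def bessel_coeff_def by (simp add: algebra_simps)
  also have "\<dots> = (x / 2) powr (\<nu> - 1) * bessel_ser \<nu> (x\<^sup>2 / 4)"
    by (simp add: suminf_mult[OF summable_bessel[OF assms(2)]] bessel_ser_def)
  finally show ?thesis .
qed

text \<open>The quotient I_\<nu> / I_{\<nu>-1} with the common real power cancelled. In this form it
  is continuous at 0 and is the derivative of \<open>log_bessel\<close> there as well.\<close>

definition bessel_ratio :: "real \<Rightarrow> real \<Rightarrow> real" where
  "bessel_ratio \<nu> t = t / 2 * bessel_ser (\<nu> + 1) (t\<^sup>2 / 4) / bessel_ser \<nu> (t\<^sup>2 / 4)"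

lemma besselh_eq_bessel_ratio:
  assumes "x > 0" "\<nu> > 0"
  shows "besselh \<nu> x = bessel_ratio \<nu> x"
proof -
  have 1: "besselI \<nu> x = (x / 2) powr \<nu> * bessel_ser (\<nu> + 1) (x\<^sup>2 / 4)"
    using besselI_eq_ser[of x "\<nu> + 1"] assms by simp
  have 2: "(x / 2) powr \<nu> = (x / 2) powr (\<nu> - 1) * (x / 2)"
    using assms by (simp add: powr_diff)
  have "besselh \<nu> x = ((x / 2) powr (\<nu> - 1) * (x / 2 * bessel_ser (\<nu> + 1) (x\<^sup>2 / 4)))
      / ((x / 2) powr (\<nu> - 1) * bessel_ser \<nu> (x\<^sup>2 / 4))"
    unfolding besselh_def besselI_eq_ser[OF assms] 1 2 by (simp only: mult.assoc)
  also have "\<dots> = bessel_ratio \<nu> x"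
    using assms by (subst mult_divide_mult_cancel_left) (auto simp: bessel_ratio_def)
  finally show ?thesis .
qed

section \<open>Bounds on the quotient of consecutive Bessel functions\<close>

lemma bessel_ratio_nonneg: "\<nu> > 0 \<Longrightarrow> t \<ge> 0 \<Longrightarrow> bessel_ratio \<nu> t \<ge> 0"
  unfolding bessel_ratio_def
  using bessel_ser_pos[of \<nu> "t\<^sup>2 / 4"] bessel_ser_pos[of "\<nu> + 1" "t\<^sup>2 / 4"] by simp

text \<open>The Jensen bound divided by the square of \<open>bessel_ser \<nu> z\<close> at
  \<open>z = t\<^sup>2 / 4\<close>.\<close>

lemma bessel_ratio_lower:
  assumes "\<nu> > 0" "t > 0"
  shows "(bessel_ratio \<nu> t)\<^sup>2 + 2 * \<nu> * bessel_ratio \<nu> t / t \<ge> 1"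
proof -
  define z where "z = t\<^sup>2 / 4"
  have a: "bessel_ser \<nu> z > 0" using assms by (auto intro!: bessel_ser_pos simp: z_def)
  have j: "(bessel_ser \<nu> z)\<^sup>2 \<le> bessel_ser (\<nu> + 1) z * (\<nu> * bessel_ser \<nu> z + z * bessel_ser (\<nu> + 1) z)"
    using assms by (intro bessel_ser_jensen) (auto simp: z_def)
  have "(bessel_ratio \<nu> t)\<^sup>2 + 2 * \<nu> * bessel_ratio \<nu> t / t
     = (bessel_ser (\<nu> + 1) z * (\<nu> * bessel_ser \<nu> z + z * bessel_ser (\<nu> + 1) z)) / (bessel_ser \<nu> z)\<^sup>2"
    using a assms by (simp add: bessel_ratio_def z_def[symmetric] power2_eq_square field_simps)
      (simp add: z_def power2_eq_square)
  also have "\<dots> \<ge> 1" using j a by simp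
  finally show ?thesis .
qed

text \<open>The Turan inequality at index \<open>\<nu> - 1\<close>, divided by the square of the
  middle term and rewritten by the recurrence; the shifted index is the reason for
  \<open>\<nu> > 1\<close>. It differs from the lower bound only by \<open>\<nu> - 1\<close> in
  place of \<nu>, a relative change that disappears for large \<nu>.\<close>

lemma bessel_ratio_upper:
  assumes "\<nu> > 1" "t > 0"
  shows "(bessel_ratio \<nu> t)\<^sup>2 + 2 * (\<nu> - 1) * bessel_ratio \<nu> t / t \<le> 1"
proof -
  define z where "z = t\<^sup>2 / 4"
  have z: "z > 0" using assms by (simp add: z_def)
  have a: "bessel_ser \<nu> z > 0" using assms z by (auto intro!: bessel_ser_pos)
  have t: "bessel_ser (\<nu> - 1) z * bessel_ser (\<nu> + 1) z \<le> (bessel_ser \<nu> z)\<^sup>2"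
    using bessel_ser_turan[of "\<nu> - 1" z] assms z by (simp add: add.commute)
  have r: "bessel_ser (\<nu> - 1) z = (\<nu> - 1) * bessel_ser \<nu> z + z * bessel_ser (\<nu> + 1) z"
    using bessel_ser_rec[of "\<nu> - 1" z] assms by (simp add: add.commute)
  have "2 * (\<nu> - 1) * bessel_ratio \<nu> t / t = (\<nu> - 1) * bessel_ser (\<nu> + 1) z / bessel_ser \<nu> z"
  proof -
    have "2 * bessel_ratio \<nu> t / t = bessel_ser (\<nu> + 1) z / bessel_ser \<nu> z"
      using assms by (simp add: bessel_ratio_def z_def[symmetric])
    then show ?thesis by (metis mult.assoc mult.left_commute times_divide_eq_right)
  qed
  moreover have "(bessel_ratio \<nu> t)\<^sup>2 = z * (bessel_ser (\<nu> + 1) z)\<^sup>2 / (bessel_ser \<nu> z)\<^sup>2"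
    unfolding bessel_ratio_def z_def[symmetric] by (simp add: power_mult_distrib power_divide z_def)
  ultimately have "(bessel_ratio \<nu> t)\<^sup>2 + 2 * (\<nu> - 1) * bessel_ratio \<nu> t / t
     = z * (bessel_ser (\<nu> + 1) z)\<^sup>2 / (bessel_ser \<nu> z)\<^sup>2 + (\<nu> - 1) * bessel_ser (\<nu> + 1) z / bessel_ser \<nu> z"
    by simp
  also have "\<dots> = (bessel_ser (\<nu> - 1) z * bessel_ser (\<nu> + 1) z) / (bessel_ser \<nu> z)\<^sup>2"
    unfolding r using a by (simp add: power2_eq_square field_simps)
  also have "\<dots> \<le> 1" using t a by simp
  finally show ?thesis .
qed

text \<open>Drops the last term of the recurrence. This linear bound controls the quotient near
  \<open>t = 0\<close>, where it has to compensate a factor of order 1/t.\<close>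

lemma bessel_ratio_le_lin:
  assumes "\<nu> > 0" "t \<ge> 0"
  shows "2 * \<nu> * bessel_ratio \<nu> t \<le> t"
proof -
  define z where "z = t\<^sup>2 / 4"
  have z: "z \<ge> 0" by (simp add: z_def)
  have p: "bessel_ser \<nu> z > 0" "bessel_ser (\<nu> + 2) z > 0" using assms z by (auto intro!: bessel_ser_pos)
  have "\<nu> * bessel_ser (\<nu> + 1) z \<le> bessel_ser \<nu> z"
    using bessel_ser_rec[of \<nu> z] assms p z by simp
  then have "\<nu> * bessel_ser (\<nu> + 1) z / bessel_ser \<nu> z \<le> 1" using p by simp
  then have "t * (\<nu> * bessel_ser (\<nu> + 1) z / bessel_ser \<nu> z) \<le> t * 1"
    using assms by (intro mult_left_mono)
  then show ?thesis by (simp add: bessel_ratio_def z_def[symmetric] field_simps)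
qed

lemma bessel_ratio_le_1:
  assumes "\<nu> > 1" "t \<ge> 0"
  shows "bessel_ratio \<nu> t \<le> 1"
proof (cases "t = 0")
  case False
  then have "(bessel_ratio \<nu> t)\<^sup>2 \<le> 1"
    using bessel_ratio_upper[of \<nu> t] bessel_ratio_nonneg[of \<nu> t] assms
    by (smt (verit) divide_nonneg_pos mult_nonneg_nonneg)
  then show ?thesis using abs_le_square_iff[of "bessel_ratio \<nu> t" 1] by simp
qed (simp add: bessel_ratio_def)

text \<open>For \<nu> = n/2 this is the cumulant generating function of one coordinate under the
  uniform law on the unit sphere in dimension \<open>n\<close>; compare
  \<open>sphere_exp\<close>.\<close>

definition log_bessel :: "real \<Rightarrow> real \<Rightarrow> real" where
  "log_bessel \<nu> t = ln (bessel_ser \<nu> (t\<^sup>2 / 4)) - ln (rGamma \<nu>)"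

lemma log_bessel_0: "log_bessel \<nu> 0 = 0"
  by (simp add: log_bessel_def bessel_ser_0)

lemma DERIV_log_bessel:
  assumes "\<nu> > 0"
  shows "(log_bessel \<nu> has_real_derivative bessel_ratio \<nu> t) (at t)"
proof -
  have p: "bessel_ser \<nu> (t\<^sup>2 / 4) > 0" using assms by (intro bessel_ser_pos) auto
  show ?thesis
    unfolding log_bessel_def bessel_ratio_def
    by (rule derivative_eq_intros DERIV_chain2[OF DERIV_bessel_ser[OF assms]] refl p | simp add: mult.commute)+
qed

lemma log_bessel_lipschitz:
  assumes "\<nu> > 1" "s \<ge> 0" "t \<ge> 0"
  shows "\<bar>log_bessel \<nu> s - log_bessel \<nu> t\<bar> \<le> \<bar>s - t\<bar>"
proof -
  have "norm (log_bessel \<nu> s - log_bessel \<nu> t) \<le> 1 * norm (s - t)"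
  proof (rule field_differentiable_bound[of "{0..}"])
    show "(log_bessel \<nu> has_field_derivative bessel_ratio \<nu> z) (at z within {0..})" for z
      using DERIV_log_bessel[of \<nu> z] assms by (auto intro: DERIV_subset)
    show "norm (bessel_ratio \<nu> z) \<le> 1" if "z \<in> {0..}" for z
      using that bessel_ratio_le_1[of \<nu> z] bessel_ratio_nonneg[of \<nu> z] assms by auto
  qed (use assms in auto)
  then show ?thesis by simp
qed

lemma log_bessel_nonneg:
  assumes "\<nu> > 0" "t \<ge> 0"
  shows "log_bessel \<nu> t \<ge> 0"
  using DERIV_nonneg_imp_nondecreasing[of 0 t "log_bessel \<nu>"] DERIV_log_bessel[OF assms(1)] bessel_ratio_nonneg[OF assms(1)] assms(2)
  by (metis log_bessel_0)

text \<open>The primitive, vanishing at 0, of the positive root 2 \<tau> / (1 + sqrt (1 + 4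
  \<tau>^2)) of u^2 + u / \<tau> = 1. It is the limit of
  \<open>log_bessel (n / 2) (n * \<tau>) / n\<close>.\<close>

definition kappa_lim :: "real \<Rightarrow> real" where
  "kappa_lim \<tau> = (sqrt (1 + 4 * \<tau>\<^sup>2) - 1) / 2 - ln ((1 + sqrt (1 + 4 * \<tau>\<^sup>2)) / 2) / 2"

lemma DERIV_kappa_lim: "(kappa_lim has_real_derivative 2 * \<tau> / (1 + sqrt (1 + 4 * \<tau>\<^sup>2))) (at \<tau>)"
proof -
  define w where "w = (\<lambda>\<tau>::real. sqrt (1 + 4 * \<tau>\<^sup>2))"
  have p: "1 + 4 * \<tau>\<^sup>2 > 0" by (intro add_pos_nonneg) auto
  have w: "w \<tau> \<ge> 1" unfolding w_def by simp
  have W: "(w has_real_derivative 4 * \<tau> / w \<tau>) (at \<tau>)"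
    unfolding w_def using p by (auto intro!: derivative_eq_intros simp: field_simps)
  have "((\<lambda>\<tau>. (w \<tau> - 1) / 2 - ln ((1 + w \<tau>) / 2) / 2) has_real_derivative
      (4 * \<tau> / w \<tau>) / 2 - (4 * \<tau> / w \<tau>) / 2 / ((1 + w \<tau>) / 2) / 2) (at \<tau>)"
    by (rule derivative_eq_intros W refl | use w in simp)+
  moreover have "(4 * \<tau> / w \<tau>) / 2 - (4 * \<tau> / w \<tau>) / 2 / ((1 + w \<tau>) / 2) / 2 = 2 * \<tau> / (1 + w \<tau>)"
    using w by (simp add: divide_simps) (simp add: algebra_simps)
  ultimately show ?thesis unfolding w_def kappa_lim_def[abs_def] by simp
qed

text \<open>The two Riccati-type bounds pin \<open>bessel_ratio\<close> to the positive root of \<open>u\<^sup>2 + u / \<tau> = 1\<close>.\<close>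

lemma bessel_ratio_kappa_lim_bounds:
  assumes n: "n > 2" and t: "\<tau> > 0"
  defines "u \<equiv> 2 * \<tau> / (1 + sqrt (1 + 4 * \<tau>\<^sup>2))"
  shows "u \<le> bessel_ratio (n / 2) (n * \<tau>)" and "bessel_ratio (n / 2) (n * \<tau>) \<le> u + 2 / n"
proof -
  define h where "h = bessel_ratio (n / 2) (n * \<tau>)"
  define w where "w = sqrt (1 + 4 * \<tau>\<^sup>2)"
  have w: "w \<ge> 1" unfolding w_def by simp
  have w2: "w\<^sup>2 = 1 + 4 * \<tau>\<^sup>2" unfolding w_def by simp
  have u: "u = 2 * \<tau> / (1 + w)" by (simp add: u_def w_def)
  have up: "u > 0" using w t by (simp add: u)
  have hp: "h \<ge> 0" unfolding h_def using n t by (intro bessel_ratio_nonneg) auto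
  have uq: "u\<^sup>2 + u / \<tau> = 1"
  proof -
    have "u\<^sup>2 + u / \<tau> = (4 * \<tau>\<^sup>2 + 2 * (1 + w)) / (1 + w)\<^sup>2"
    proof -
      have "u / \<tau> = 2 / (1 + w)" using t by (simp add: u)
      moreover have "2 / (1 + w) = 2 * (1 + w) / (1 + w)\<^sup>2" using w by (simp add: power2_eq_square divide_simps)
      ultimately show ?thesis by (simp add: u power_divide power_mult_distrib add_divide_distrib)
    qed
    also have "4 * \<tau>\<^sup>2 = w\<^sup>2 - 1" using w2 by simp
    also have "w\<^sup>2 - 1 + 2 * (1 + w) = (1 + w)\<^sup>2" by (simp add: power2_eq_square algebra_simps)
    finally show ?thesis using w by simp
  qed
  have uu: "u + 1 / \<tau> = 1 / u" using uq up t by (simp add: field_simps power2_eq_square)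
  have u1: "u \<le> 1"
  proof -
    have "u * u \<le> 1" using uq up t by (smt (verit) divide_pos_pos power2_eq_square)
    then show ?thesis by (smt (verit) mult_le_cancel_left1)
  qed
  have lo: "h\<^sup>2 + h / \<tau> \<ge> 1"
    using bessel_ratio_lower[of "n / 2" "n * \<tau>"] n t unfolding h_def by simp
  have hi: "h\<^sup>2 + (n - 2) * h / (n * \<tau>) \<le> 1"
    using bessel_ratio_upper[of "n / 2" "n * \<tau>"] n t unfolding h_def by (simp add: field_simps)
  have lin: "h / \<tau> \<le> 1"
    using bessel_ratio_le_lin[of "n / 2" "n * \<tau>"] n t unfolding h_def by (simp add: field_simps)
  \<comment> \<open>The other root of the quadratic is -(u + 1 / \<tau>) = -1/u. As u is at most 1,
    the second factor is at least 1, so the residual of \<open>h\<close> in the equation bounds its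
    distance to \<open>u\<close>.\<close>
  have f: "(h - u) * (h + u + 1 / \<tau>) = h\<^sup>2 + h / \<tau> - 1"
    using uq by (simp add: algebra_simps power2_eq_square diff_divide_distrib)
  have pos: "h + u + 1 / \<tau> \<ge> 1"
    using uu u1 up hp by (smt (verit) le_divide_eq_1_pos)
  have "(h - u) * (h + u + 1 / \<tau>) \<ge> 0" using f lo by simp
  then have hu: "h - u \<ge> 0" using pos by (simp add: zero_le_mult_iff)
  then show "u \<le> bessel_ratio (n / 2) (n * \<tau>)" by (simp add: h_def)
  \<comment> \<open>The lower bound has coefficient n and the upper one n - 2; the gap is 2/n times
    h / \<tau>, and h / \<tau> is at most 1 by the linear bound.\<close>
  have "h\<^sup>2 + h / \<tau> = h\<^sup>2 + (n - 2) * h / (n * \<tau>) + 2 / n * (h / \<tau>)"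
    using n t by (simp add: field_simps)
  also have "\<dots> \<le> 1 + 2 / n * 1" using hi lin n by (intro add_mono mult_left_mono) auto
  finally have "(h - u) * (h + u + 1 / \<tau>) \<le> 2 / n" using f by simp
  moreover have "(h - u) * 1 \<le> (h - u) * (h + u + 1 / \<tau>)" using hu pos by (intro mult_left_mono)
  ultimately show "bessel_ratio (n / 2) (n * \<tau>) \<le> u + 2 / n" by (simp add: h_def)
qed

text \<open>Both functions of \<tau> vanish at 0, and their derivatives differ by at most 2/n by the
  preceding bounds. The factor \<tau> on the right keeps the estimate uniform in \<tau>.\<close>

lemma log_bessel_kappa_lim:
  assumes n: "n > 2" and t: "\<tau> \<ge> 0"
  shows "\<bar>log_bessel (n / 2) (n * \<tau>) / n - kappa_lim \<tau>\<bar> \<le> 2 / n * \<tau>"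
proof -
  define f where "f = (\<lambda>\<tau>. log_bessel (n / 2) (n * \<tau>) / n - kappa_lim \<tau>)"
  define f' where "f' = (\<lambda>\<tau>. bessel_ratio (n / 2) (n * \<tau>) - 2 * \<tau> / (1 + sqrt (1 + 4 * \<tau>\<^sup>2)))"
  have D: "(f has_real_derivative f' x) (at x)" for x
    unfolding f_def f'_def using n
    by (auto intro!: derivative_eq_intros DERIV_chain2[OF DERIV_log_bessel] DERIV_kappa_lim)
  have b: "\<bar>f' x\<bar> \<le> 2 / n" if "x \<ge> 0" for x
  proof (cases "x = 0")
    case False
    then show ?thesis using bessel_ratio_kappa_lim_bounds[OF n, of x] that by (auto simp: f'_def)
  qed (use n in \<open>simp add: f'_def bessel_ratio_def\<close>)
  have "norm (f \<tau> - f 0) \<le> 2 / n * norm (\<tau> - 0)"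
  proof (rule field_differentiable_bound[of "{0..}"])
    show "(f has_field_derivative f' z) (at z within {0..})" for z
      using D by (auto intro: DERIV_subset)
  qed (use b t in auto)
  moreover have "f 0 = 0" by (simp add: f_def log_bessel_0 kappa_lim_def)
  ultimately show ?thesis using t by (simp add: f_def)
qed

subsection \<open>Lebesgue and Gaussian measures on coordinate spaces\<close>

lemma sets_Ln[measurable_cong]: "sets (Ln n) = sets (Rn n)"
  unfolding Ln_def Rn_def by (intro sets_PiM_cong) auto

lemma space_Ln: "space (Ln n) = space (Rn n)"
  by (rule sets_eq_imp_space_eq[OF sets_Ln])

lemma space_Rn: "space (Rn n) = {..<n} \<rightarrow>\<^sub>E UNIV"
  by (simp add: Rn_def space_PiM)

lemma measurable_coord: "i < n \<Longrightarrow> (\<lambda>x. x i) \<in> borel_measurable (Rn n)"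
  unfolding Rn_def by measurable

lemma measurable_vnorm[measurable]: "vnorm n \<in> borel_measurable (Rn n)"
  supply measurable_coord[measurable] unfolding vnorm_def[abs_def] by measurable

lemma vnorm_nonneg[simp]: "vnorm n x \<ge> 0"
  by (simp add: vnorm_def sum_nonneg)

lemma vnorm_sq: "(vnorm n x)\<^sup>2 = (\<Sum>i<n. (x i)\<^sup>2)"
  by (simp add: vnorm_def sum_nonneg)

definition dotp :: "nat \<Rightarrow> (nat \<Rightarrow> real) \<Rightarrow> (nat \<Rightarrow> real) \<Rightarrow> real" where
  "dotp n y w = (\<Sum>i<n. y i * w i)"

lemma measurable_dotp[measurable]: "dotp n y \<in> borel_measurable (Rn n)"
  supply measurable_coord[measurable] unfolding dotp_def[abs_def] by measurable

lemma measurable_vadd[measurable (raw)]: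
  assumes [measurable]: "f \<in> M \<rightarrow>\<^sub>M Rn n" "g \<in> M \<rightarrow>\<^sub>M Rn n"
  shows "(\<lambda>x. vadd n (f x) (g x)) \<in> M \<rightarrow>\<^sub>M Rn n"
proof -
  have [measurable]: "(\<lambda>x. f x i) \<in> borel_measurable M" "(\<lambda>x. g x i) \<in> borel_measurable M" if "i < n" for i
    by (rule measurable_compose[OF _ measurable_coord[OF that]], fact)+
  then show ?thesis
    unfolding vadd_def[abs_def] Rn_def by (intro measurable_restrict) auto
qed

definition vaffine :: "nat \<Rightarrow> (nat \<Rightarrow> real) \<Rightarrow> real \<Rightarrow> (nat \<Rightarrow> real) \<Rightarrow> (nat \<Rightarrow> real)" where
  "vaffine n a c w = (\<lambda>i\<in>{..<n}. a i + c * w i)"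

lemma measurable_vaffine[measurable]: "vaffine n a c \<in> Rn n \<rightarrow>\<^sub>M Rn n"
proof -
  have [measurable]: "(\<lambda>x. x i) \<in> borel_measurable (Rn n)" if "i < n" for i
    using that by (rule measurable_coord)
  then show ?thesis
    unfolding vaffine_def[abs_def] Rn_def by (intro measurable_restrict) auto
qed

text \<open>On boxes this is the one-dimensional substitution in every coordinate; uniqueness of the
  product measure extends it to all measurable functions.\<close>

lemma nn_integral_Ln_affine:
  assumes c: "c \<noteq> 0" and H[measurable]: "H \<in> borel_measurable (Rn n)"
  shows "ennreal (\<bar>c\<bar> ^ n) * (\<integral>\<^sup>+w. H (vaffine n a c w) \<partial>Ln n) = (\<integral>\<^sup>+w. H w \<partial>Ln n)"
proof -
  interpret product_sigma_finite "\<lambda>_::nat. lborel :: real measure" ..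
  define P where "P = scale_measure (ennreal (\<bar>c\<bar> ^ n)) (distr (Ln n) (Ln n) (vaffine n a c))"
  have "P = PiM {..<n} (\<lambda>_. lborel)"
  proof (rule PiM_eqI)
    show "sets P = sets (PiM {..<n} (\<lambda>_. lborel))"
      by (simp add: P_def Ln_def)
    fix A :: "nat \<Rightarrow> real set" assume A: "\<And>i. i \<in> {..<n} \<Longrightarrow> A i \<in> sets lborel"
    have AS: "Pi\<^sub>E {..<n} A \<in> sets (Ln n)"
      unfolding Ln_def using A by (intro sets_PiM_I_finite) auto
    have pre: "vaffine n a c -` Pi\<^sub>E {..<n} A \<inter> space (Ln n) = Pi\<^sub>E {..<n} (\<lambda>i. (\<lambda>x. a i + c * x) -` A i)"
      by (auto simp: vaffine_def Ln_def space_PiM PiE_iff extensional_def)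
    have meas: "(\<lambda>x. a i + c * x) -` A i \<in> sets lborel" if "i < n" for i
    proof -
      have [measurable]: "A i \<in> sets borel" using A[of i] that by simp
      have "(\<lambda>x. a i + c * x) -` A i \<inter> space borel \<in> sets borel"
        by (rule measurable_sets[of _ borel borel]) auto
      then show ?thesis by simp
    qed
    have one: "emeasure lborel (A i) = ennreal \<bar>c\<bar> * emeasure lborel ((\<lambda>x. a i + c * x) -` A i)" if "i < n" for i
    proof -
      have [measurable]: "A i \<in> sets borel" using A[of i] that by simp
      have "emeasure lborel (A i) = (\<integral>\<^sup>+x. indicator (A i) x \<partial>lborel)" by simp
      also have "\<dots> = ennreal \<bar>c\<bar> * (\<integral>\<^sup>+x. indicator (A i) (a i + c * x) \<partial>lborel)"
        by (rule nn_integral_real_affine) (use c in auto)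
      also have "(\<lambda>x. indicator (A i) (a i + c * x) :: ennreal) = indicator ((\<lambda>x. a i + c * x) -` A i)"
        by (auto simp: indicator_def)
      also have "(\<integral>\<^sup>+x. indicator ((\<lambda>x. a i + c * x) -` A i) x \<partial>lborel) = emeasure lborel ((\<lambda>x. a i + c * x) -` A i)"
        using meas[OF that] by (intro nn_integral_indicator)
      finally show ?thesis .
    qed
    have "emeasure P (Pi\<^sub>E {..<n} A) = ennreal (\<bar>c\<bar> ^ n) * emeasure (Ln n) (vaffine n a c -` Pi\<^sub>E {..<n} A \<inter> space (Ln n))"
      unfolding P_def using AS by (subst emeasure_scale_measure, subst emeasure_distr) auto
    also have "\<dots> = ennreal (\<bar>c\<bar> ^ n) * (\<Prod>i<n. emeasure lborel ((\<lambda>x. a i + c * x) -` A i))"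
      unfolding pre unfolding Ln_def using meas by (subst emeasure_PiM) auto
    also have "\<dots> = (\<Prod>i<n. ennreal \<bar>c\<bar> * emeasure lborel ((\<lambda>x. a i + c * x) -` A i))"
      by (simp add: prod.distrib ennreal_power)
    also have "\<dots> = (\<Prod>i\<in>{..<n}. emeasure lborel (A i))"
      using one by (intro prod.cong) auto
    finally show "emeasure P (Pi\<^sub>E {..<n} A) = (\<Prod>i\<in>{..<n}. emeasure lborel (A i))" .
  qed auto
  then have "(\<integral>\<^sup>+w. H w \<partial>Ln n) = (\<integral>\<^sup>+w. H w \<partial>P)"
    by (simp add: Ln_def)
  also have "\<dots> = ennreal (\<bar>c\<bar> ^ n) * (\<integral>\<^sup>+w. H (vaffine n a c w) \<partial>Ln n)"
    unfolding P_def by (subst nn_integral_scale_measure, simp, subst nn_integral_distr) auto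
  finally show ?thesis by simp
qed

lemma vnorm_scale: "vnorm n (vaffine n (\<lambda>_. 0) c w) = \<bar>c\<bar> * vnorm n w"
proof -
  have "(\<Sum>i<n. (vaffine n (\<lambda>_. 0) c w i)\<^sup>2) = c\<^sup>2 * (\<Sum>i<n. (w i)\<^sup>2)"
    by (simp add: vaffine_def power_mult_distrib sum_distrib_left)
  then show ?thesis by (simp add: vnorm_def real_sqrt_mult)
qed

lemma dotp_scale: "dotp n y (vaffine n (\<lambda>_. 0) c w) = c * dotp n y w"
  by (simp add: dotp_def vaffine_def sum_distrib_left algebra_simps)

section \<open>The Gaussian measure and its moments along a direction\<close>

lemma gauss_density_prod:
  assumes "v > 0"
  shows "gauss_density n v x = (\<Prod>i<n. normal_density 0 (sqrt v) (x i))"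
proof -
  have "(2 * pi * v) powr (- real n / 2) = (1 / sqrt (2 * pi * v)) ^ n"
  proof -
    have "(2 * pi * v) powr (- real n / 2) = ((2 * pi * v) powr (- 1 / 2)) powr (real n)"
      by (simp add: powr_powr)
    also have "(2 * pi * v) powr (- 1 / 2) = 1 / sqrt (2 * pi * v)"
      using assms by (simp add: powr_minus_divide powr_half_sqrt)
    also have "\<dots> powr (real n) = (1 / sqrt (2 * pi * v)) ^ n"
      using assms by (subst powr_realpow) auto
    finally show ?thesis .
  qed
  then show ?thesis
    using assms by (simp add: gauss_density_def normal_density_def prod.distrib exp_sum[symmetric]
      vnorm_sq sum_negf sum_divide_distrib power_divide prod_dividef)
qed

lemma gaussM_PiM:
  assumes "v > 0"
  shows "gaussM n v = PiM {..<n} (\<lambda>_. density lborel (normal_density 0 (sqrt v)))"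
proof -
  let ?N = "density lborel (\<lambda>x. ennreal (normal_density 0 (sqrt v) x))"
  interpret L: product_sigma_finite "\<lambda>_::nat. lborel :: real measure" ..
  interpret N: prob_space ?N using assms by (intro prob_space_normal_density) simp
  interpret N: product_sigma_finite "\<lambda>_::nat. ?N" ..
  have g[measurable]: "(\<lambda>x. \<Prod>i<n. normal_density 0 (sqrt v) (x i)) \<in> borel_measurable (Rn n)"
    by (intro borel_measurable_prod measurable_compose[OF measurable_coord]) auto
  show ?thesis
  proof (rule N.PiM_eqI)
    show "sets (gaussM n v) = sets (PiM {..<n} (\<lambda>_. ?N))"
      unfolding gaussM_def Ln_def by (simp, intro sets_PiM_cong) auto
    fix A :: "nat \<Rightarrow> real set" assume A: "\<And>i. i \<in> {..<n} \<Longrightarrow> A i \<in> sets ?N"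
    have AS: "Pi\<^sub>E {..<n} A \<in> sets (Ln n)"
      unfolding Ln_def using A by (intro sets_PiM_I_finite) auto
    have "emeasure (gaussM n v) (Pi\<^sub>E {..<n} A)
        = (\<integral>\<^sup>+x. ennreal (\<Prod>i<n. normal_density 0 (sqrt v) (x i)) * indicator (Pi\<^sub>E {..<n} A) x \<partial>Ln n)"
      unfolding gaussM_def gauss_density_prod[OF assms] using AS g
      by (subst emeasure_density) auto
    also have "\<dots> = (\<integral>\<^sup>+x. (\<Prod>i<n. ennreal (normal_density 0 (sqrt v) (x i)) * indicator (A i) (x i)) \<partial>Ln n)"
    proof (rule nn_integral_cong)
      fix x assume "x \<in> space (Ln n)"
      then have "x \<in> extensional {..<n}" by (auto simp: Ln_def space_PiM PiE_iff)
      then have "(indicator (Pi\<^sub>E {..<n} A) x :: ennreal) = (\<Prod>i<n. indicator (A i) (x i))"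
        by (auto simp: indicator_def PiE_iff prod_zero_iff)
      then show "ennreal (\<Prod>i<n. normal_density 0 (sqrt v) (x i)) * indicator (Pi\<^sub>E {..<n} A) x
        = (\<Prod>i<n. ennreal (normal_density 0 (sqrt v) (x i)) * indicator (A i) (x i))"
        by (simp add: prod.distrib prod_ennreal)
    qed
    also have "\<dots> = (\<Prod>i<n. (\<integral>\<^sup>+x. ennreal (normal_density 0 (sqrt v) x) * indicator (A i) x \<partial>lborel))"
      unfolding Ln_def using A by (intro L.product_nn_integral_prod) auto
    also have "\<dots> = (\<Prod>i\<in>{..<n}. emeasure ?N (A i))"
      using A by (intro prod.cong) (auto simp: emeasure_density)
    finally show "emeasure (gaussM n v) (Pi\<^sub>E {..<n} A) = (\<Prod>i\<in>{..<n}. emeasure ?N (A i))" .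
  qed auto
qed

lemma sets_gaussM[measurable_cong]: "sets (gaussM n v) = sets (Rn n)"
  by (simp add: gaussM_def sets_Ln)

lemma space_gaussM: "space (gaussM n v) = space (Rn n)"
  by (rule sets_eq_imp_space_eq[OF sets_gaussM])

lemma prob_space_gaussM:
  assumes "v > 0"
  shows "prob_space (gaussM n v)"
  unfolding gaussM_PiM[OF assms] using assms by (intro prob_space_PiM prob_space_normal_density) simp

lemma measurable_gauss_density[measurable]: "gauss_density n v \<in> borel_measurable (Rn n)"
  unfolding gauss_density_def[abs_def] by measurable

lemma nn_integral_gaussM:
  assumes "F \<in> borel_measurable (Rn n)"
  shows "(\<integral>\<^sup>+w. F w \<partial>gaussM n v) = (\<integral>\<^sup>+w. ennreal (gauss_density n v w) * F w \<partial>Ln n)"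
  unfolding gaussM_def using assms by (subst nn_integral_density) auto

text \<open>\<open>dotp n y\<close> is a sum of independent centred normals, hence normal with
  variance |y|^2 v, whose even moments are known.\<close>

lemma gaussM_dotp_moment:
  assumes v: "v > 0"
  shows "(\<integral>\<^sup>+w. ennreal (dotp n y w ^ (2 * k)) \<partial>gaussM n v)
    = ennreal ((vnorm n y)^(2 * k) * v ^ k * fact (2 * k) / (2 ^ k * fact k))"
proof -
  let ?N = "density lborel (\<lambda>x. ennreal (normal_density 0 (sqrt v) x))"
  \<comment> \<open>Coordinates with zero coefficient are removed, because the rule for affine
    images of normals asks for a nonzero factor. The set is empty exactly when the scalar product
    vanishes identically.\<close>
  define I where "I = {i. i < n \<and> y i \<noteq> 0}"
  have fI: "finite I" by (simp add: I_def)
  interpret prob_space "gaussM n v" by (rule prob_space_gaussM[OF v])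
  have N: "prob_space ?N" using v by (intro prob_space_normal_density) simp
  have dot: "dotp n y w = (\<Sum>i\<in>I. y i * w i)" for w
    unfolding dotp_def I_def by (rule sum.mono_neutral_right) auto
  have nrm: "(vnorm n y)\<^sup>2 = (\<Sum>i\<in>I. (y i)\<^sup>2)"
    unfolding vnorm_sq I_def by (rule sum.mono_neutral_right) auto
  note measurable_coord[measurable]
  show ?thesis
  proof (cases "I = {}")
    case True
    then have "dotp n y w = 0" "vnorm n y = 0" for w
      using dot nrm by auto
    then show ?thesis
      by (cases k) (simp_all add: emeasure_space_1)
  next
    case False
    then have n: "{..<n} \<noteq> {}" by (auto simp: I_def)
    have comp: "distr (gaussM n v) borel (\<lambda>x. x i) = ?N" if "i < n" for i
    proof -
      have "distr (gaussM n v) borel (\<lambda>x. x i) = distr (PiM {..<n} (\<lambda>_. ?N)) ?N (\<lambda>x. x i)"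
        unfolding gaussM_PiM[OF v] by (intro distr_cong) auto
      also have "\<dots> = ?N" using that N by (intro distr_PiM_component) auto
      finally show ?thesis .
    qed
    have "indep_vars (\<lambda>_. borel) (\<lambda>i x. x i) {..<n}"
    proof (subst indep_vars_iff_distr_eq_PiM')
      have "distr (gaussM n v) (PiM {..<n} (\<lambda>_. borel)) (\<lambda>x. \<lambda>i\<in>{..<n}. x i)
        = distr (gaussM n v) (Rn n) (\<lambda>x. x)"
        unfolding Rn_def
        by (intro distr_cong refl) (auto simp: space_gaussM space_Rn PiE_iff extensional_def restrict_def)
      also have "\<dots> = gaussM n v" by (intro distr_id2) (simp add: sets_gaussM)
      also have "\<dots> = PiM {..<n} (\<lambda>i. distr (gaussM n v) borel (\<lambda>x. x i))"
        unfolding gaussM_PiM[OF v] by (intro PiM_cong refl) (use comp in \<open>simp add: gaussM_PiM[OF v]\<close>)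
      finally show "distr (gaussM n v) (PiM {..<n} (\<lambda>_. borel)) (\<lambda>x. \<lambda>i\<in>{..<n}. x i)
        = PiM {..<n} (\<lambda>i. distr (gaussM n v) borel (\<lambda>x. x i))" .
    qed (use n in \<open>auto\<close>)
    then have ind: "indep_vars (\<lambda>_. borel) (\<lambda>i x. x i) I"
      by (rule indep_vars_subset) (auto simp: I_def)
    have ind2: "indep_vars (\<lambda>_. borel) (\<lambda>i x. y i * x i) I"
      by (rule indep_vars_compose2[OF ind]) auto
    have "distributed (gaussM n v) lborel (\<lambda>x. x i) (normal_density 0 (sqrt v))" if "i < n" for i
      unfolding distributed_def using comp[OF that] that
      by (auto simp: measurable_cong_sets[OF sets_gaussM refl] cong: distr_cong)
    then have "distributed (gaussM n v) lborel (\<lambda>x. 0 + y i * x i) (normal_density (0 + y i * 0) (\<bar>y i\<bar> * sqrt v))" if "i \<in> I" for i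
      using that v by (intro normal_density_affine) (auto simp: I_def)
    then have "distributed (gaussM n v) lborel (\<lambda>x. \<Sum>i\<in>I. y i * x i)
        (normal_density (\<Sum>i\<in>I. 0) (sqrt (\<Sum>i\<in>I. (\<bar>y i\<bar> * sqrt v)\<^sup>2)))"
      using fI False ind2 v by (intro sum_indep_normal) (auto simp: I_def)
    moreover have "(\<Sum>i\<in>I. (\<bar>y i\<bar> * sqrt v)\<^sup>2) = (vnorm n y)\<^sup>2 * v"
      using v by (simp add: power_mult_distrib nrm sum_distrib_right)
    ultimately have D: "distributed (gaussM n v) lborel (dotp n y) (normal_density 0 (vnorm n y * sqrt v))"
      using v by (simp add: dot[abs_def] real_sqrt_mult)
    have "(vnorm n y)\<^sup>2 \<noteq> 0"
      unfolding nrm using False fI by (subst sum_nonneg_eq_0_iff) (auto simp: I_def)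
    then have pos: "vnorm n y * sqrt v > 0"
      using v by (simp add: less_le)
    have "(\<integral>\<^sup>+w. ennreal (dotp n y w ^ (2 * k)) \<partial>gaussM n v)
      = (\<integral>\<^sup>+x. ennreal (normal_density 0 (vnorm n y * sqrt v) x) * ennreal (x ^ (2 * k)) \<partial>lborel)"
      by (rule distributed_nn_integral[OF D, symmetric]) auto
    also have "\<dots> = (\<integral>\<^sup>+x. ennreal (normal_density 0 (vnorm n y * sqrt v) x * (x - 0) ^ (2 * k)) \<partial>lborel)"
      by (simp add: ennreal_mult)
    also have "\<dots> = ennreal (fact (2 * k) / ((2 / (vnorm n y * sqrt v)\<^sup>2) ^ k * fact k))"
      using normal_moment_even[OF pos, of 0 k]
      by (intro nn_integral_eq_integral[THEN trans])
         (auto simp: has_bochner_integral_iff)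
    also have "fact (2 * k) / ((2 / (vnorm n y * sqrt v)\<^sup>2) ^ k * fact k)
      = (vnorm n y)^(2 * k) * v ^ k * fact (2 * k) / (2 ^ k * fact k)"
      using v by (simp add: power_mult_distrib power_divide power_mult)
    finally show ?thesis .
  qed
qed

text \<open>The half-line Gaussian moments have different factorial closed forms for even and odd
  exponents; the Gamma function unifies the two.\<close>

lemma nn_integral_pow_gauss:
  assumes "N \<ge> 1"
  shows "(\<integral>\<^sup>+r. ennreal (r ^ (N - 1) * exp (- r\<^sup>2)) * indicator {0<..} r \<partial>lborel) = ennreal (Gamma (real N / 2) / 2)"
proof -
  have G: "has_bochner_integral lborel (\<lambda>x::real. indicator {0..} x *\<^sub>R (exp (-x\<^sup>2) * x ^ (N - 1))) (Gamma (real N / 2) / 2)"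
  proof (cases "odd N")
    case True
    then obtain k where N: "N = 2 * k + 1" by (auto elim: oddE)
    have "sqrt pi * (fact (2 * k) / (2 ^ (2 * k) * fact k)) = Gamma (real k + 1 / 2)"
    proof (induction k)
      case 0
      then show ?case by (simp add: Gamma_one_half_real)
    next
      case (Suc k)
      have "Gamma (real (Suc k) + 1 / 2) = (real k + 1 / 2) * Gamma (real k + 1 / 2)"
      proof -
        have "real k + 1 / 2 \<notin> \<int>\<^sub>\<le>\<^sub>0" by (auto dest: nonpos_Ints_nonpos)
        from Gamma_plus1[OF this] show ?thesis by (simp add: add_ac)
      qed
      moreover have "(fact (2 * Suc k) / (2 ^ (2 * Suc k) * fact (Suc k)) :: real)
          = (real k + 1 / 2) * (fact (2 * k) / (2 ^ (2 * k) * fact k))"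
        by (simp add: divide_simps) (simp add: algebra_simps)
      ultimately show ?case by (simp only: Suc.IH[symmetric] mult_ac)
    qed
    then have "sqrt pi / 2 * (fact (2 * k) / (2 ^ (2 * k) * fact k)) = Gamma (real N / 2) / 2"
      by (simp add: N add_divide_distrib) (simp add: add.commute)
    then show ?thesis
      using gaussian_moment_even_pos[of k] unfolding N by (simp only: add_diff_cancel_right')
  next
    case False
    then obtain k where N: "N = 2 * k + 2" using assms
      by (metis add_2_eq_Suc' dvd_def even_add evenE not_one_le_zero mult_Suc_right odd_two_times_div_two_nat One_nat_def Suc_1 add.commute nat.exhaust mult_0_right)
    have "Gamma (real k + 1) = fact k"
      by (metis Gamma_fact add.commute)
    then have "fact k / 2 = Gamma (real N / 2) / 2"
      by (simp add: N add_divide_distrib) (simp add: add.commute)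
    moreover have "N - 1 = 2 * k + 1" by (simp add: N)
    ultimately show ?thesis
      using gaussian_moment_odd_pos[of k] by (simp only:)
  qed
  have "(\<integral>\<^sup>+r. ennreal (r ^ (N - 1) * exp (- r\<^sup>2)) * indicator {0<..} r \<partial>lborel)
    = (\<integral>\<^sup>+r. ennreal (indicator {0..} r *\<^sub>R (exp (-r\<^sup>2) * r ^ (N - 1))) \<partial>lborel)"
    by (rule nn_integral_cong_AE, use AE_lborel_singleton[of "0::real"] in eventually_elim)
       (auto simp: indicator_def mult.commute)
  also have "\<dots> = ennreal (Gamma (real N / 2) / 2)"
    using G by (subst nn_integral_eq_integral) (auto simp only: has_bochner_integral_iff, auto simp: indicator_def)
  finally show ?thesis .
qed

text \<open>The surface integral of the 2k-th power of one coordinate over the unit sphere; for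
  \<open>k = 0\<close> the surface area.\<close>

definition moment_coeff :: "nat \<Rightarrow> nat \<Rightarrow> real" where
  "moment_coeff n k = 2 * pi powr (real n / 2) * (fact (2 * k) / (4 ^ k * fact k)) * rGamma (real n / 2 + real k)"

text \<open>Homogeneity determines the radial law of \<open>(y \<cdot> w)\<^sup>2\<^sup>k dw\<close> up to a constant, which is
  read off from the Gaussian case.\<close>

lemma nn_integral_Ln_moment:
  fixes F :: "real \<Rightarrow> ennreal"
  assumes n: "n \<ge> 1" and F[measurable]: "F \<in> borel_measurable borel"
  shows "(\<integral>\<^sup>+w. ennreal (dotp n y w ^ (2 * k)) * F (vnorm n w) \<partial>Ln n)
    = (\<integral>\<^sup>+r. ennreal (moment_coeff n k * vnorm n y ^ (2 * k) * r ^ (n + 2 * k - 1)) * indicator {0<..} r * F r \<partial>lborel)"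
proof -
  define N where "N = n + 2 * k"
  have N: "N \<ge> 1" using n by (simp add: N_def)
  define G where "G = (\<lambda>F. (\<integral>\<^sup>+w. ennreal (dotp n y w ^ (2 * k)) * F (vnorm n w) \<partial>Ln n))"
  define \<mu> where "\<mu> = distr (density (Ln n) (\<lambda>w. ennreal (dotp n y w ^ (2 * k)))) borel (vnorm n)"
  have mu: "(\<integral>\<^sup>+r. H r \<partial>\<mu>) = G H" if [measurable]: "H \<in> borel_measurable borel" for H
  proof -
    have 1: "vnorm n \<in> density (Ln n) (\<lambda>w. ennreal (dotp n y w ^ (2 * k))) \<rightarrow>\<^sub>M borel"
      by measurable
    show ?thesis
      unfolding \<mu>_def G_def
      by (subst nn_integral_distr[OF 1], simp, subst nn_integral_density) measurable
  qed
  \<comment> \<open>Substituting c w for w contributes c^n from the volume and c^(2k) from the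
    weight.\<close>
  have scale: "G H = ennreal (c ^ N) * G (\<lambda>r. H (c * r))" if [measurable]: "H \<in> borel_measurable borel" and c: "c > 0" for H c
  proof -
    have "G H = ennreal (\<bar>c\<bar> ^ n) * (\<integral>\<^sup>+w. ennreal (dotp n y (vaffine n (\<lambda>_. 0) c w) ^ (2 * k)) * H (vnorm n (vaffine n (\<lambda>_. 0) c w)) \<partial>Ln n)"
      unfolding G_def using c by (subst nn_integral_Ln_affine) auto
    also have "\<dots> = ennreal (c ^ n) * (\<integral>\<^sup>+w. ennreal (c ^ (2 * k)) * (ennreal (dotp n y w ^ (2 * k)) * H (c * vnorm n w)) \<partial>Ln n)"
      using c by (simp add: dotp_scale vnorm_scale power_mult_distrib ennreal_mult mult.assoc)
    also have "\<dots> = ennreal (c ^ n) * (ennreal (c ^ (2 * k)) * G (\<lambda>r. H (c * r)))"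
      unfolding G_def by (subst nn_integral_cmult) auto
    also have "\<dots> = ennreal (c ^ N) * G (\<lambda>r. H (c * r))"
      using c by (simp add: N_def power_add ennreal_mult mult.assoc)
    finally show ?thesis .
  qed
  define IG where "IG = pi powr (real n / 2) * (vnorm n y ^ (2 * k) * fact (2 * k) / (4 ^ k * fact k))"
  have gd: "exp (- (vnorm n w)\<^sup>2) = pi powr (real n / 2) * gauss_density n (1 / 2) w" for w
    by (simp add: gauss_density_def powr_minus)
  have IG: "G (\<lambda>r. ennreal (exp (- r\<^sup>2))) = ennreal IG"
  proof -
    have "G (\<lambda>r. ennreal (exp (- r\<^sup>2)))
      = (\<integral>\<^sup>+w. ennreal (pi powr (real n / 2)) * (ennreal (gauss_density n (1 / 2) w) * ennreal (dotp n y w ^ (2 * k))) \<partial>Ln n)"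
      unfolding G_def gd by (rule nn_integral_cong)
        (simp add: ennreal_mult gauss_density_def mult_ac)
    also have "\<dots> = ennreal (pi powr (real n / 2)) * (\<integral>\<^sup>+w. ennreal (dotp n y w ^ (2 * k)) \<partial>gaussM n (1 / 2))"
      by (subst nn_integral_cmult, measurable, subst nn_integral_gaussM, measurable)
    also have "\<dots> = ennreal (pi powr (real n / 2)) * ennreal (vnorm n y ^ (2 * k) * (1 / 2) ^ k * fact (2 * k) / (2 ^ k * fact k))"
      by (subst gaussM_dotp_moment) auto
    also have "vnorm n y ^ (2 * k) * (1 / 2) ^ k * fact (2 * k) / (2 ^ k * fact k) = vnorm n y ^ (2 * k) * fact (2 * k) / (4 ^ k * fact k)"
      by (simp add: power_divide power_mult_distrib[symmetric] field_simps)
    finally show ?thesis unfolding IG_def by (subst ennreal_mult) auto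
  qed
  \<comment> \<open>The weighted mass of the unit ball. It is finite by comparison with the Gaussian
    case, since exp 1 * exp (- r^2) is at least 1 on the ball; homogeneity then gives the mass of
    every ball.\<close>
  define a0 where "a0 = G (indicator {..1})"
  have "a0 \<le> G (\<lambda>r. ennreal (exp 1) * ennreal (exp (- r\<^sup>2)))"
    unfolding a0_def G_def
  proof (intro nn_integral_mono mult_left_mono)
    fix w
    show "indicator {..1} (vnorm n w) \<le> ennreal (exp 1) * ennreal (exp (- (vnorm n w)\<^sup>2))"
    proof (cases "vnorm n w \<le> 1")
      case True
      then have "(vnorm n w)\<^sup>2 \<le> 1" by (simp add: power_le_one)
      then have "1 \<le> exp 1 * exp (- (vnorm n w)\<^sup>2)" by (simp add: exp_add[symmetric])
      then show ?thesis using True by (simp add: ennreal_mult[symmetric])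
    qed auto
  qed auto
  also have "\<dots> = ennreal (exp 1) * G (\<lambda>r. ennreal (exp (- r\<^sup>2)))"
    unfolding G_def by (subst nn_integral_cmult[symmetric]) (auto simp: mult_ac)
  also have "\<dots> < \<infinity>" unfolding IG by (simp add: ennreal_mult[symmetric] IG_def)
  finally have a0: "a0 < \<infinity>" .
  define \<alpha> where "\<alpha> = enn2real a0"
  have \<alpha>: "a0 = ennreal \<alpha>" "\<alpha> \<ge> 0" using a0 by (auto simp: \<alpha>_def)
  have mass: "G (indicator {..\<rho>}) = ennreal (\<alpha> * \<rho> ^ N)" if "\<rho> > 0" for \<rho>
  proof -
    have "G (indicator {..\<rho>}) = ennreal (\<rho> ^ N) * G (\<lambda>r. indicator {..\<rho>} (\<rho> * r))"
      by (rule scale) (use that in auto)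
    also have "(\<lambda>r. indicator {..\<rho>} (\<rho> * r)) = (indicator {..1} :: real \<Rightarrow> ennreal)"
      using that by (auto simp: indicator_def fun_eq_iff)
    finally show ?thesis using \<alpha> that by (simp add: a0_def[symmetric] ennreal_mult mult.commute)
  qed
  \<comment> \<open>The mass at radius 0 lies below \<alpha> e^N for every e > 0, and N is at least
    1.\<close>
  have mass0: "G (indicator {..\<rho>}) = 0" if "\<rho> \<le> 0" for \<rho>
  proof -
    have mono: "G (indicator {..\<rho>}) \<le> G (indicator {..e})" if "e > 0" for e
      unfolding G_def using that \<open>\<rho> \<le> 0\<close> by (intro nn_integral_mono mult_left_mono) (auto simp: indicator_def)
    have le: "G (indicator {..\<rho>}) \<le> ennreal (\<alpha> * e ^ N)" if "e > 0" for e
      using mono[OF that] mass[OF that] by metis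
    have "((\<lambda>e. ennreal (\<alpha> * e ^ N)) \<longlongrightarrow> ennreal (\<alpha> * 0 ^ N)) (at_right 0)"
      by (intro tendsto_ennrealI tendsto_intros)
    moreover have "eventually (\<lambda>e. G (indicator {..\<rho>}) \<le> ennreal (\<alpha> * e ^ N)) (at_right 0)"
      using le by (auto simp: eventually_at_right_field intro: exI[of _ 1])
    ultimately have "G (indicator {..\<rho>}) \<le> ennreal (\<alpha> * 0 ^ N)"
      by (rule tendsto_lowerbound) simp
    then show ?thesis using N by (simp add: power_0_left)
  qed
  define \<nu> where "\<nu> = density lborel (\<lambda>r. ennreal (\<alpha> * real N * r ^ (N - 1)) * indicator {0<..} r)"
  have nu: "emeasure \<nu> {..\<rho>} = (if \<rho> > 0 then ennreal (\<alpha> * \<rho> ^ N) else 0)" for \<rho>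
  proof (cases "\<rho> > 0")
    case True
    have "emeasure \<nu> {..\<rho>} = (\<integral>\<^sup>+r. ennreal (\<alpha> * real N * r ^ (N - 1)) * indicator {0..\<rho>} r \<partial>lborel)"
      unfolding \<nu>_def
      by (subst emeasure_density, measurable, rule nn_integral_cong_AE,
          use AE_lborel_singleton[of "0::real"] in eventually_elim) (auto simp: indicator_def)
    also have "\<dots> = ennreal (\<alpha> * \<rho> ^ N - \<alpha> * 0 ^ N)"
    proof (rule nn_integral_FTC_Icc)
      show "((\<lambda>r. \<alpha> * r ^ N) has_real_derivative \<alpha> * real N * x ^ (N - 1)) (at x)" for x
        by (auto intro!: derivative_eq_intros)
    qed (use \<alpha> True in auto)
    finally show ?thesis using True N by (simp add: power_0_left)
  next
    case False
    have "emeasure \<nu> {..\<rho>} = (\<integral>\<^sup>+r. 0 \<partial>(lborel :: real measure))"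
      unfolding \<nu>_def
      by (subst emeasure_density, measurable, rule nn_integral_cong) (use False in \<open>auto simp: indicator_def\<close>)
    then show ?thesis using False by simp
  qed
  have "\<mu> = \<nu>"
  proof (rule measure_eqI_generator_eq[where E = "range (\<lambda>a::real. {..a})" and \<Omega> = UNIV and A = "\<lambda>i. {..real i}"])
    show "Int_stable (range (\<lambda>a::real. {..a}))"
      by (auto simp: Int_stable_def)
    have em: "emeasure \<mu> {..\<rho>} = G (indicator {..\<rho>})" for \<rho>
      using mu[of "indicator {..\<rho>}"] by (simp add: \<mu>_def)
    show "emeasure \<mu> X = emeasure \<nu> X" if X: "X \<in> range (\<lambda>a::real. {..a})" for X
      using X em nu mass mass0 by force
    show "sets \<mu> = sigma_sets UNIV (range (\<lambda>a::real. {..a}))" "sets \<nu> = sigma_sets UNIV (range (\<lambda>a::real. {..a}))"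
      unfolding \<mu>_def \<nu>_def by (simp_all add: borel_eq_atMost)
    show "range (\<lambda>i. {..real i}) \<subseteq> range (\<lambda>a. {..a})" by auto
    show "(\<Union>i. {..real i}) = UNIV" by (auto intro: real_arch_simple)
    show "emeasure \<mu> {..real i} \<noteq> \<infinity>" for i
      unfolding em using mass[of "real i"] mass0[of "real i"] by (cases "real i > 0") auto
  qed auto
  then have GF: "G H = (\<integral>\<^sup>+r. ennreal (\<alpha> * real N * r ^ (N - 1)) * indicator {0<..} r * H r \<partial>lborel)"
    if [measurable]: "H \<in> borel_measurable borel" for H
    using mu[OF that] unfolding \<nu>_def by (simp add: nn_integral_density)
  \<comment> \<open>Testing the radial law against exp (- r^2), where the left side is a Gaussian
    moment with variance 1/2, determines the remaining constant.\<close>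
  have "ennreal IG = (\<integral>\<^sup>+r. ennreal (\<alpha> * real N * r ^ (N - 1)) * indicator {0<..} r * ennreal (exp (- r\<^sup>2)) \<partial>lborel)"
    unfolding IG[symmetric] by (rule GF) measurable
  also have "\<dots> = (\<integral>\<^sup>+r. ennreal (\<alpha> * real N) * (ennreal (r ^ (N - 1) * exp (- r\<^sup>2)) * indicator {0<..} r) \<partial>lborel)"
    using \<alpha> by (intro nn_integral_cong) (auto simp: indicator_def ennreal_mult[symmetric] mult_ac)
  also have "\<dots> = ennreal (\<alpha> * real N) * ennreal (Gamma (real N / 2) / 2)"
    by (subst nn_integral_cmult, measurable, subst nn_integral_pow_gauss[OF N]) simp
  also have "\<dots> = ennreal (\<alpha> * real N * (Gamma (real N / 2) / 2))"
    using \<alpha> by (subst ennreal_mult') auto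
  finally have eq: "IG = \<alpha> * real N * (Gamma (real N / 2) / 2)"
    using \<alpha> N by (subst (asm) ennreal_inj) (auto simp: IG_def intro!: mult_nonneg_nonneg Gamma_real_nonneg)
  have Gp: "Gamma (real N / 2) > 0" using N by (intro Gamma_real_pos) auto
  have "\<alpha> * real N = 2 * IG * rGamma (real N / 2)"
    using eq Gp by (simp add: rGamma_inverse_Gamma field_simps)
  also have "\<dots> = moment_coeff n k * vnorm n y ^ (2 * k)"
    by (simp add: moment_coeff_def IG_def N_def add_divide_distrib)
  finally have "\<alpha> * real N = moment_coeff n k * vnorm n y ^ (2 * k)" .
  with GF[OF F] show ?thesis by (simp add: G_def N_def)
qed

lemma cosh_sums: "(\<lambda>k. t ^ (2 * k) / fact (2 * k)) sums cosh (t :: real)"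
proof -
  have "(\<lambda>k. (\<lambda>n. if even n then t ^ n /\<^sub>R fact n else 0) (2 * k)) sums cosh t"
    by (subst sums_mono_reindex[of "\<lambda>k. 2 * k"])
       (use cosh_converges[of t] in \<open>auto simp: strict_mono_def elim!: evenE\<close>)
  then show ?thesis by (simp add: divide_inverse mult.commute)
qed

text \<open>The reflection of w replaces exp by cosh, whose series has only even powers with
  positive coefficients. Monotone convergence allows termwise integration, and each term is a moment
  already known; the factorials of 2k cancel and the Bessel series appears. The coefficient
  \<open>a\<close> may depend on the norm: it is constant for Gaussian shifts and proportional to
  1/r for projections to a sphere.\<close>

lemma nn_integral_Ln_exp:
  fixes F :: "real \<Rightarrow> ennreal" and a :: "real \<Rightarrow> real"
  assumes n: "n \<ge> 1" and F[measurable]: "F \<in> borel_measurable borel" and a[measurable]: "a \<in> borel_measurable borel"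
  shows "(\<integral>\<^sup>+w. ennreal (exp (a (vnorm n w) * dotp n y w)) * F (vnorm n w) \<partial>Ln n)
    = (\<integral>\<^sup>+r. ennreal (2 * pi powr (real n / 2) * bessel_ser (real n / 2) ((vnorm n y * r * a r)\<^sup>2 / 4) * r ^ (n - 1))
        * indicator {0<..} r * F r \<partial>lborel)"
    (is "?I = ?R")
proof -
  define t where "t = (\<lambda>w. a (vnorm n w) * dotp n y w)"
  have [measurable]: "t \<in> borel_measurable (Rn n)" unfolding t_def by measurable
  \<comment> \<open>Reflection at the origin, as the affine map with factor -1; norms are unchanged
    and scalar products change sign.\<close>
  have "?I = ennreal (\<bar>-1\<bar> ^ n) * (\<integral>\<^sup>+w. ennreal (exp (a (vnorm n (vaffine n (\<lambda>_. 0) (-1) w)) * dotp n y (vaffine n (\<lambda>_. 0) (-1) w))) * F (vnorm n (vaffine n (\<lambda>_. 0) (-1) w)) \<partial>Ln n)"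
    by (rule nn_integral_Ln_affine[symmetric]) auto
  then have I2: "?I = (\<integral>\<^sup>+w. ennreal (exp (- t w)) * F (vnorm n w) \<partial>Ln n)"
    by (simp only: vnorm_scale dotp_scale) (simp add: t_def)
  have "?I + ?I = (\<integral>\<^sup>+w. ennreal (exp (t w)) * F (vnorm n w) \<partial>Ln n) + (\<integral>\<^sup>+w. ennreal (exp (- t w)) * F (vnorm n w) \<partial>Ln n)"
    using I2 by (simp add: t_def)
  also have "\<dots> = (\<integral>\<^sup>+w. ennreal (exp (t w)) * F (vnorm n w) + ennreal (exp (- t w)) * F (vnorm n w) \<partial>Ln n)"
    by (subst nn_integral_add) auto
  also have "\<dots> = (\<integral>\<^sup>+w. ennreal (cosh (t w)) * F (vnorm n w) + ennreal (cosh (t w)) * F (vnorm n w) \<partial>Ln n)"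
  proof (rule nn_integral_cong)
    fix w
    have "ennreal (exp (t w)) + ennreal (exp (- t w)) = ennreal (cosh (t w)) + ennreal (cosh (t w))"
      by (simp add: ennreal_plus[symmetric] cosh_def del: ennreal_plus)
    then show "ennreal (exp (t w)) * F (vnorm n w) + ennreal (exp (- t w)) * F (vnorm n w)
       = ennreal (cosh (t w)) * F (vnorm n w) + ennreal (cosh (t w)) * F (vnorm n w)"
      by (simp add: distrib_right[symmetric])
  qed
  also have "\<dots> = (\<integral>\<^sup>+w. ennreal (cosh (t w)) * F (vnorm n w) \<partial>Ln n) + (\<integral>\<^sup>+w. ennreal (cosh (t w)) * F (vnorm n w) \<partial>Ln n)"
    by (subst nn_integral_add) (auto simp: cosh_def)
  finally have "2 * ?I = 2 * (\<integral>\<^sup>+w. ennreal (cosh (t w)) * F (vnorm n w) \<partial>Ln n)"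
    by (simp add: mult_2)
  then have "?I = (\<integral>\<^sup>+w. ennreal (cosh (t w)) * F (vnorm n w) \<partial>Ln n)"
    by (simp add: ennreal_mult_cancel_left)
  also have "\<dots> = (\<integral>\<^sup>+w. (\<Sum>k. ennreal (dotp n y w ^ (2 * k)) * (ennreal (a (vnorm n w) ^ (2 * k) / fact (2 * k)) * F (vnorm n w))) \<partial>Ln n)"
  proof (rule nn_integral_cong)
    fix w
    have "ennreal (cosh (t w)) = (\<Sum>k. ennreal (t w ^ (2 * k) / fact (2 * k)))"
      by (rule suminf_ennreal_eq[symmetric, OF _ cosh_sums]) simp
    then have "ennreal (cosh (t w)) * F (vnorm n w) = (\<Sum>k. ennreal (t w ^ (2 * k) / fact (2 * k)) * F (vnorm n w))"
      by simp
    also have "(\<lambda>k. ennreal (t w ^ (2 * k) / fact (2 * k)) * F (vnorm n w))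
      = (\<lambda>k. ennreal (dotp n y w ^ (2 * k)) * (ennreal (a (vnorm n w) ^ (2 * k) / fact (2 * k)) * F (vnorm n w)))"
      by (simp add: t_def power_mult_distrib ennreal_mult[symmetric] mult.assoc[symmetric] fun_eq_iff) (simp add: mult_ac)
    finally show "ennreal (cosh (t w)) * F (vnorm n w)
      = (\<Sum>k. ennreal (dotp n y w ^ (2 * k)) * (ennreal (a (vnorm n w) ^ (2 * k) / fact (2 * k)) * F (vnorm n w)))" .
  qed
  also have "\<dots> = (\<Sum>k. \<integral>\<^sup>+w. ennreal (dotp n y w ^ (2 * k)) * (ennreal (a (vnorm n w) ^ (2 * k) / fact (2 * k)) * F (vnorm n w)) \<partial>Ln n)"
    by (rule nn_integral_suminf) measurable
  also have "\<dots> = (\<Sum>k. \<integral>\<^sup>+r. ennreal (moment_coeff n k * vnorm n y ^ (2 * k) * r ^ (n + 2 * k - 1)) * indicator {0<..} r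
       * (ennreal (a r ^ (2 * k) / fact (2 * k)) * F r) \<partial>lborel)"
    by (intro suminf_cong nn_integral_Ln_moment[OF n]) measurable
  also have "\<dots> = (\<integral>\<^sup>+r. (\<Sum>k. ennreal (moment_coeff n k * vnorm n y ^ (2 * k) * r ^ (n + 2 * k - 1)) * indicator {0<..} r
       * (ennreal (a r ^ (2 * k) / fact (2 * k)) * F r)) \<partial>lborel)"
  proof -
    define Y where "Y = vnorm n y"
    show ?thesis
      unfolding Y_def[symmetric] by (rule nn_integral_suminf[symmetric]) measurable
  qed
  also have "\<dots> = ?R"
  proof (rule nn_integral_cong)
    fix r :: real
    let ?c = "2 * pi powr (real n / 2) * r ^ (n - 1)"
    let ?z = "(vnorm n y * r * a r)\<^sup>2 / 4"
    show "(\<Sum>k. ennreal (moment_coeff n k * vnorm n y ^ (2 * k) * r ^ (n + 2 * k - 1)) * indicator {0<..} r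
       * (ennreal (a r ^ (2 * k) / fact (2 * k)) * F r))
      = ennreal (2 * pi powr (real n / 2) * bessel_ser (real n / 2) ?z * r ^ (n - 1)) * indicator {0<..} r * F r"
    proof (cases "r > 0")
      case True
      have nu: "real n / 2 > 0" using n by simp
      have nn: "0 \<le> ?c * (bessel_coeff (real n / 2) k * ?z ^ k)" for k
        using True bessel_coeff_pos[OF nu, of k] by simp
      have trm: "ennreal (moment_coeff n k * vnorm n y ^ (2 * k) * r ^ (n + 2 * k - 1)) * indicator {0<..} r
          * (ennreal (a r ^ (2 * k) / fact (2 * k)) * F r)
        = ennreal (?c * (bessel_coeff (real n / 2) k * ?z ^ k)) * F r" for k
      proof -
        have "moment_coeff n k \<ge> 0"
          using nu by (auto simp: moment_coeff_def rGamma_inverse_Gamma intro!: mult_nonneg_nonneg Gamma_real_nonneg)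
        moreover have "moment_coeff n k * vnorm n y ^ (2 * k) * r ^ (n + 2 * k - 1) * (a r ^ (2 * k) / fact (2 * k))
          = ?c * (bessel_coeff (real n / 2) k * ?z ^ k)"
        proof -
          have "n + 2 * k - 1 = (n - 1) + 2 * k" using n by simp
          then have "r ^ (n + 2 * k - 1) = r ^ (n - 1) * r ^ (2 * k)" by (simp only: power_add)
          then show ?thesis
            by (simp add: moment_coeff_def bessel_coeff_def power_divide power_mult[symmetric] power_mult_distrib mult_ac)
        qed
        ultimately show ?thesis
          using True by (simp add: mult.assoc[symmetric] ennreal_mult[symmetric])
      qed
      have "(\<lambda>k. ?c * (bessel_coeff (real n / 2) k * ?z ^ k)) sums (?c * bessel_ser (real n / 2) ?z)"
        unfolding bessel_ser_def by (intro sums_mult summable_sums summable_bessel nu)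
      then have "(\<Sum>k. ennreal (?c * (bessel_coeff (real n / 2) k * ?z ^ k))) = ennreal (?c * bessel_ser (real n / 2) ?z)"
        by (intro suminf_ennreal_eq nn)
      moreover have "?c * bessel_ser (real n / 2) ?z = 2 * pi powr (real n / 2) * bessel_ser (real n / 2) ?z * r ^ (n - 1)"
        by simp
      ultimately have "(\<Sum>k. ennreal (?c * (bessel_coeff (real n / 2) k * ?z ^ k))) * F r
          = ennreal (2 * pi powr (real n / 2) * bessel_ser (real n / 2) ?z * r ^ (n - 1)) * F r"
        by (simp only:)
      then show ?thesis using True unfolding trm ennreal_suminf_multc by simp
    qed simp
  qed
  finally show ?thesis .
qed

subsection \<open>Radial Gaussian means\<close>

lemma nn_integral_gaussM_shift:
  assumes H[measurable]: "H \<in> borel_measurable (Rn n)"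
  shows "(\<integral>\<^sup>+w. H (vadd n x w) \<partial>gaussM n v) = (\<integral>\<^sup>+y. ennreal (gauss_density n v (\<lambda>i. y i - x i)) * H y \<partial>Ln n)"
proof -
  have e1: "gauss_density n v (\<lambda>i. y i - x i) = gauss_density n v (vaffine n (\<lambda>i. - x i) 1 y)" for y
    by (simp add: gauss_density_def vnorm_def vaffine_def)
  have e2: "gauss_density n v (vaffine n (\<lambda>i. - x i) 1 (vaffine n x 1 w)) = gauss_density n v w" for w
    by (simp add: gauss_density_def vnorm_def vaffine_def)
  have "(\<integral>\<^sup>+y. ennreal (gauss_density n v (vaffine n (\<lambda>i. - x i) 1 y)) * H y \<partial>Ln n)
    = ennreal (\<bar>1\<bar> ^ n) * (\<integral>\<^sup>+w. ennreal (gauss_density n v (vaffine n (\<lambda>i. - x i) 1 (vaffine n x 1 w))) * H (vaffine n x 1 w) \<partial>Ln n)"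
    by (rule nn_integral_Ln_affine[symmetric]) auto
  also have "\<dots> = (\<integral>\<^sup>+w. ennreal (gauss_density n v w) * H (vadd n x w) \<partial>Ln n)"
    unfolding e2 by (simp add: vaffine_def vadd_def)
  also have "\<dots> = (\<integral>\<^sup>+w. H (vadd n x w) \<partial>gaussM n v)"
  proof (rule nn_integral_gaussM[symmetric])
    have "vadd n x = vaffine n x 1" by (simp add: vadd_def vaffine_def fun_eq_iff)
    then show "(\<lambda>w. H (vadd n x w)) \<in> borel_measurable (Rn n)" by simp
  qed
  finally show ?thesis unfolding e1 by simp
qed

definition chi_const :: "nat \<Rightarrow> real \<Rightarrow> real" where
  "chi_const m v = 2 / ((2 * v) powr (real m / 2) * Gamma (real m / 2))"

definition chi_density :: "nat \<Rightarrow> real \<Rightarrow> real \<Rightarrow> real" where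
  "chi_density m v r = (if r > 0 then chi_const m v * r ^ (m - 1) * exp (- r\<^sup>2 / (2 * v)) else 0)"

definition chiM :: "nat \<Rightarrow> real \<Rightarrow> real measure" where
  "chiM m v = density lborel (\<lambda>r. ennreal (chi_density m v r))"

definition poisson_weight :: "real \<Rightarrow> nat \<Rightarrow> real" where
  "poisson_weight l j = exp (- l) * l ^ j / fact j"

lemma chi_const_pos: "m \<ge> 1 \<Longrightarrow> v > 0 \<Longrightarrow> chi_const m v > 0"
  unfolding chi_const_def by (intro divide_pos_pos mult_pos_pos Gamma_real_pos) auto

lemma chi_density_nonneg: "m \<ge> 1 \<Longrightarrow> v > 0 \<Longrightarrow> chi_density m v r \<ge> 0"
  using chi_const_pos[of m v] by (auto simp: chi_density_def)

lemma measurable_chi_density[measurable]: "chi_density m v \<in> borel_measurable borel"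
  unfolding chi_density_def[abs_def] by measurable

lemma sets_chiM[measurable_cong]: "sets (chiM m v) = sets borel"
  by (simp add: chiM_def)

lemma poisson_weight_nonneg: "l \<ge> 0 \<Longrightarrow> poisson_weight l j \<ge> 0"
  by (simp add: poisson_weight_def)

lemma nn_integral_chiM:
  assumes [measurable]: "F \<in> borel_measurable borel"
  shows "(\<integral>\<^sup>+r. F r \<partial>chiM m v) = (\<integral>\<^sup>+r. ennreal (chi_density m v r) * F r \<partial>lborel)"
  unfolding chiM_def by (subst nn_integral_density) auto

lemma prob_space_chiM:
  assumes m: "m \<ge> 1" and v: "v > 0"
  shows "prob_space (chiM m v)"
proof
  \<comment> \<open>The scale that turns exp (- r^2 / (2 v)) into exp (- r^2).\<close>
  define c where "c = sqrt (2 * v)"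
  have c: "c > 0" "c\<^sup>2 = 2 * v" using v by (auto simp: c_def)
  have cm: "c ^ m = (2 * v) powr (real m / 2)"
  proof -
    have "(2 * v) powr (real m / 2) = ((2 * v) powr (1 / 2)) powr real m" by (simp add: powr_powr)
    also have "\<dots> = c powr real m" using v by (simp add: c_def powr_half_sqrt)
    also have "\<dots> = c ^ m" using c by (simp add: powr_realpow)
    finally show ?thesis by simp
  qed
  have Gp: "Gamma (real m / 2) > 0" using m by (intro Gamma_real_pos) auto
  have "emeasure (chiM m v) (space (chiM m v)) = (\<integral>\<^sup>+r. ennreal (chi_density m v r) \<partial>lborel)"
    unfolding chiM_def by (subst emeasure_density) auto
  also have "\<dots> = ennreal \<bar>c\<bar> * (\<integral>\<^sup>+r. ennreal (chi_density m v (0 + c * r)) \<partial>lborel)"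
    by (rule nn_integral_real_affine) (use c in auto)
  also have "\<dots> = ennreal c * (\<integral>\<^sup>+r. ennreal (chi_const m v * c ^ (m - 1)) * (ennreal (r ^ (m - 1) * exp (- r\<^sup>2)) * indicator {0<..} r) \<partial>lborel)"
  proof -
    have "ennreal (chi_density m v (0 + c * r)) = ennreal (chi_const m v * c ^ (m - 1)) * (ennreal (r ^ (m - 1) * exp (- r\<^sup>2)) * indicator {0<..} r)" for r
    proof (cases "r > 0")
      case True
      have "(c * r)\<^sup>2 / (2 * v) = r\<^sup>2" using c v by (simp add: power_mult_distrib)
      then have "chi_density m v (0 + c * r) = (chi_const m v * c ^ (m - 1)) * (r ^ (m - 1) * exp (- r\<^sup>2))"
        using True c by (simp add: chi_density_def power_mult_distrib)
      then show ?thesis using True c chi_const_pos[OF m v] by (simp add: ennreal_mult)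
    qed (use c in \<open>auto simp: chi_density_def zero_less_mult_iff\<close>)
    then show ?thesis using c by simp
  qed
  also have "\<dots> = ennreal c * (ennreal (chi_const m v * c ^ (m - 1)) * ennreal (Gamma (real m / 2) / 2))"
    by (subst nn_integral_cmult, measurable, subst nn_integral_pow_gauss[OF m]) simp
  also have "\<dots> = ennreal (c * (chi_const m v * c ^ (m - 1) * (Gamma (real m / 2) / 2)))"
    using c chi_const_pos[OF m v] Gp by (simp add: ennreal_mult[symmetric] mult_ac)
  also have "c * (chi_const m v * c ^ (m - 1) * (Gamma (real m / 2) / 2)) = c ^ m * chi_const m v * Gamma (real m / 2) / 2"
    using m by (cases m) (auto simp: mult_ac)
  also have "\<dots> = 1" unfolding cm chi_const_def using Gp v by simp
  finally show "emeasure (chiM m v) (space (chiM m v)) = 1" by simp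
qed

text \<open>The functional equation of Gamma: weighting by r^2 raises the degrees of freedom by two.
  The moments, the integration by parts and the preservation of signs all rest on this
  identity.\<close>

lemma chi_density_shift:
  assumes m: "m \<ge> 1" and v: "v > 0"
  shows "chi_density m v r * r\<^sup>2 = real m * v * chi_density (m + 2) v r"
proof -
  have "Gamma (real m / 2 + 1) = real m / 2 * Gamma (real m / 2)"
    using m by (intro Gamma_plus1) (auto dest: nonpos_Ints_nonpos)
  then have "Gamma (real (m + 2) / 2) = real m / 2 * Gamma (real m / 2)"
    by (simp add: add_divide_distrib add.commute)
  moreover have "(2 * v) powr (real (m + 2) / 2) = (2 * v) powr (real m / 2) * (2 * v)"
    using v by (simp add: add_divide_distrib powr_add)
  ultimately have "chi_const (m + 2) v = 2 / (((2 * v) powr (real m / 2) * (2 * v)) * (real m / 2 * Gamma (real m / 2)))"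
    unfolding chi_const_def by (simp only:)
  then have "real m * v * chi_const (m + 2) v = chi_const m v"
    using m v by (simp add: chi_const_def)
  moreover have "r ^ (m + 2 - 1) = r ^ (m - 1) * r\<^sup>2"
    using m by (simp add: power_add[symmetric])
  ultimately show ?thesis
    by (auto simp: chi_density_def mult_ac)
qed

text \<open>The noncentral chi law. Expanding the square in the shifted Gaussian leaves the
  exponential of a scalar product, which integrates over directions to a Bessel series; its j-th
  term is a Poisson weight with parameter |x|^2 / (2 v) times the chi density with
  \<open>n + 2 * j\<close> degrees.\<close>

lemma nn_integral_gaussM_radial:
  assumes n: "n \<ge> 1" and v: "v > 0" and F[measurable]: "F \<in> borel_measurable borel"
  shows "(\<integral>\<^sup>+w. F (vnorm n (vadd n x w)) \<partial>gaussM n v)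
    = (\<Sum>j. ennreal (poisson_weight ((vnorm n x)\<^sup>2 / (2 * v)) j) * (\<integral>\<^sup>+r. F r \<partial>chiM (n + 2 * j) v))"
proof -
  define l where "l = (vnorm n x)\<^sup>2 / (2 * v)"
  have l: "l \<ge> 0" using v by (simp add: l_def)
  define C where "C = (2 * pi * v) powr (- real n / 2) * exp (- l)"
  have C: "C > 0" using v by (simp add: C_def)
  have gd: "gauss_density n v (\<lambda>i. y i - x i) = C * (exp (1 / v * dotp n x y) * exp (- (vnorm n y)\<^sup>2 / (2 * v)))" for y
  proof -
    have "(vnorm n (\<lambda>i. y i - x i))\<^sup>2 = (vnorm n y)\<^sup>2 - 2 * dotp n x y + (vnorm n x)\<^sup>2"
      unfolding vnorm_sq dotp_def
      by (simp add: power2_diff sum.distrib sum_subtractf sum_distrib_left algebra_simps)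
    then have "- (vnorm n (\<lambda>i. y i - x i))\<^sup>2 / (2 * v) = - l + (1 / v * dotp n x y + - (vnorm n y)\<^sup>2 / (2 * v))"
      using v by (simp only: l_def) (simp add: field_simps)
    then show ?thesis
      by (simp only: gauss_density_def exp_add C_def mult.assoc)
  qed
  have "(\<integral>\<^sup>+w. F (vnorm n (vadd n x w)) \<partial>gaussM n v)
      = (\<integral>\<^sup>+y. ennreal (gauss_density n v (\<lambda>i. y i - x i)) * F (vnorm n y) \<partial>Ln n)"
    by (rule nn_integral_gaussM_shift) measurable
  also have "\<dots> = (\<integral>\<^sup>+y. ennreal (exp (1 / v * dotp n x y)) * (ennreal (C * exp (- (vnorm n y)\<^sup>2 / (2 * v))) * F (vnorm n y)) \<partial>Ln n)"
    unfolding gd using C by (intro nn_integral_cong) (simp add: ennreal_mult mult_ac)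
  also have "\<dots> = (\<integral>\<^sup>+r. ennreal (2 * pi powr (real n / 2) * bessel_ser (real n / 2) ((vnorm n x * r * (1 / v))\<^sup>2 / 4) * r ^ (n - 1))
        * indicator {0<..} r * (ennreal (C * exp (- r\<^sup>2 / (2 * v))) * F r) \<partial>lborel)"
    by (rule nn_integral_Ln_exp[OF n]) measurable
  also have "\<dots> = (\<integral>\<^sup>+r. (\<Sum>j. ennreal (poisson_weight l j) * (ennreal (chi_density (n + 2 * j) v r) * F r)) \<partial>lborel)"
  proof (rule nn_integral_cong)
    fix r :: real
    let ?z = "(vnorm n x * r * (1 / v))\<^sup>2 / 4"
    show "ennreal (2 * pi powr (real n / 2) * bessel_ser (real n / 2) ?z * r ^ (n - 1))
        * indicator {0<..} r * (ennreal (C * exp (- r\<^sup>2 / (2 * v))) * F r)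
      = (\<Sum>j. ennreal (poisson_weight l j) * (ennreal (chi_density (n + 2 * j) v r) * F r))"
    proof (cases "r > 0")
      case True
      have nu: "real n / 2 > 0" using n by simp
      define K where "K = 2 * pi powr (real n / 2) * r ^ (n - 1) * (C * exp (- r\<^sup>2 / (2 * v)))"
      have K: "K \<ge> 0" using True C by (simp add: K_def)
      have trm: "poisson_weight l j * chi_density (n + 2 * j) v r = K * (bessel_coeff (real n / 2) j * ?z ^ j)" for j
      proof -
        have "n + 2 * j - 1 = (n - 1) + 2 * j" using n by simp
        then have e1: "r ^ (n + 2 * j - 1) = r ^ (n - 1) * r ^ (2 * j)" by (simp only: power_add)
        have e2: "(2 * v) powr (real (n + 2 * j) / 2) = (2 * v) powr (real n / 2) * (2 * v) ^ j"
          using v by (simp add: add_divide_distrib powr_add powr_realpow)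
        have e3: "real (n + 2 * j) / 2 = real n / 2 + real j" by (simp add: add_divide_distrib)
        have e4: "K = 2 * inverse ((2 * v) powr (real n / 2)) * r ^ (n - 1) * exp (- l) * exp (- r\<^sup>2 / (2 * v))"
        proof -
          have "(2 * pi * v) powr (- real n / 2) = inverse (pi powr (real n / 2) * (2 * v) powr (real n / 2))"
            using v by (simp add: powr_minus powr_mult[symmetric] mult_ac)
          then show ?thesis by (simp add: K_def C_def)
        qed
        have e5: "?z ^ j = l ^ j * r ^ (2 * j) * inverse ((2 * v) ^ j)"
        proof -
          have "?z = l * r\<^sup>2 / (2 * v)"
            by (simp add: l_def power_mult_distrib power_divide power2_eq_square mult_ac)
          then have "?z ^ j = (l * r\<^sup>2 / (2 * v)) ^ j" by (rule arg_cong)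
          also have "\<dots> = (l * r\<^sup>2) ^ j / (2 * v) ^ j" by (rule power_divide)
          finally show ?thesis
            by (simp only: power_mult_distrib[of l] power_mult divide_inverse)
        qed
        \<comment> \<open>A bare rearrangement of factors, stated for variables so that powers and
          Gamma values stay opaque.\<close>
        have alg: "E * lj / fj * (2 / (A * B * G) * (a * b) * X) = (2 * inverse A * a * E * X) * (inverse G / fj * (lj * b * inverse B))"
          for E lj fj A B G a b X :: real
          by (simp add: divide_inverse mult_ac)
        have "poisson_weight l j * chi_density (n + 2 * j) v r = exp (- l) * l ^ j / fact j
          * (2 / ((2 * v) powr (real (n + 2 * j) / 2) * Gamma (real (n + 2 * j) / 2)) * r ^ (n + 2 * j - 1) * exp (- r\<^sup>2 / (2 * v)))"
          using True by (simp add: poisson_weight_def chi_density_def chi_const_def)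
        then show ?thesis
          unfolding e1 e2 e4 e5 bessel_coeff_def rGamma_inverse_Gamma unfolding e3 alg .
      qed
      have "(\<lambda>j. K * (bessel_coeff (real n / 2) j * ?z ^ j)) sums (K * bessel_ser (real n / 2) ?z)"
        unfolding bessel_ser_def by (intro sums_mult summable_sums summable_bessel nu)
      then have "(\<Sum>j. ennreal (K * (bessel_coeff (real n / 2) j * ?z ^ j))) = ennreal (K * bessel_ser (real n / 2) ?z)"
        using K bessel_coeff_pos[OF nu] by (intro suminf_ennreal_eq) (simp_all add: less_imp_le)
      then have "ennreal (K * bessel_ser (real n / 2) ?z) * F r = (\<Sum>j. ennreal (poisson_weight l j * chi_density (n + 2 * j) v r) * F r)"
        by (simp add: trm)
      moreover have "ennreal (poisson_weight l j * chi_density (n + 2 * j) v r) * F r = ennreal (poisson_weight l j) * (ennreal (chi_density (n + 2 * j) v r) * F r)" for j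
        using poisson_weight_nonneg[OF l] chi_density_nonneg[of "n + 2 * j" v r] n v by (simp add: ennreal_mult mult.assoc)
      moreover have "ennreal (K * bessel_ser (real n / 2) ?z) * F r
        = ennreal (2 * pi powr (real n / 2) * bessel_ser (real n / 2) ?z * r ^ (n - 1))
        * indicator {0<..} r * (ennreal (C * exp (- r\<^sup>2 / (2 * v))) * F r)"
        using True C bessel_ser_pos[OF nu, of ?z]
        by (simp add: K_def ennreal_mult[symmetric] mult.assoc[symmetric]) (simp add: mult_ac)
      ultimately show ?thesis by simp
    qed (simp add: chi_density_def)
  qed
  also have "\<dots> = (\<Sum>j. \<integral>\<^sup>+r. ennreal (poisson_weight l j) * (ennreal (chi_density (n + 2 * j) v r) * F r) \<partial>lborel)"
    by (rule nn_integral_suminf) measurable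
  also have "\<dots> = (\<Sum>j. ennreal (poisson_weight l j) * (\<integral>\<^sup>+r. F r \<partial>chiM (n + 2 * j) v))"
    by (simp add: nn_integral_chiM nn_integral_cmult)
  finally show ?thesis by (simp add: l_def)
qed


text \<open>Quartic growth is allowed because concentration is derived from fourth moments. The
  bound concerns nonnegative radii only, since chi laws live on the positive axis.\<close>

definition growth :: "(real \<Rightarrow> real) \<Rightarrow> bool" where
  "growth f \<longleftrightarrow> f \<in> borel_measurable borel \<and> (\<exists>A. \<forall>r\<ge>0. \<bar>f r\<bar> \<le> A * (1 + r ^ 4))"

lemma growthD: "growth f \<Longrightarrow> f \<in> borel_measurable borel"
  by (simp add: growth_def)

lemma growthE:
  assumes "growth f"
  obtains A where "A \<ge> 0" "\<And>r. r \<ge> 0 \<Longrightarrow> \<bar>f r\<bar> \<le> A * (1 + r ^ 4)"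
proof -
  from assms obtain A where A: "\<And>r. r \<ge> 0 \<Longrightarrow> \<bar>f r\<bar> \<le> A * (1 + r ^ 4)" unfolding growth_def by blast
  have "0 \<le> A" using A[of 0] by simp
  then show ?thesis using A that by blast
qed

lemma growthI:
  assumes "f \<in> borel_measurable borel" "\<And>r. r \<ge> 0 \<Longrightarrow> \<bar>f r\<bar> \<le> A + B * r\<^sup>2" "A \<ge> 0" "B \<ge> 0"
  shows "growth f"
  unfolding growth_def
proof (intro conjI exI allI impI)
  fix r :: real assume r: "r \<ge> 0"
  have "0 \<le> (r\<^sup>2 - 1)\<^sup>2" by simp
  then have "2 * r\<^sup>2 \<le> 1 + r ^ 4" by (simp add: power2_eq_square algebra_simps power4_eq_xxxx)
  moreover have "0 \<le> r ^ 4" by simp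
  ultimately have "r\<^sup>2 \<le> 1 + r ^ 4" by linarith
  then have "A + B * r\<^sup>2 \<le> A * (1 + r ^ 4) + B * (1 + r ^ 4)"
    using assms(3,4) by (intro add_mono mult_left_mono) (auto simp: algebra_simps)
  then show "\<bar>f r\<bar> \<le> (A + B) * (1 + r ^ 4)"
    using assms(2)[OF r] by (simp add: algebra_simps)
qed fact

lemma growth_diff:
  assumes "growth f" "growth g"
  shows "growth (\<lambda>r. f r - g r)"
proof -
  obtain A where A: "\<And>r. r \<ge> 0 \<Longrightarrow> \<bar>f r\<bar> \<le> A * (1 + r ^ 4)" using assms(1) growthE by blast
  obtain B where B: "\<And>r. r \<ge> 0 \<Longrightarrow> \<bar>g r\<bar> \<le> B * (1 + r ^ 4)" using assms(2) growthE by blast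
  have "\<bar>f r - g r\<bar> \<le> (A + B) * (1 + r ^ 4)" if "r \<ge> 0" for r
    using A[OF that] B[OF that] by (simp add: algebra_simps)
  moreover have "(\<lambda>r. f r - g r) \<in> borel_measurable borel" using assms by (auto simp: growth_def)
  ultimately show ?thesis unfolding growth_def by blast
qed

lemma growth_pos:
  assumes "growth f"
  shows "growth (\<lambda>r. max 0 (f r))"
proof -
  obtain A where A: "\<And>r. r \<ge> 0 \<Longrightarrow> \<bar>f r\<bar> \<le> A * (1 + r ^ 4)" using assms growthE by blast
  have "\<bar>max 0 (f r)\<bar> \<le> A * (1 + r ^ 4)" if "r \<ge> 0" for r
    using A[OF that] by linarith
  moreover have "(\<lambda>r. max 0 (f r)) \<in> borel_measurable borel" using growthD[OF assms] by measurable
  ultimately show ?thesis unfolding growth_def by blast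
qed

lemma growth_uminus: "growth f \<Longrightarrow> growth (\<lambda>r. - f r)"
  unfolding growth_def by auto

section \<open>Means under chi laws and their Poisson mixtures\<close>

definition chi_mean :: "nat \<Rightarrow> real \<Rightarrow> (real \<Rightarrow> real) \<Rightarrow> real" where
  "chi_mean m v f = (\<integral>r. f r \<partial>chiM m v)"

lemma nn_integral_chiM_shift:
  assumes m: "m \<ge> 1" and v: "v > 0" and [measurable]: "F \<in> borel_measurable borel"
  shows "(\<integral>\<^sup>+r. ennreal (r\<^sup>2) * F r \<partial>chiM m v) = ennreal (real m * v) * (\<integral>\<^sup>+r. F r \<partial>chiM (m + 2) v)"
proof -
  have "ennreal (chi_density m v r) * (ennreal (r\<^sup>2) * F r) = ennreal (real m * v) * (ennreal (chi_density (m + 2) v r) * F r)" for r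
    using chi_density_nonneg[OF m v, of r] chi_density_nonneg[of "m + 2" v r] v chi_density_shift[OF m v, of r]
    by (simp add: mult.assoc[symmetric] ennreal_mult[symmetric])
  then show ?thesis
    by (simp add: nn_integral_chiM nn_integral_cmult)
qed

lemma AE_chiM: "AE r in chiM m v. r > 0"
  unfolding chiM_def by (subst AE_density) (auto simp: chi_density_def split: if_splits)

lemma chiM_moment4:
  assumes m: "m \<ge> 1" and v: "v > 0"
  shows "(\<integral>\<^sup>+r. ennreal (r ^ 4) \<partial>chiM m v) = ennreal (real m * (real m + 2) * v\<^sup>2)"
    and "(\<integral>\<^sup>+r. ennreal (r\<^sup>2) \<partial>chiM m v) = ennreal (real m * v)"
proof -
  have 2: "(\<integral>\<^sup>+r. ennreal (r\<^sup>2) \<partial>chiM m v) = ennreal (real m * v)" if "m \<ge> 1" for m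
    using nn_integral_chiM_shift[OF that v, of "\<lambda>_. 1"] prob_space.emeasure_space_1[OF prob_space_chiM[of "m + 2" v]] v by simp
  show "(\<integral>\<^sup>+r. ennreal (r\<^sup>2) \<partial>chiM m v) = ennreal (real m * v)" by (rule 2[OF m])
  have "(\<integral>\<^sup>+r. ennreal (r ^ 4) \<partial>chiM m v) = (\<integral>\<^sup>+r. ennreal (r\<^sup>2) * ennreal (r\<^sup>2) \<partial>chiM m v)"
    by (simp add: ennreal_mult[symmetric] power_add[symmetric])
  also have "\<dots> = ennreal (real m * v) * ennreal (real (m + 2) * v)"
    using nn_integral_chiM_shift[OF m v, of "\<lambda>r. ennreal (r\<^sup>2)"] 2[of "m + 2"] by simp
  also have "\<dots> = ennreal (real m * (real m + 2) * v\<^sup>2)"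
    using v by (subst ennreal_mult[symmetric]) (auto simp: power2_eq_square algebra_simps)
  finally show "(\<integral>\<^sup>+r. ennreal (r ^ 4) \<partial>chiM m v) = ennreal (real m * (real m + 2) * v\<^sup>2)" .
qed

text \<open>The bound is kept explicit in \<open>m\<close>: its quadratic growth is what the
  factorials in the Poisson mixture have to beat.\<close>

lemma growth_chiM:
  assumes m: "m \<ge> 1" and v: "v > 0" and f: "growth f" and A: "A \<ge> 0" "\<And>r. r \<ge> 0 \<Longrightarrow> \<bar>f r\<bar> \<le> A * (1 + r ^ 4)"
  shows "integrable (chiM m v) f" and "\<bar>chi_mean m v f\<bar> \<le> A * (1 + real m * (real m + 2) * v\<^sup>2)"
proof -
  have [measurable]: "f \<in> borel_measurable borel" using f by (rule growthD)
  have "(\<integral>\<^sup>+r. ennreal (norm (f r)) \<partial>chiM m v) \<le> (\<integral>\<^sup>+r. ennreal A * (1 + ennreal (r ^ 4)) \<partial>chiM m v)"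
  proof (rule nn_integral_mono_AE, use AE_chiM[of m v] in eventually_elim)
    fix r :: real assume "r > 0"
    then show "ennreal (norm (f r)) \<le> ennreal A * (1 + ennreal (r ^ 4))"
      using A by (simp add: ennreal_mult[symmetric] ennreal_1[symmetric] ennreal_plus[symmetric] ennreal_leI del: ennreal_plus ennreal_1)
  qed
  also have "\<dots> = ennreal A * (1 + ennreal (real m * (real m + 2) * v\<^sup>2))"
    using prob_space.emeasure_space_1[OF prob_space_chiM[OF m v]] chiM_moment4[OF m v]
    by (simp add: nn_integral_cmult nn_integral_add)
  also have "\<dots> = ennreal (A * (1 + real m * (real m + 2) * v\<^sup>2))"
    using A by (simp add: ennreal_mult[symmetric] ennreal_1[symmetric] ennreal_plus[symmetric] del: ennreal_plus ennreal_1)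
  finally have le: "(\<integral>\<^sup>+r. ennreal (norm (f r)) \<partial>chiM m v) \<le> ennreal (A * (1 + real m * (real m + 2) * v\<^sup>2))" .
  show int: "integrable (chiM m v) f"
  proof (rule integrableI_bounded)
    show "(\<integral>\<^sup>+r. ennreal (norm (f r)) \<partial>chiM m v) < \<infinity>"
      using le by (rule le_less_trans) simp
  qed simp
  have "ennreal \<bar>chi_mean m v f\<bar> \<le> (\<integral>\<^sup>+r. ennreal (norm (f r)) \<partial>chiM m v)"
    unfolding chi_mean_def using integral_norm_bound_ennreal[OF int] by simp
  also note le
  finally show "\<bar>chi_mean m v f\<bar> \<le> A * (1 + real m * (real m + 2) * v\<^sup>2)"
    using A by (subst (asm) ennreal_le_iff) (auto intro!: mult_nonneg_nonneg add_nonneg_nonneg)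
qed

lemma integrable_chiM: "m \<ge> 1 \<Longrightarrow> v > 0 \<Longrightarrow> growth f \<Longrightarrow> integrable (chiM m v) f"
  by (metis growthE growth_chiM(1))

lemma integral_chi_density:
  assumes m: "m \<ge> 1" and v: "v > 0" and f: "growth f"
  shows "integrable lborel (\<lambda>r. chi_density m v r * f r)"
    and "(\<integral>r. chi_density m v r * f r \<partial>lborel) = chi_mean m v f"
proof -
  have [measurable]: "f \<in> borel_measurable borel" using f by (rule growthD)
  have nn: "AE r in lborel. 0 \<le> chi_density m v r" using chi_density_nonneg[OF m v] by simp
  show "integrable lborel (\<lambda>r. chi_density m v r * f r)"
    using integrable_chiM[OF m v f] unfolding chiM_def by (subst (asm) integrable_density) (use nn in auto)
  show "(\<integral>r. chi_density m v r * f r \<partial>lborel) = chi_mean m v f"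
    unfolding chi_mean_def chiM_def by (subst integral_density) (use nn in auto)
qed

lemma summable_chi_mean:
  assumes n: "n \<ge> 1" and v: "v > 0" and f: "growth f"
  shows "summable (\<lambda>j. norm (chi_mean (n + 2 * j) v f / fact j * l ^ j))"
proof -
  obtain A where A: "A \<ge> 0" "\<And>r. r \<ge> 0 \<Longrightarrow> \<bar>f r\<bar> \<le> A * (1 + r ^ 4)" using growthE[OF f] by blast
  define B where "B = A * (1 + v\<^sup>2) * (real n + 2)\<^sup>2"
  show ?thesis
  proof (rule summable_comparison_test')
    show "summable (\<lambda>j. B * (inverse (fact j) * (4 * \<bar>l\<bar>) ^ j))"
      by (intro summable_mult summable_exp)
    fix j :: nat
    \<comment> \<open>Trades the polynomial in j for a geometric factor: the squared degrees of
      freedom cost 4^j, which is absorbed into the argument of an exponential series.\<close>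
    have two: "real j + 1 \<le> 2 ^ j"
      by (induction j) auto
    have "real (n + 2 * j) + 2 \<le> (real n + 2) * (real j + 1)" by (simp add: algebra_simps)
    also have "\<dots> \<le> (real n + 2) * 2 ^ j" using two by (intro mult_left_mono) auto
    finally have m: "real (n + 2 * j) + 2 \<le> (real n + 2) * 2 ^ j" .
    have "\<bar>chi_mean (n + 2 * j) v f\<bar> \<le> A * (1 + real (n + 2 * j) * (real (n + 2 * j) + 2) * v\<^sup>2)"
      using growth_chiM(2)[of "n + 2 * j" v f A] n v f A by auto
    also have "\<dots> \<le> A * ((1 + v\<^sup>2) * (real (n + 2 * j) + 2)\<^sup>2)"
    proof (rule mult_left_mono)
      define M where "M = real (n + 2 * j)"
      have M: "M \<ge> 0" by (simp add: M_def)
      have "M * (M + 2) \<le> (M + 2)\<^sup>2" "1 \<le> (M + 2)\<^sup>2"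
        using M by (auto simp: power2_eq_square algebra_simps)
      then have "1 + M * (M + 2) * v\<^sup>2 \<le> (M + 2)\<^sup>2 + (M + 2)\<^sup>2 * v\<^sup>2"
        by (intro add_mono mult_right_mono) auto
      then show "1 + M * (M + 2) * v\<^sup>2 \<le> (1 + v\<^sup>2) * (M + 2)\<^sup>2" by (simp add: algebra_simps)
    qed fact
    also have "\<dots> \<le> A * ((1 + v\<^sup>2) * ((real n + 2) * 2 ^ j)\<^sup>2)"
      using A m by (intro mult_left_mono power_mono) auto
    also have "\<dots> = B * 4 ^ j"
      by (simp add: B_def power_mult_distrib power_mult[symmetric] mult.commute[of j 2]) (simp add: power_mult)
    finally have b: "\<bar>chi_mean (n + 2 * j) v f\<bar> \<le> B * 4 ^ j" .
    have "norm (norm (chi_mean (n + 2 * j) v f / fact j * l ^ j)) = \<bar>chi_mean (n + 2 * j) v f\<bar> * (inverse (fact j) * \<bar>l\<bar> ^ j)"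
      by (simp add: abs_mult power_abs divide_inverse mult_ac)
    also have "\<dots> \<le> (B * 4 ^ j) * (inverse (fact j) * \<bar>l\<bar> ^ j)"
      using b by (intro mult_right_mono) auto
    finally show "norm (norm (chi_mean (n + 2 * j) v f / fact j * l ^ j)) \<le> B * (inverse (fact j) * (4 * \<bar>l\<bar>) ^ j)"
      by (simp add: power_mult_distrib mult_ac)
  qed
qed

text \<open>The Gaussian mean of \<open>f\<close> of the norm around a point at distance
  \<open>y\<close> from the origin, written as its Poisson mixture. The formula involves no choice
  of such a point, and it is a power series in y^2 times an exponential, so that it can be
  differentiated at every real \<open>y\<close>, including 0.\<close>

definition radial_mean :: "nat \<Rightarrow> real \<Rightarrow> (real \<Rightarrow> real) \<Rightarrow> real \<Rightarrow> real" where
  "radial_mean n v f y = (\<Sum>j. poisson_weight (y\<^sup>2 / (2 * v)) j * chi_mean (n + 2 * j) v f)"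

lemma summable_poisson_weight_chi_mean:
  assumes "n \<ge> 1" "v > 0" "growth f"
  shows "summable (\<lambda>j. poisson_weight l j * chi_mean (n + 2 * j) v f)"
proof -
  have "summable (\<lambda>j. exp (- l) * (chi_mean (n + 2 * j) v f / fact j * l ^ j))"
    by (intro summable_mult summable_norm_cancel[OF summable_chi_mean] assms)
  then show ?thesis by (simp add: poisson_weight_def mult_ac)
qed

lemma summable_chi_mean_pow:
  assumes "n \<ge> 1" "v > 0" "growth f"
  shows "summable (\<lambda>j. chi_mean (n + 2 * j) v f / fact j * l ^ j)"
  by (rule summable_norm_cancel[OF summable_chi_mean[OF assms]])

lemma radial_mean_power_series:
  assumes "n \<ge> 1" "v > 0" "growth f"
  shows "radial_mean n v f y
    = exp (- (y\<^sup>2 / (2 * v))) * (\<Sum>j. chi_mean (n + 2 * j) v f / fact j * (y\<^sup>2 / (2 * v)) ^ j)"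
  unfolding radial_mean_def
  by (subst suminf_mult[OF summable_chi_mean_pow[OF assms], symmetric]) (simp add: poisson_weight_def mult_ac)

text \<open>For nonnegative functions this is the Poisson mixture of extended-real integrals; the
  general case follows by subtracting the parts \<open>?p\<close> and \<open>?q\<close>.\<close>

lemma gaussM_radial:
  assumes n: "n \<ge> 1" and v: "v > 0" and f: "growth f"
  shows "integrable (gaussM n v) (\<lambda>w. f (vnorm n (vadd n x w)))"
    and "(\<integral>w. f (vnorm n (vadd n x w)) \<partial>gaussM n v) = radial_mean n v f (vnorm n x)"
proof -
  define l where "l = (vnorm n x)\<^sup>2 / (2 * v)"
  have l: "l \<ge> 0" using v by (simp add: l_def)
  have mv[measurable]: "(\<lambda>w. vnorm n (vadd n x w)) \<in> borel_measurable (Rn n)"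
  proof -
    have "vadd n x = vaffine n x 1" by (simp add: vadd_def vaffine_def fun_eq_iff)
    then show ?thesis by simp
  qed
  have pos: "integrable (gaussM n v) (\<lambda>w. h (vnorm n (vadd n x w))) \<and>
      (\<integral>w. h (vnorm n (vadd n x w)) \<partial>gaussM n v) = radial_mean n v h (vnorm n x)"
    if h: "growth h" and nn: "\<And>r. h r \<ge> 0" for h
  proof -
    have [measurable]: "h \<in> borel_measurable borel" using h by (rule growthD)
    have cn: "chi_mean m v h \<ge> 0" for m unfolding chi_mean_def by (intro Bochner_Integration.integral_nonneg nn)
    have "(\<integral>\<^sup>+w. ennreal (h (vnorm n (vadd n x w))) \<partial>gaussM n v)
      = (\<Sum>j. ennreal (poisson_weight l j) * (\<integral>\<^sup>+r. ennreal (h r) \<partial>chiM (n + 2 * j) v))"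
      unfolding l_def by (rule nn_integral_gaussM_radial[OF n v]) measurable
    also have "\<dots> = (\<Sum>j. ennreal (poisson_weight l j * chi_mean (n + 2 * j) v h))"
      using poisson_weight_nonneg[OF l] cn nn integrable_chiM[OF _ v h] n
      by (simp add: nn_integral_eq_integral chi_mean_def ennreal_mult)
    also have "\<dots> = ennreal (radial_mean n v h (vnorm n x))"
      unfolding radial_mean_def l_def[symmetric]
      by (intro suminf_ennreal2 summable_poisson_weight_chi_mean n v h) (auto intro!: mult_nonneg_nonneg poisson_weight_nonneg[OF l] cn)
    finally have e: "(\<integral>\<^sup>+w. ennreal (h (vnorm n (vadd n x w))) \<partial>gaussM n v) = ennreal (radial_mean n v h (vnorm n x))" .
    have T: "radial_mean n v h (vnorm n x) \<ge> 0"
      unfolding radial_mean_def l_def[symmetric]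
      by (intro suminf_nonneg summable_poisson_weight_chi_mean n v h) (auto intro!: mult_nonneg_nonneg poisson_weight_nonneg[OF l] cn)
    have "has_bochner_integral (gaussM n v) (\<lambda>w. h (vnorm n (vadd n x w))) (radial_mean n v h (vnorm n x))"
      by (rule has_bochner_integral_nn_integral) (use e T nn in auto)
    then show ?thesis by (simp add: has_bochner_integral_iff)
  qed
  let ?p = "\<lambda>r. max 0 (f r)" and ?q = "\<lambda>r. max 0 (- f r)"
  have gp: "growth ?p" "growth ?q" using f by (auto intro: growth_pos growth_uminus)
  have fe: "(\<lambda>r. ?p r - ?q r) = f" by (rule ext) auto
  have fw: "(\<lambda>w. f (vnorm n (vadd n x w))) = (\<lambda>w. ?p (vnorm n (vadd n x w)) - ?q (vnorm n (vadd n x w)))"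
    by (rule ext) auto
  have ip: "integrable (gaussM n v) (\<lambda>w. ?p (vnorm n (vadd n x w)))" "integrable (gaussM n v) (\<lambda>w. ?q (vnorm n (vadd n x w)))"
    using pos[OF gp(1)] pos[OF gp(2)] by auto
  show "integrable (gaussM n v) (\<lambda>w. f (vnorm n (vadd n x w)))"
    unfolding fw by (intro Bochner_Integration.integrable_diff ip)
  have ce: "chi_mean m v f = chi_mean m v ?p - chi_mean m v ?q" if "m \<ge> 1" for m
    using Bochner_Integration.integral_diff[OF integrable_chiM[OF that v gp(1)] integrable_chiM[OF that v gp(2)]]
    unfolding chi_mean_def fe .
  have "(\<integral>w. f (vnorm n (vadd n x w)) \<partial>gaussM n v) = radial_mean n v ?p (vnorm n x) - radial_mean n v ?q (vnorm n x)"
    unfolding fw Bochner_Integration.integral_diff[OF ip] using pos[OF gp(1)] pos[OF gp(2)] by simp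
  also have "\<dots> = radial_mean n v f (vnorm n x)"
    unfolding radial_mean_def suminf_diff[OF summable_poisson_weight_chi_mean[OF n v gp(1)] summable_poisson_weight_chi_mean[OF n v gp(2)]]
    using n by (intro suminf_cong) (simp add: ce right_diff_distrib)
  finally show "(\<integral>w. f (vnorm n (vadd n x w)) \<partial>gaussM n v) = radial_mean n v f (vnorm n x)" .
qed

text \<open>The derivative of r * chi_density m v r * f r, which is \<open>H\<close>, integrates to
  0 over the half-line. By the shift identity this derivative is a combination of chi densities with
  \<open>m\<close> and \<open>m + 2\<close> degrees.\<close>

lemma chi_mean_parts:
  assumes m: "m \<ge> 1" and v: "v > 0" and f: "growth f" and g: "growth g"
    and D: "\<And>r. r > 0 \<Longrightarrow> (f has_real_derivative r * g r) (at r)"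
    and c: "\<And>r. r > 0 \<Longrightarrow> isCont g r"
  shows "chi_mean (m + 2) v f - chi_mean m v f = v * chi_mean (m + 2) v g"
proof -
  define K where "K = chi_const m v"
  have K: "K > 0" unfolding K_def by (rule chi_const_pos[OF m v])
  define H where "H = (\<lambda>r. K * r ^ m * exp (- r\<^sup>2 / (2 * v)) * f r)"
  define h where "h = (\<lambda>r. K * exp (- r\<^sup>2 / (2 * v)) * (real m * r ^ (m - 1) * f r - r ^ (m + 1) / v * f r + r ^ (m + 1) * g r))"
  have [measurable]: "f \<in> borel_measurable borel" "g \<in> borel_measurable borel" using f g by (auto dest: growthD)
  have e1: "chi_density m v r = K * r ^ (m - 1) * exp (- r\<^sup>2 / (2 * v))" if "r > 0" for r
    using that by (simp add: chi_density_def K_def)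
  have e2: "real m * v * chi_density (m + 2) v r = K * r ^ (m + 1) * exp (- r\<^sup>2 / (2 * v))" if "r > 0" for r
  proof -
    have "r ^ (m - 1) * r\<^sup>2 = r ^ (m + 1)" using m by (simp add: power_add[symmetric])
    then show ?thesis unfolding chi_density_shift[OF m v, symmetric] e1[OF that] by (simp add: mult_ac)
  qed
  have hd: "h r = real m * (chi_density m v r * f r) - real m * (chi_density (m + 2) v r * f r) + real m * v * (chi_density (m + 2) v r * g r)" if "r > 0" for r
  proof -
    have "chi_density (m + 2) v r = K * r ^ (m + 1) * exp (- r\<^sup>2 / (2 * v)) / (real m * v)"
      using e2[OF that, symmetric] m v by simp
    then show ?thesis unfolding e1[OF that] h_def using m v by (simp add: algebra_simps)
  qed
  note I = integral_chi_density[OF _ v]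
  have hi: "indicator {0<..} r *\<^sub>R h r = real m * (chi_density m v r * f r) - real m * (chi_density (m + 2) v r * f r) + real m * v * (chi_density (m + 2) v r * g r)" for r
    using hd[of r] by (cases "r > 0") (auto simp: chi_density_def)
  have int: "set_integrable lborel {0<..} h"
    unfolding set_integrable_def hi using m by (intro Bochner_Integration.integrable_add Bochner_Integration.integrable_diff integrable_mult_right I f g) auto
  have val: "(LBINT r:{0<..}. h r) = real m * chi_mean m v f - real m * chi_mean (m + 2) v f + real m * v * chi_mean (m + 2) v g"
    unfolding set_lebesgue_integral_def hi using m
    by (simp add: I f g Bochner_Integration.integral_add Bochner_Integration.integral_diff)
  obtain A where A: "A \<ge> 0" "\<And>r. r \<ge> 0 \<Longrightarrow> \<bar>f r\<bar> \<le> A * (1 + r ^ 4)" using growthE[OF f] by blast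
  have Hb: "norm (H r) \<le> K * r ^ m * exp (- r\<^sup>2 / (2 * v)) * (A * (1 + r ^ 4))" if "r \<ge> 0" for r
    unfolding H_def using K that A(2)[OF that] by (simp add: abs_mult mult_left_mono)
  have "(LBINT r=0..\<infinity>. h r) = 0 - 0"
  proof (rule interval_integral_FTC_integrable)
    fix x :: real assume "0 < ereal x" "ereal x < \<infinity>"
    then have x: "x > 0" by simp
    have "(H has_real_derivative h x) (at x)"
    proof -
      define E where "E = exp (- x\<^sup>2 / (2 * v))"
      have DE: "((\<lambda>r. exp (- r\<^sup>2 / (2 * v))) has_real_derivative - (x / v) * E) (at x)"
        unfolding E_def using v by (auto intro!: derivative_eq_intros)
      have "(H has_real_derivative (K * (real m * x ^ (m - 1)) * E + (- (x / v) * E) * (K * x ^ m)) * f x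
          + (x * g x) * (K * x ^ m * E)) (at x)"
      proof -
        have "((\<lambda>r. K * r ^ m) has_real_derivative K * (real m * x ^ (m - 1))) (at x)"
          by (auto intro!: derivative_eq_intros)
        from DERIV_mult[OF DERIV_mult[OF this DE] D[OF x]] show ?thesis
          unfolding H_def E_def .
      qed
      moreover have "(K * (real m * x ^ (m - 1)) * E + (- (x / v) * E) * (K * x ^ m)) * f x + (x * g x) * (K * x ^ m * E) = h x"
        unfolding h_def E_def by (simp add: algebra_simps)
      ultimately show ?thesis by simp
    qed
    then show "(H has_vector_derivative h x) (at x)"
      by (simp add: has_real_derivative_iff_has_vector_derivative)
    have "isCont f x" using D[OF x] by (rule DERIV_isCont)
    then show "isCont h x"
      unfolding h_def using c[OF x] v by (intro continuous_intros) auto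
  next
    show "set_integrable lborel (einterval 0 \<infinity>) h"
      using int by (simp add: einterval_def greaterThan_def)
    \<comment> \<open>At the left end the factor r^m vanishes, as \<open>m\<close> is at least 1,
      while \<open>f\<close> stays bounded.\<close>
    have l0: "((\<lambda>r. K * r ^ m * exp (- r\<^sup>2 / (2 * v)) * (A * (1 + r ^ 4))) \<longlongrightarrow> K * 0 ^ m * exp (- 0\<^sup>2 / (2 * v)) * (A * (1 + 0 ^ 4))) (at_right 0)"
      using v by (intro tendsto_intros) auto
    have "(H \<longlongrightarrow> 0) (at_right 0)"
    proof (rule Lim_null_comparison)
      show "eventually (\<lambda>r. norm (H r) \<le> K * r ^ m * exp (- r\<^sup>2 / (2 * v)) * (A * (1 + r ^ 4))) (at_right 0)"
        unfolding eventually_at_right_field by (intro exI[of _ 1] conjI allI impI Hb) auto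
      show "((\<lambda>r. K * r ^ m * exp (- r\<^sup>2 / (2 * v)) * (A * (1 + r ^ 4))) \<longlongrightarrow> 0) (at_right 0)"
        using l0 m by (simp add: power_0_left)
    qed
    then show "((H \<circ> real_of_ereal) \<longlongrightarrow> 0) (at_right 0)"
      unfolding zero_ereal_def by (simp add: ereal_tendsto_simps1)
    have "(H \<longlongrightarrow> 0) at_top"
    proof (rule Lim_null_comparison)
      \<comment> \<open>Beyond r = 2 v the Gaussian factor is at most exp (- r), which leaves a
        polynomial divided by an exponential.\<close>
      show "eventually (\<lambda>r. norm (H r) \<le> K * A * (r ^ m / exp r + r ^ (m + 4) / exp r)) at_top"
        using eventually_ge_at_top[of "max 0 (2 * v)"]
      proof eventually_elim
        case (elim r)
        then have r: "r \<ge> 0" "r \<ge> 2 * v" by auto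
        have "2 * v * r \<le> r * r" using r by (intro mult_right_mono) auto
        then have "r \<le> r\<^sup>2 / (2 * v)" using v by (simp add: field_simps power2_eq_square)
        then have e: "exp (- r\<^sup>2 / (2 * v)) \<le> exp (- r)" by simp
        have "norm (H r) \<le> K * r ^ m * exp (- r\<^sup>2 / (2 * v)) * (A * (1 + r ^ 4))" by (rule Hb[OF r(1)])
        also have "\<dots> \<le> K * r ^ m * exp (- r) * (A * (1 + r ^ 4))"
          using e K A r by (intro mult_right_mono mult_left_mono) auto
        also have "\<dots> = K * A * (r ^ m / exp r + r ^ (m + 4) / exp r)"
          by (simp add: exp_minus field_simps power_add)
        finally show ?case .
      qed
      have "((\<lambda>r. K * A * (r ^ m / exp r + r ^ (m + 4) / exp r)) \<longlongrightarrow> K * A * (0 + 0)) at_top"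
        by (intro tendsto_intros tendsto_power_div_exp_0)
      then show "((\<lambda>r. K * A * (r ^ m / exp r + r ^ (m + 4) / exp r)) \<longlongrightarrow> 0) at_top" by simp
    qed
    then show "((H \<circ> real_of_ereal) \<longlongrightarrow> 0) (at_left \<infinity>)"
      by (simp add: ereal_tendsto_simps1)
  qed auto
  then have "real m * chi_mean m v f - real m * chi_mean (m + 2) v f + real m * v * chi_mean (m + 2) v g = 0"
    using val by (simp add: interval_lebesgue_integral_0_infty)
  then have "real m * (chi_mean m v f - chi_mean (m + 2) v f + v * chi_mean (m + 2) v g) = 0" by (simp add: algebra_simps)
  then show ?thesis using m by simp
qed

text \<open>In the form exp (- l) * P l with l = y^2 / (2 v), the derivative in l replaces every
  coefficient by its difference to the next one. \<open>chi_mean_parts\<close> evaluates this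
  difference as v times a mean of \<open>g\<close> in two more degrees, and the chain rule
  contributes y / v.\<close>

lemma DERIV_radial_mean:
  assumes n: "n \<ge> 1" and v: "v > 0" and f: "growth f" and g: "growth g"
    and D: "\<And>r. r > 0 \<Longrightarrow> (f has_real_derivative r * g r) (at r)"
    and c: "\<And>r. r > 0 \<Longrightarrow> isCont g r"
  shows "(radial_mean n v f has_real_derivative y * radial_mean (n + 2) v g y) (at y)"
proof -
  define a where "a = (\<lambda>j. chi_mean (n + 2 * j) v f / fact j)"
  define P where "P = (\<lambda>l. \<Sum>j. a j * l ^ j)"
  have sa: "summable (\<lambda>j. a j * l ^ j)" for l
    unfolding a_def by (rule summable_chi_mean_pow[OF n v f])
  have radial_mean_P: "radial_mean n v f y = exp (- (y\<^sup>2 / (2 * v))) * P (y\<^sup>2 / (2 * v))" for y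
    unfolding P_def a_def by (rule radial_mean_power_series[OF n v f])
  have DP: "(P has_field_derivative (\<Sum>j. diffs a j * l ^ j)) (at l)" for l
    unfolding P_def by (rule termdiffs_strong_converges_everywhere[OF sa])
  have da: "diffs a j = chi_mean (n + 2 * j + 2) v f / fact j" for j
    by (simp add: diffs_def a_def del: of_nat_Suc)
  have sd: "summable (\<lambda>j. diffs a j * l ^ j)" for l
  proof -
    have "summable (\<lambda>j. chi_mean (n + 2 + 2 * j) v f / fact j * l ^ j)"
      by (rule summable_chi_mean_pow[OF _ v f]) (use n in simp)
    then show ?thesis by (simp add: da add_ac)
  qed
  have diff: "(\<Sum>j. diffs a j * l ^ j) - P l = v * (exp l * radial_mean (n + 2) v g y)" if l: "l = y\<^sup>2 / (2 * v)" for l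
  proof -
    have "(\<Sum>j. diffs a j * l ^ j) - P l = (\<Sum>j. diffs a j * l ^ j - a j * l ^ j)"
      unfolding P_def by (rule suminf_diff[OF sd sa])
    also have "\<dots> = (\<Sum>j. (v * exp l) * (poisson_weight l j * chi_mean (n + 2 + 2 * j) v g))"
    proof (rule suminf_cong)
      fix j
      have "chi_mean (n + 2 * j + 2) v f - chi_mean (n + 2 * j) v f = v * chi_mean (n + 2 * j + 2) v g"
        by (rule chi_mean_parts) (use n v f g D c in auto)
      then have "diffs a j - a j = v * chi_mean (n + 2 * j + 2) v g / fact j"
        by (simp only: da) (simp add: a_def diff_divide_distrib[symmetric])
      then have "diffs a j * l ^ j - a j * l ^ j = v * chi_mean (n + 2 * j + 2) v g / fact j * l ^ j"
        by (simp add: left_diff_distrib[symmetric])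
      then show "diffs a j * l ^ j - a j * l ^ j = (v * exp l) * (poisson_weight l j * chi_mean (n + 2 + 2 * j) v g)"
      proof -
        have "(v * exp l) * (poisson_weight l j * c) = v * (exp l * exp (- l)) * c / fact j * l ^ j" for c
          by (simp add: poisson_weight_def mult_ac)
        moreover have "exp l * exp (- l) = 1" by (simp add: exp_minus)
        moreover have "n + 2 + 2 * j = n + 2 * j + 2" by simp
        ultimately show ?thesis using \<open>diffs a j * l ^ j - a j * l ^ j = _\<close> by simp
      qed
    qed
    also have "\<dots> = (v * exp l) * radial_mean (n + 2) v g y"
      unfolding radial_mean_def l by (rule suminf_mult[OF summable_poisson_weight_chi_mean]) (use n v g in auto)
    finally show ?thesis by simp
  qed
  define l where "l = y\<^sup>2 / (2 * v)"
  have dl: "((\<lambda>y. y\<^sup>2 / (2 * v)) has_real_derivative y / v) (at y)"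
    using v by (auto intro!: derivative_eq_intros)
  have "((\<lambda>y. exp (- (y\<^sup>2 / (2 * v)))) has_real_derivative exp (- l) * (- (y / v))) (at y)"
    unfolding l_def by (rule DERIV_chain2[OF DERIV_exp DERIV_minus[OF dl]])
  from DERIV_mult[OF this DERIV_chain2[OF DP dl]]
  have D1: "(radial_mean n v f has_real_derivative exp (- l) * (- (y / v)) * P l + (\<Sum>j. diffs a j * l ^ j) * (y / v) * exp (- l)) (at y)"
    unfolding l_def radial_mean_P[abs_def] .
  have "exp (- l) * (- (y / v)) * P l + (\<Sum>j. diffs a j * l ^ j) * (y / v) * exp (- l)
     = exp (- l) * (y / v) * ((\<Sum>j. diffs a j * l ^ j) - P l)" by (simp add: algebra_simps)
  also have "\<dots> = exp (- l) * (y / v) * (v * (exp l * radial_mean (n + 2) v g y))"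
    unfolding diff[OF l_def] ..
  also have "\<dots> = (exp (- l) * exp l) * (y / v * v) * radial_mean (n + 2) v g y" by (simp only: mult_ac)
  also have "\<dots> = y * radial_mean (n + 2) v g y"
    using v by (simp add: exp_minus)
  finally show ?thesis using D1 by simp
qed

subsection \<open>Mutual information with bounded input\<close>

lemma vnorm_L2: "vnorm n x = L2_set x {..<n}"
  by (simp add: vnorm_def L2_set_def)

lemma vnorm_diff_le: "vnorm n (\<lambda>i. y i - x i) \<le> vnorm n y + vnorm n x"
proof -
  have "L2_set (\<lambda>i. y i + (- x i)) {..<n} \<le> L2_set y {..<n} + L2_set (\<lambda>i. - x i) {..<n}"
    by (rule L2_set_triangle_ineq)
  then show ?thesis by (simp add: vnorm_L2) (simp add: L2_set_def)
qed

lemma vnorm_vadd_le: "vnorm n (vadd n x w) \<le> vnorm n x + vnorm n w"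
  using vnorm_diff_le[of n x "\<lambda>i. - w i"] by (simp add: vnorm_def vadd_def)

lemma measurable_gauss_diff[measurable (raw)]:
  assumes f: "f \<in> M \<rightarrow>\<^sub>M Rn n" and g: "g \<in> M \<rightarrow>\<^sub>M Rn n"
  shows "(\<lambda>p. gauss_density n v (\<lambda>i. f p i - g p i)) \<in> borel_measurable M"
proof -
  have [measurable]: "(\<lambda>x. f x i) \<in> borel_measurable M" "(\<lambda>x. g x i) \<in> borel_measurable M" if "i < n" for i
    by (rule measurable_compose[OF _ measurable_coord[OF that]], fact)+
  show ?thesis unfolding gauss_density_def vnorm_def by measurable
qed

lemma gauss_density_pos: "v > 0 \<Longrightarrow> gauss_density n v x > 0"
  by (simp add: gauss_density_def)

definition out_density :: "nat \<Rightarrow> real \<Rightarrow> (nat \<Rightarrow> real) measure \<Rightarrow> (nat \<Rightarrow> real) \<Rightarrow> real" where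
  "out_density n v P y = (\<integral>x. gauss_density n v (\<lambda>i. y i - x i) \<partial>P)"

definition out_measure :: "nat \<Rightarrow> real \<Rightarrow> (nat \<Rightarrow> real) measure \<Rightarrow> (nat \<Rightarrow> real) measure" where
  "out_measure n v P = distr (P \<Otimes>\<^sub>M gaussM n v) (Rn n) (\<lambda>p. vadd n (fst p) (snd p))"

lemma sets_out_measure[measurable_cong]: "sets (out_measure n v P) = sets (Rn n)"
  by (simp add: out_measure_def)

text \<open>Tested on boxes, where both sides factor into coordinates and the claim becomes the
  convolution of two normal densities on the line.\<close>

lemma distr_gaussM_add:
  assumes v: "v > 0" and u: "u > 0"
  shows "distr (gaussM n v \<Otimes>\<^sub>M gaussM n u) (Rn n) (\<lambda>p. vadd n (fst p) (snd p)) = gaussM n (v + u)"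
proof -
  let ?N = "\<lambda>v. density lborel (\<lambda>x. ennreal (normal_density 0 (sqrt v) x))"
  have N: "prob_space (?N v)" if "v > 0" for v using that by (intro prob_space_normal_density) simp
  have fN: "finite_measure (?N v)" if "v > 0" for v using N[OF that] by (rule prob_space.finite_measure)
  interpret V: prob_space "?N v" by (rule N[OF v])
  interpret U: prob_space "?N u" by (rule N[OF u])
  interpret W: prob_space "?N (v + u)" by (rule N) (use v u in simp)
  interpret V: product_sigma_finite "\<lambda>_::nat. ?N v" ..
  interpret U: product_sigma_finite "\<lambda>_::nat. ?N u" ..
  interpret W: product_sigma_finite "\<lambda>_::nat. ?N (v + u)" ..
  interpret Gu: prob_space "gaussM n u" by (rule prob_space_gaussM[OF u])
  have conv: "?N v \<star> ?N u = ?N (v + u)"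
  proof -
    have "?N v \<star> ?N u = density lborel (\<lambda>x. \<integral>\<^sup>+y. ennreal (normal_density 0 (sqrt v) (x - y)) * ennreal (normal_density 0 (sqrt u) y) \<partial>lborel)"
      by (rule convolution_density) (use fN[OF v] fN[OF u] in auto)
    also have "\<dots> = ?N (v + u)"
      using conv_normal_density_zero_mean[of "sqrt v" "sqrt u"] v u
      by (simp add: ennreal_mult[symmetric] normal_density_nonneg)
    finally show ?thesis .
  qed
  have "distr (gaussM n v \<Otimes>\<^sub>M gaussM n u) (Rn n) (\<lambda>p. vadd n (fst p) (snd p)) = PiM {..<n} (\<lambda>_. ?N (v + u))"
  proof (rule W.PiM_eqI)
    show "sets (distr (gaussM n v \<Otimes>\<^sub>M gaussM n u) (Rn n) (\<lambda>p. vadd n (fst p) (snd p))) = sets (PiM {..<n} (\<lambda>_. ?N (v + u)))"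
      by (simp add: Rn_def, intro sets_PiM_cong) auto
    fix A :: "nat \<Rightarrow> real set" assume A: "\<And>i. i \<in> {..<n} \<Longrightarrow> A i \<in> sets (?N (v + u))"
    have Am[measurable]: "A i \<in> sets borel" if "i < n" for i using A[of i] that by simp
    have AS[measurable]: "Pi\<^sub>E {..<n} A \<in> sets (Rn n)"
      unfolding Rn_def using A by (intro sets_PiM_I_finite) auto
    define p where "p = (\<lambda>i x. \<integral>\<^sup>+y. indicator (A i) (x + y) \<partial>?N u)"
    have pm: "p i \<in> borel_measurable borel" if "i < n" for i
    proof -
      have [measurable]: "A i \<in> sets borel" using that by (rule Am)
      show ?thesis unfolding p_def by measurable
    qed
    have "emeasure (distr (gaussM n v \<Otimes>\<^sub>M gaussM n u) (Rn n) (\<lambda>p. vadd n (fst p) (snd p))) (Pi\<^sub>E {..<n} A)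
      = (\<integral>\<^sup>+z. indicator (Pi\<^sub>E {..<n} A) z \<partial>distr (gaussM n v \<Otimes>\<^sub>M gaussM n u) (Rn n) (\<lambda>p. vadd n (fst p) (snd p)))"
      by simp
    also have "\<dots> = (\<integral>\<^sup>+q. indicator (Pi\<^sub>E {..<n} A) (vadd n (fst q) (snd q)) \<partial>(gaussM n v \<Otimes>\<^sub>M gaussM n u))"
      by (subst nn_integral_distr) auto
    also have "\<dots> = (\<integral>\<^sup>+a. \<integral>\<^sup>+b. indicator (Pi\<^sub>E {..<n} A) (vadd n a b) \<partial>gaussM n u \<partial>gaussM n v)"
      by (subst Gu.nn_integral_fst[symmetric]) auto
    also have "\<dots> = (\<integral>\<^sup>+a. \<integral>\<^sup>+b. (\<Prod>i<n. indicator (A i) (a i + b i)) \<partial>gaussM n u \<partial>gaussM n v)"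
      by (intro nn_integral_cong) (auto simp: indicator_def PiE_iff vadd_def prod_zero_iff)
    also have "\<dots> = (\<integral>\<^sup>+a. (\<Prod>i<n. p i (a i)) \<partial>gaussM n v)"
      unfolding gaussM_PiM[OF u] p_def
      by (intro nn_integral_cong U.product_nn_integral_prod) auto
    also have "\<dots> = (\<Prod>i<n. \<integral>\<^sup>+x. p i x \<partial>?N v)"
      unfolding gaussM_PiM[OF v] using pm by (intro V.product_nn_integral_prod) auto
    also have "\<dots> = (\<Prod>i\<in>{..<n}. emeasure (?N (v + u)) (A i))"
    proof (rule prod.cong)
      fix i assume "i \<in> {..<n}"
      then have [measurable]: "A i \<in> sets borel" using Am by simp
      show "(\<integral>\<^sup>+x. p i x \<partial>?N v) = emeasure (?N (v + u)) (A i)"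
        unfolding conv[symmetric] p_def
        by (subst convolution_emeasure') (use fN[OF v] fN[OF u] in auto)
    qed simp
    finally show "emeasure (distr (gaussM n v \<Otimes>\<^sub>M gaussM n u) (Rn n) (\<lambda>p. vadd n (fst p) (snd p))) (Pi\<^sub>E {..<n} A)
      = (\<Prod>i\<in>{..<n}. emeasure (?N (v + u)) (A i))" .
  qed simp
  then show ?thesis using v u by (simp add: gaussM_PiM)
qed

lemma sigma_finite_Ln: "sigma_finite_measure (Ln n)"
proof -
  interpret finite_product_sigma_finite "\<lambda>_::nat. lborel :: real measure" "{..<n}" by standard simp
  show ?thesis unfolding Ln_def by (rule sigma_finite_measure_axioms)
qed

text \<open>The dominating function depends on the noise alone; the input enters through its almost
  sure bound.\<close>

lemma integrable_pair_bound:
  fixes f :: "'a \<times> 'b \<Rightarrow> real"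
  assumes P: "prob_space P" and G: "sigma_finite_measure G" and f[measurable]: "f \<in> borel_measurable (P \<Otimes>\<^sub>M G)"
    and b: "AE x in P. \<forall>w\<in>space G. \<bar>f (x, w)\<bar> \<le> g w" and g: "integrable G g"
  shows "integrable (P \<Otimes>\<^sub>M G) f"
proof (rule integrableI_bounded)
  interpret P: prob_space P by fact
  interpret G: sigma_finite_measure G by fact
  have "(\<integral>\<^sup>+q. ennreal (norm (f q)) \<partial>(P \<Otimes>\<^sub>M G)) = (\<integral>\<^sup>+x. \<integral>\<^sup>+w. ennreal (norm (f (x, w))) \<partial>G \<partial>P)"
    by (subst G.nn_integral_fst[symmetric]) auto
  also have "\<dots> \<le> (\<integral>\<^sup>+x. (\<integral>\<^sup>+w. ennreal (norm (g w)) \<partial>G) \<partial>P)"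
  proof (rule nn_integral_mono_AE, use b in eventually_elim)
    fix x assume "\<forall>w\<in>space G. \<bar>f (x, w)\<bar> \<le> g w"
    then show "(\<integral>\<^sup>+w. ennreal (norm (f (x, w))) \<partial>G) \<le> (\<integral>\<^sup>+w. ennreal (norm (g w)) \<partial>G)"
      by (intro nn_integral_mono ennreal_leI) auto
  qed
  also have "\<dots> < \<infinity>"
    using g by (simp add: P.emeasure_space_1 integrable_iff_bounded)
  finally show "(\<integral>\<^sup>+q. ennreal (norm (f q)) \<partial>(P \<Otimes>\<^sub>M G)) < \<infinity>" .
qed fact

lemma integrable_vnorm_sq: "n \<ge> 1 \<Longrightarrow> v > 0 \<Longrightarrow> integrable (gaussM n v) (\<lambda>w. (vnorm n w)\<^sup>2)"
proof -
  assume n: "n \<ge> 1" and v: "v > 0"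
  have "growth (\<lambda>r. r\<^sup>2)" by (rule growthI[of _ 0 1]) auto
  from gaussM_radial(1)[OF n v this, of "\<lambda>_. 0"] show ?thesis
    by (simp add: vadd_def vnorm_def)
qed

section \<open>A Gaussian channel whose input lies in a ball\<close>

locale channel_input =
  fixes n :: nat and R :: real and P :: "(nat \<Rightarrow> real) measure"
  assumes n: "n \<ge> 1" and R: "R \<ge> 0" and adm: "admissible n R P"
begin

lemma prob_P: "prob_space P" and sets_P[measurable_cong]: "sets P = sets (Rn n)"
  and AE_P: "AE x in P. vnorm n x \<le> R"
  using adm by (auto simp: admissible_def)

sublocale P: prob_space P by (rule prob_P)

context
  fixes v :: real
  assumes v: "v > 0"
begin

lemma prob_G: "prob_space (gaussM n v)" by (rule prob_space_gaussM[OF v])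

lemma pair_PG: "pair_prob_space P (gaussM n v)"
  using prob_G by (simp add: pair_prob_space_def pair_sigma_finite_def prob_P prob_space_imp_sigma_finite)

lemma measurable_out_density[measurable]: "out_density n v P \<in> borel_measurable (Rn n)"
proof -
  have "(\<lambda>y. \<integral>x. gauss_density n v (\<lambda>i. y i - x i) \<partial>P) \<in> borel_measurable (Rn n)"
    by (rule P.borel_measurable_lebesgue_integral) measurable
  then show ?thesis by (simp add: out_density_def[abs_def])
qed

lemma gauss_density_le: "gauss_density n v x \<le> (2 * pi * v) powr (- real n / 2)"
  using v by (simp add: gauss_density_def mult_left_le)

lemma integrable_gauss_diff: 
  assumes "y \<in> space (Rn n)"
  shows "integrable P (\<lambda>x. gauss_density n v (\<lambda>i. y i - x i))"
proof (rule P.integrable_const_bound)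
  show "AE x in P. norm (gauss_density n v (\<lambda>i. y i - x i)) \<le> (2 * pi * v) powr (- real n / 2)"
    using gauss_density_le gauss_density_pos[OF v] by (simp add: less_imp_le)
  show "(\<lambda>x. gauss_density n v (\<lambda>i. y i - x i)) \<in> borel_measurable P"
    using assms by measurable
qed

lemma nn_out_density:
  assumes "y \<in> space (Rn n)"
  shows "(\<integral>\<^sup>+x. ennreal (gauss_density n v (\<lambda>i. y i - x i)) \<partial>P) = ennreal (out_density n v P y)"
  unfolding out_density_def using integrable_gauss_diff[OF assms] gauss_density_pos[OF v]
  by (intro nn_integral_eq_integral) (auto simp: less_imp_le)

lemma out_density_le:
  assumes "y \<in> space (Rn n)"
  shows "out_density n v P y \<le> (2 * pi * v) powr (- real n / 2)"
  unfolding out_density_def using integrable_gauss_diff[OF assms] gauss_density_le by (intro P.integral_le_const) auto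

text \<open>For inputs in the ball the distance from \<open>y\<close> is at most |y| + R, so every
  Gaussian entering the average is at least the stated value.\<close>

lemma out_density_ge:
  assumes y: "y \<in> space (Rn n)"
  shows "out_density n v P y \<ge> (2 * pi * v) powr (- real n / 2) * exp (- (vnorm n y + R)\<^sup>2 / (2 * v))"
  unfolding out_density_def
proof (rule P.integral_ge_const[OF integrable_gauss_diff[OF y]], use AE_P in eventually_elim)
  fix x assume "vnorm n x \<le> R"
  then have "vnorm n (\<lambda>i. y i - x i) \<le> vnorm n y + R"
    using vnorm_diff_le[of n y x] by linarith
  then have "(vnorm n (\<lambda>i. y i - x i))\<^sup>2 \<le> (vnorm n y + R)\<^sup>2" by (intro power_mono) auto
  then show "(2 * pi * v) powr (- real n / 2) * exp (- (vnorm n y + R)\<^sup>2 / (2 * v)) \<le> gauss_density n v (\<lambda>i. y i - x i)"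
    unfolding gauss_density_def using v by (intro mult_left_mono) (auto simp: divide_right_mono)
qed

lemma out_density_pos: "y \<in> space (Rn n) \<Longrightarrow> out_density n v P y > 0"
  by (rule less_le_trans[OF _ out_density_ge]) (use v in auto)

text \<open>The density lies between a Gaussian in |y| + R and a constant, so its logarithm grows at
  most quadratically. The integrability of log densities, also under the output law of another input
  from the same ball, comes from this bound.\<close>

lemma ln_out_density_bound: "\<exists>A B. A \<ge> 0 \<and> B \<ge> 0 \<and> (\<forall>y\<in>space (Rn n). \<bar>ln (out_density n v P y)\<bar> \<le> A + B * (vnorm n y)\<^sup>2)"
proof -
  define c where "c = (2 * pi * v) powr (- real n / 2)"
  have c: "c > 0" using v by (simp add: c_def)
  show ?thesis
  proof (intro exI conjI ballI)
    show "0 \<le> \<bar>ln c\<bar> + R\<^sup>2 / v" "0 \<le> 1 / v" using v by auto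
    fix y assume y: "y \<in> space (Rn n)"
    have "ln (out_density n v P y) \<le> ln c"
      using out_density_le[OF y] out_density_pos[OF y] c unfolding c_def[symmetric] by simp
    moreover have "ln c - (vnorm n y + R)\<^sup>2 / (2 * v) \<le> ln (out_density n v P y)"
    proof -
      have "ln (c * exp (- (vnorm n y + R)\<^sup>2 / (2 * v))) \<le> ln (out_density n v P y)"
        using out_density_ge[OF y] out_density_pos[OF y] c unfolding c_def[symmetric] by simp
      then show ?thesis using c by (simp add: ln_mult)
    qed
    moreover have "(vnorm n y + R)\<^sup>2 / (2 * v) \<le> R\<^sup>2 / v + 1 / v * (vnorm n y)\<^sup>2"
    proof -
      have "(vnorm n y + R)\<^sup>2 \<le> 2 * (R\<^sup>2 + (vnorm n y)\<^sup>2)"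
        using zero_le_power2[of "vnorm n y - R"] by (simp add: power2_eq_square algebra_simps)
      then have "(vnorm n y + R)\<^sup>2 / (2 * v) \<le> 2 * (R\<^sup>2 + (vnorm n y)\<^sup>2) / (2 * v)"
        using v by (intro divide_right_mono) auto
      then show ?thesis by (simp add: add_divide_distrib)
    qed
    moreover have "0 \<le> R\<^sup>2 / v" "0 \<le> 1 / v * (vnorm n y)\<^sup>2" using v by auto
    ultimately show "\<bar>ln (out_density n v P y)\<bar> \<le> \<bar>ln c\<bar> + R\<^sup>2 / v + 1 / v * (vnorm n y)\<^sup>2"
      by linarith
  qed
qed

lemma nn_integral_out_measure:
  assumes [measurable]: "H \<in> borel_measurable (Rn n)"
  shows "(\<integral>\<^sup>+y. H y \<partial>out_measure n v P) = (\<integral>\<^sup>+x. \<integral>\<^sup>+w. H (vadd n x w) \<partial>gaussM n v \<partial>P)"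
proof -
  interpret G: prob_space "gaussM n v" by (rule prob_G)
  show ?thesis unfolding out_measure_def
    by (subst nn_integral_distr, simp, simp, subst G.nn_integral_fst[symmetric]) auto
qed

lemma out_measure_density: "out_measure n v P = density (Ln n) (\<lambda>y. ennreal (out_density n v P y))"
proof (rule measure_eqI)
  interpret G: prob_space "gaussM n v" by (rule prob_G)
  interpret L: sigma_finite_measure "Ln n" by (rule sigma_finite_Ln)
  interpret PL: pair_sigma_finite P "Ln n" ..
  show "sets (out_measure n v P) = sets (density (Ln n) (\<lambda>y. ennreal (out_density n v P y)))"
    by (simp add: sets_out_measure sets_Ln)
  fix A assume "A \<in> sets (out_measure n v P)"
  then have A[measurable]: "A \<in> sets (Rn n)" by (simp add: sets_out_measure)
  have "emeasure (out_measure n v P) A = (\<integral>\<^sup>+y. indicator A y \<partial>out_measure n v P)"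
    by (simp add: sets_out_measure)
  also have "\<dots> = (\<integral>\<^sup>+x. \<integral>\<^sup>+w. indicator A (vadd n x w) \<partial>gaussM n v \<partial>P)"
    by (rule nn_integral_out_measure) measurable
  also have "\<dots> = (\<integral>\<^sup>+x. \<integral>\<^sup>+y. ennreal (gauss_density n v (\<lambda>i. y i - x i)) * indicator A y \<partial>Ln n \<partial>P)"
    by (intro nn_integral_cong nn_integral_gaussM_shift) measurable
  also have "\<dots> = (\<integral>\<^sup>+y. \<integral>\<^sup>+x. ennreal (gauss_density n v (\<lambda>i. y i - x i)) * indicator A y \<partial>P \<partial>Ln n)"
    by (rule PL.Fubini'[symmetric]) measurable
  also have "\<dots> = (\<integral>\<^sup>+y. ennreal (out_density n v P y) * indicator A y \<partial>Ln n)"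
  proof (rule nn_integral_cong)
    fix y assume "y \<in> space (Ln n)"
    then have y: "y \<in> space (Rn n)" by (simp add: space_Ln)
    show "(\<integral>\<^sup>+x. ennreal (gauss_density n v (\<lambda>i. y i - x i)) * indicator A y \<partial>P) = ennreal (out_density n v P y) * indicator A y"
      using y by (subst nn_integral_multc) (auto simp: nn_out_density)
  qed
  also have "\<dots> = emeasure (density (Ln n) (\<lambda>y. ennreal (out_density n v P y))) A"
    by (subst emeasure_density) auto
  finally show "emeasure (out_measure n v P) A = emeasure (density (Ln n) (\<lambda>y. ennreal (out_density n v P y))) A" .
qed

lemma prob_out_measure: "prob_space (out_measure n v P)"
proof -
  interpret PG: pair_prob_space P "gaussM n v" by (rule pair_PG)
  show ?thesis unfolding out_measure_def by (rule PG.prob_space_distr) measurable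
qed

lemma integrable_out_measure:
  assumes [measurable]: "h \<in> borel_measurable (Rn n)"
    and b: "\<And>y. y \<in> space (Rn n) \<Longrightarrow> \<bar>h y\<bar> \<le> A + B * (vnorm n y)\<^sup>2" and B: "B \<ge> 0"
  shows "integrable (P \<Otimes>\<^sub>M gaussM n v) (\<lambda>p. h (vadd n (fst p) (snd p)))"
    and "integrable (out_measure n v P) h"
proof -
  show 1: "integrable (P \<Otimes>\<^sub>M gaussM n v) (\<lambda>p. h (vadd n (fst p) (snd p)))"
  proof (rule integrable_pair_bound[OF prob_P prob_space_imp_sigma_finite[OF prob_G]])
    show "integrable (gaussM n v) (\<lambda>w. (A + B * (2 * R\<^sup>2)) + (2 * B) * (vnorm n w)\<^sup>2)"
    proof -
      interpret G: prob_space "gaussM n v" by (rule prob_G)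
      show ?thesis using integrable_vnorm_sq[OF n v] by simp
    qed
    show "AE x in P. \<forall>w\<in>space (gaussM n v). \<bar>h (vadd n (fst (x, w)) (snd (x, w)))\<bar> \<le> (A + B * (2 * R\<^sup>2)) + (2 * B) * (vnorm n w)\<^sup>2"
      using AE_P
    proof eventually_elim
      case (elim x)
      show ?case
      proof
        fix w assume "w \<in> space (gaussM n v)"
        have sp: "vadd n x w \<in> space (Rn n)" by (auto simp: vadd_def space_Rn)
        have "vnorm n (vadd n x w) \<le> R + vnorm n w" using vnorm_vadd_le[of n x w] elim by linarith
        then have "(vnorm n (vadd n x w))\<^sup>2 \<le> (R + vnorm n w)\<^sup>2" by (intro power_mono) auto
        also have "\<dots> \<le> 2 * R\<^sup>2 + 2 * (vnorm n w)\<^sup>2"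
          using zero_le_power2[of "vnorm n w - R"] by (simp add: power2_eq_square algebra_simps)
        finally have "B * (vnorm n (vadd n x w))\<^sup>2 \<le> B * (2 * R\<^sup>2 + 2 * (vnorm n w)\<^sup>2)"
          using B by (intro mult_left_mono)
        then show "\<bar>h (vadd n (fst (x, w)) (snd (x, w)))\<bar> \<le> (A + B * (2 * R\<^sup>2)) + (2 * B) * (vnorm n w)\<^sup>2"
          using b[OF sp] by (simp add: algebra_simps)
      qed
    qed
  qed measurable
  show "integrable (out_measure n v P) h"
    unfolding out_measure_def by (subst integrable_distr_eq) (use 1 in auto)
qed

lemma integral_out_measure:
  assumes [measurable]: "h \<in> borel_measurable (Rn n)"
    and b: "\<And>y. y \<in> space (Rn n) \<Longrightarrow> \<bar>h y\<bar> \<le> A + B * (vnorm n y)\<^sup>2" and B: "B \<ge> 0"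
  shows "(\<integral>y. h y \<partial>out_measure n v P) = (\<integral>x. (\<integral>w. h (vadd n x w) \<partial>gaussM n v) \<partial>P)"
    and "integrable P (\<lambda>x. \<integral>w. h (vadd n x w) \<partial>gaussM n v)"
proof -
  interpret PG: pair_prob_space P "gaussM n v" by (rule pair_PG)
  note i = integrable_out_measure(1)[OF assms]
  have "(\<integral>y. h y \<partial>out_measure n v P) = (\<integral>p. h (vadd n (fst p) (snd p)) \<partial>(P \<Otimes>\<^sub>M gaussM n v))"
    unfolding out_measure_def by (subst integral_distr) auto
  also have "\<dots> = (\<integral>x. (\<integral>w. h (vadd n x w) \<partial>gaussM n v) \<partial>P)"
    using PG.integral_fst'[OF i] by simp
  finally show "(\<integral>y. h y \<partial>out_measure n v P) = (\<integral>x. (\<integral>w. h (vadd n x w) \<partial>gaussM n v) \<partial>P)" .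
  show "integrable P (\<lambda>x. \<integral>w. h (vadd n x w) \<partial>gaussM n v)"
    using PG.integrable_fst'[OF i] by simp
qed

lemma out_measure_ae: "AE y in out_measure n v P. y \<in> space (Rn n)"
  by (rule AE_I2) (simp add: sets_eq_imp_space_eq[OF sets_out_measure])

text \<open>The joint law of input and output has a density relative to the product of its
  marginals, namely \<open>ratio\<close>, the noise density at y - x divided by the output density
  at y. The mean of its logarithm splits into two entropy terms, each of them integrable by the
  quadratic bounds.\<close>

lemma minfo_eq:
  "minfo n v P = (\<integral>w. ln (gauss_density n v w) \<partial>gaussM n v) - (\<integral>y. ln (out_density n v P y) \<partial>out_measure n v P)"
proof -
  interpret M: pair_prob_space P "gaussM n v" by (rule pair_PG)
  interpret L: sigma_finite_measure "Ln n" by (rule sigma_finite_Ln)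
  interpret O: prob_space "out_measure n v P" by (rule prob_out_measure)
  interpret PO: pair_prob_space P "out_measure n v P" ..
  let ?M = "P \<Otimes>\<^sub>M gaussM n v"
  let ?Y = "\<lambda>p. vadd n (fst p) (snd p)"
  define ratio where "ratio = (\<lambda>q. gauss_density n v (\<lambda>i. snd q i - fst q i) / out_density n v P (snd q))"
  have [measurable]: "ratio \<in> borel_measurable (Rn n \<Otimes>\<^sub>M Rn n)" unfolding ratio_def by measurable
  have rpos: "ratio q > 0" if "q \<in> space (Rn n \<Otimes>\<^sub>M Rn n)" for q
    using that out_density_pos[of "snd q"] gauss_density_pos[OF v] by (auto simp: ratio_def space_pair_measure)
  have dX: "distr ?M (Rn n) fst = P"
  proof -
    have "distr ?M (Rn n) fst = distr ?M P fst" by (intro distr_cong) (auto simp: sets_P)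
    also have "\<dots> = P" by (rule M.M2.distr_pair_fst)
    finally show ?thesis .
  qed
  have sPO: "sets (P \<Otimes>\<^sub>M out_measure n v P) = sets (Rn n \<Otimes>\<^sub>M Rn n)"
    by (intro sets_pair_measure_cong sets_P sets_out_measure)
  have dXY: "distr ?M (Rn n \<Otimes>\<^sub>M Rn n) (\<lambda>p. (fst p, ?Y p)) = density (P \<Otimes>\<^sub>M out_measure n v P) (\<lambda>q. ennreal (ratio q))"
  proof (rule measure_eqI)
    show "sets (distr ?M (Rn n \<Otimes>\<^sub>M Rn n) (\<lambda>p. (fst p, ?Y p))) = sets (density (P \<Otimes>\<^sub>M out_measure n v P) (\<lambda>q. ennreal (ratio q)))"
      by (simp add: sPO)
    fix A assume "A \<in> sets (distr ?M (Rn n \<Otimes>\<^sub>M Rn n) (\<lambda>p. (fst p, ?Y p)))"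
    then have A[measurable]: "A \<in> sets (Rn n \<Otimes>\<^sub>M Rn n)" by simp
    have "emeasure (distr ?M (Rn n \<Otimes>\<^sub>M Rn n) (\<lambda>p. (fst p, ?Y p))) A
      = (\<integral>\<^sup>+q. indicator A q \<partial>distr ?M (Rn n \<Otimes>\<^sub>M Rn n) (\<lambda>p. (fst p, ?Y p)))" by simp
    also have "\<dots> = (\<integral>\<^sup>+p. indicator A (fst p, ?Y p) \<partial>?M)"
      by (subst nn_integral_distr) auto
    also have "\<dots> = (\<integral>\<^sup>+x. \<integral>\<^sup>+w. indicator A (x, vadd n x w) \<partial>gaussM n v \<partial>P)"
      by (subst M.M2.nn_integral_fst[symmetric]) auto
    also have "\<dots> = (\<integral>\<^sup>+x. \<integral>\<^sup>+y. ennreal (gauss_density n v (\<lambda>i. y i - x i)) * indicator A (x, y) \<partial>Ln n \<partial>P)"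
    proof (rule nn_integral_cong)
      fix x assume "x \<in> space P"
      then have [measurable]: "x \<in> space (Rn n)" by (simp add: sets_eq_imp_space_eq[OF sets_P])
      have "(\<lambda>y. indicator A (x, y) :: ennreal) \<in> borel_measurable (Rn n)" by measurable
      from nn_integral_gaussM_shift[OF this]
      show "(\<integral>\<^sup>+w. indicator A (x, vadd n x w) \<partial>gaussM n v) = (\<integral>\<^sup>+y. ennreal (gauss_density n v (\<lambda>i. y i - x i)) * indicator A (x, y) \<partial>Ln n)" .
    qed
    also have "\<dots> = (\<integral>\<^sup>+x. \<integral>\<^sup>+y. ennreal (ratio (x, y)) * indicator A (x, y) \<partial>out_measure n v P \<partial>P)"
    proof (rule nn_integral_cong)
      fix x assume "x \<in> space P"
      then have x[measurable]: "x \<in> space (Rn n)" by (simp add: sets_eq_imp_space_eq[OF sets_P])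
      have "(\<integral>\<^sup>+y. ennreal (ratio (x, y)) * indicator A (x, y) \<partial>out_measure n v P)
        = (\<integral>\<^sup>+y. ennreal (out_density n v P y) * (ennreal (ratio (x, y)) * indicator A (x, y)) \<partial>Ln n)"
        unfolding out_measure_density by (subst nn_integral_density) auto
      also have "\<dots> = (\<integral>\<^sup>+y. ennreal (gauss_density n v (\<lambda>i. y i - x i)) * indicator A (x, y) \<partial>Ln n)"
      proof (rule nn_integral_cong)
        fix y assume "y \<in> space (Ln n)"
        then have y: "y \<in> space (Rn n)" by (simp add: space_Ln)
        have "out_density n v P y * ratio (x, y) = gauss_density n v (\<lambda>i. y i - x i)"
          using out_density_pos[OF y] by (simp add: ratio_def)
        moreover have "ratio (x, y) \<ge> 0" using rpos[of "(x, y)"] x y by (simp add: space_pair_measure less_imp_le)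
        ultimately show "ennreal (out_density n v P y) * (ennreal (ratio (x, y)) * indicator A (x, y))
          = ennreal (gauss_density n v (\<lambda>i. y i - x i)) * indicator A (x, y)"
          using out_density_pos[OF y] by (simp add: mult.assoc[symmetric] ennreal_mult[symmetric])
      qed
      finally show "(\<integral>\<^sup>+y. ennreal (gauss_density n v (\<lambda>i. y i - x i)) * indicator A (x, y) \<partial>Ln n)
        = (\<integral>\<^sup>+y. ennreal (ratio (x, y)) * indicator A (x, y) \<partial>out_measure n v P)" by simp
    qed
    also have "\<dots> = (\<integral>\<^sup>+q. ennreal (ratio q) * indicator A q \<partial>(P \<Otimes>\<^sub>M out_measure n v P))"
      by (subst O.nn_integral_fst[symmetric]) (auto simp: measurable_cong_sets[OF sPO refl])
    also have "\<dots> = emeasure (density (P \<Otimes>\<^sub>M out_measure n v P) (\<lambda>q. ennreal (ratio q))) A"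
      by (subst emeasure_density) (auto simp: sPO measurable_cong_sets[OF sPO refl])
    finally show "emeasure (distr ?M (Rn n \<Otimes>\<^sub>M Rn n) (\<lambda>p. (fst p, ?Y p))) A
      = emeasure (density (P \<Otimes>\<^sub>M out_measure n v P) (\<lambda>q. ennreal (ratio q))) A" .
  qed
  have rm: "ratio \<in> borel_measurable (P \<Otimes>\<^sub>M out_measure n v P)" by (simp add: measurable_cong_sets[OF sPO refl])
  have rnn: "AE q in P \<Otimes>\<^sub>M out_measure n v P. 0 \<le> ratio q"
    by (rule AE_I2) (use rpos in \<open>auto simp: sets_eq_imp_space_eq[OF sPO] less_imp_le\<close>)
  have Y: "(\<lambda>(x, z). vadd n x z) = ?Y" by auto
  have "minfo n v P = KL_divergence (exp 1) (P \<Otimes>\<^sub>M out_measure n v P) (density (P \<Otimes>\<^sub>M out_measure n v P) (\<lambda>q. ennreal (ratio q)))"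
    unfolding minfo_def M.mutual_information_def Y dX dXY out_measure_def[symmetric] ..
  also have "\<dots> = (\<integral>q. ratio q * log (exp 1) (ratio q) \<partial>(P \<Otimes>\<^sub>M out_measure n v P))"
    by (rule PO.KL_density) (use rm rnn in auto)
  also have "\<dots> = (\<integral>q. ln (ratio q) \<partial>density (P \<Otimes>\<^sub>M out_measure n v P) (\<lambda>q. ennreal (ratio q)))"
    by (subst integral_density) (use rm rnn in \<open>auto simp: log_ln[symmetric]\<close>)
  also have "\<dots> = (\<integral>p. ln (ratio (fst p, ?Y p)) \<partial>?M)"
    unfolding dXY[symmetric] by (subst integral_distr) auto
  \<comment> \<open>At y = x + w the shift cancels and the noise density is evaluated at w.\<close>
  also have "\<dots> = (\<integral>p. ln (gauss_density n v (snd p)) - ln (out_density n v P (?Y p)) \<partial>?M)"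
  proof (rule Bochner_Integration.integral_cong)
    fix p assume "p \<in> space ?M"
    have sp: "?Y p \<in> space (Rn n)" by (auto simp: vadd_def space_Rn)
    have "gauss_density n v (\<lambda>i. ?Y p i - fst p i) = gauss_density n v (snd p)"
      by (simp add: gauss_density_def vnorm_def vadd_def)
    then show "ln (ratio (fst p, ?Y p)) = ln (gauss_density n v (snd p)) - ln (out_density n v P (?Y p))"
      using out_density_pos[OF sp] gauss_density_pos[OF v, of n "snd p"] by (simp add: ratio_def ln_div)
  qed simp
  also have "\<dots> = (\<integral>p. ln (gauss_density n v (snd p)) \<partial>?M) - (\<integral>p. ln (out_density n v P (?Y p)) \<partial>?M)"
  proof (rule Bochner_Integration.integral_diff)
    obtain A B where AB: "A \<ge> 0" "B \<ge> 0" "\<forall>y\<in>space (Rn n). \<bar>ln (out_density n v P y)\<bar> \<le> A + B * (vnorm n y)\<^sup>2"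
      using ln_out_density_bound by blast
    show "integrable ?M (\<lambda>p. ln (out_density n v P (?Y p)))"
      by (rule integrable_out_measure(1)[of "\<lambda>y. ln (out_density n v P y)" A B]) (use AB in auto)
    show "integrable ?M (\<lambda>p. ln (gauss_density n v (snd p)))"
    proof (rule integrable_pair_bound[OF prob_P prob_space_imp_sigma_finite[OF prob_G]])
      show "integrable (gaussM n v) (\<lambda>w. \<bar>ln ((2 * pi * v) powr (- real n / 2))\<bar> + 1 / (2 * v) * (vnorm n w)\<^sup>2)"
      proof -
        interpret G: prob_space "gaussM n v" by (rule prob_G)
        show ?thesis using integrable_vnorm_sq[OF n v] by simp
      qed
      have "\<bar>ln (gauss_density n v w)\<bar> \<le> \<bar>ln ((2 * pi * v) powr (- real n / 2))\<bar> + 1 / (2 * v) * (vnorm n w)\<^sup>2" for w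
      proof -
        have "ln (gauss_density n v w) = ln ((2 * pi * v) powr (- real n / 2)) - 1 / (2 * v) * (vnorm n w)\<^sup>2"
          unfolding gauss_density_def using v by (subst ln_mult) auto
        moreover have "0 \<le> 1 / (2 * v) * (vnorm n w)\<^sup>2" using v by simp
        ultimately show ?thesis by linarith
      qed
      then show "AE x in P. \<forall>w\<in>space (gaussM n v). \<bar>ln (gauss_density n v (snd (x, w)))\<bar>
          \<le> \<bar>ln ((2 * pi * v) powr (- real n / 2))\<bar> + 1 / (2 * v) * (vnorm n w)\<^sup>2"
        by simp
    qed measurable
  qed
  also have "(\<integral>p. ln (gauss_density n v (snd p)) \<partial>?M) = (\<integral>w. ln (gauss_density n v w) \<partial>gaussM n v)"
  proof -
    have "distr ?M (gaussM n v) snd = gaussM n v"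
    proof (rule measure_eqI)
      fix A assume A: "A \<in> sets (distr ?M (gaussM n v) snd)"
      then have "emeasure (distr ?M (gaussM n v) snd) A = emeasure ?M (space P \<times> A)"
        by (auto simp: emeasure_distr space_pair_measure dest: sets.sets_into_space intro!: arg_cong2[where f = emeasure])
      also have "\<dots> = emeasure (gaussM n v) A"
        using A by (subst M.M2.emeasure_pair_measure_Times) (auto simp: P.emeasure_space_1)
      finally show "emeasure (distr ?M (gaussM n v) snd) A = emeasure (gaussM n v) A" .
    qed simp
    then have "(\<integral>w. ln (gauss_density n v w) \<partial>gaussM n v) = (\<integral>w. ln (gauss_density n v w) \<partial>distr ?M (gaussM n v) snd)" by simp
    also have "\<dots> = (\<integral>p. ln (gauss_density n v (snd p)) \<partial>?M)" by (rule integral_distr) measurable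
    finally show ?thesis by simp
  qed
  also have "(\<integral>p. ln (out_density n v P (?Y p)) \<partial>?M) = (\<integral>y. ln (out_density n v P y) \<partial>out_measure n v P)"
    unfolding out_measure_def by (subst integral_distr) auto
  finally show ?thesis .
qed

end

end

subsection \<open>Optimality conditions\<close>

lemma vadd_assoc: "vadd n (vadd n x a) b = vadd n x (vadd n a b)"
  by (auto simp: vadd_def fun_eq_iff)

lemma vadd_space: "vadd n x w \<in> space (Rn n)"
  by (auto simp: vadd_def space_Rn)

text \<open>The channel is degraded: the output at variance \<open>v + u\<close> is the output at
  variance \<open>v\<close> with further independent noise.\<close>

lemma out_measure_gauss_add:
  assumes P: "channel_input n R P" and v: "v > 0" and u: "u > 0"
  shows "distr (out_measure n v P \<Otimes>\<^sub>M gaussM n u) (Rn n) (\<lambda>p. vadd n (fst p) (snd p)) = out_measure n (v + u) P"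
proof (rule measure_eqI)
  interpret channel_input n R P by fact
  interpret V: prob_space "gaussM n v" by (rule prob_G[OF v])
  interpret U: prob_space "gaussM n u" by (rule prob_G[OF u])
  show "sets (distr (out_measure n v P \<Otimes>\<^sub>M gaussM n u) (Rn n) (\<lambda>p. vadd n (fst p) (snd p))) = sets (out_measure n (v + u) P)"
    by (simp add: sets_out_measure)
  fix A assume "A \<in> sets (distr (out_measure n v P \<Otimes>\<^sub>M gaussM n u) (Rn n) (\<lambda>p. vadd n (fst p) (snd p)))"
  then have A[measurable]: "A \<in> sets (Rn n)" by simp
  have "emeasure (distr (out_measure n v P \<Otimes>\<^sub>M gaussM n u) (Rn n) (\<lambda>p. vadd n (fst p) (snd p))) A
    = (\<integral>\<^sup>+y. indicator A y \<partial>distr (out_measure n v P \<Otimes>\<^sub>M gaussM n u) (Rn n) (\<lambda>p. vadd n (fst p) (snd p)))"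
    by simp
  also have "\<dots> = (\<integral>\<^sup>+p. indicator A (vadd n (fst p) (snd p)) \<partial>(out_measure n v P \<Otimes>\<^sub>M gaussM n u))"
    by (subst nn_integral_distr) auto
  also have "\<dots> = (\<integral>\<^sup>+y. \<integral>\<^sup>+b. indicator A (vadd n y b) \<partial>gaussM n u \<partial>out_measure n v P)"
    by (subst U.nn_integral_fst[symmetric]) auto
  also have "\<dots> = (\<integral>\<^sup>+x. \<integral>\<^sup>+a. \<integral>\<^sup>+b. indicator A (vadd n (vadd n x a) b) \<partial>gaussM n u \<partial>gaussM n v \<partial>P)"
    by (rule nn_integral_out_measure[OF v]) measurable
  also have "\<dots> = (\<integral>\<^sup>+x. \<integral>\<^sup>+c. indicator A (vadd n x c) \<partial>gaussM n (v + u) \<partial>P)"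
  proof (rule nn_integral_cong)
    fix x assume "x \<in> space P"
    then have x[measurable]: "x \<in> space (Rn n)" by (simp add: sets_eq_imp_space_eq[OF sets_P])
    have "(\<integral>\<^sup>+c. indicator A (vadd n x c) \<partial>gaussM n (v + u))
      = (\<integral>\<^sup>+p. indicator A (vadd n x (vadd n (fst p) (snd p))) \<partial>(gaussM n v \<Otimes>\<^sub>M gaussM n u))"
      unfolding distr_gaussM_add[OF v u, symmetric] by (subst nn_integral_distr) auto
    also have "\<dots> = (\<integral>\<^sup>+a. \<integral>\<^sup>+b. indicator A (vadd n x (vadd n a b)) \<partial>gaussM n u \<partial>gaussM n v)"
      by (subst U.nn_integral_fst[symmetric]) auto
    finally show "(\<integral>\<^sup>+a. \<integral>\<^sup>+b. indicator A (vadd n (vadd n x a) b) \<partial>gaussM n u \<partial>gaussM n v) = (\<integral>\<^sup>+c. indicator A (vadd n x c) \<partial>gaussM n (v + u))"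
      by (simp add: vadd_assoc)
  qed
  also have "\<dots> = (\<integral>\<^sup>+y. indicator A y \<partial>out_measure n (v + u) P)"
    by (rule nn_integral_out_measure[symmetric]) (use v u in auto)
  also have "\<dots> = emeasure (out_measure n (v + u) P) A" by (simp add: sets_out_measure)
  finally show "emeasure (distr (out_measure n v P \<Otimes>\<^sub>M gaussM n u) (Rn n) (\<lambda>p. vadd n (fst p) (snd p))) A = emeasure (out_measure n (v + u) P) A" .
qed

text \<open>Taken without the usual minus sign, so that
  \<open>cross_entropy n v P P - cross_entropy n v P Q\<close> is the relative entropy of the two
  output laws.\<close>

definition cross_entropy :: "nat \<Rightarrow> real \<Rightarrow> (nat \<Rightarrow> real) measure \<Rightarrow> (nat \<Rightarrow> real) measure \<Rightarrow> real" where
  "cross_entropy n v P Q = (\<integral>y. ln (out_density n v Q y) \<partial>out_measure n v P)"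

definition cross_entropy_at :: "nat \<Rightarrow> real \<Rightarrow> (nat \<Rightarrow> real) measure \<Rightarrow> (nat \<Rightarrow> real) \<Rightarrow> real" where
  "cross_entropy_at n v Q x = (\<integral>w. ln (out_density n v Q (vadd n x w)) \<partial>gaussM n v)"

locale two_inputs = P: channel_input n R P + Q: channel_input n R Q for n R P Q
begin

context
  fixes v :: real
  assumes v: "v > 0"
begin

lemma cross_entropy_int:
  "integrable (out_measure n v P) (\<lambda>y. ln (out_density n v Q y))"
  "cross_entropy n v P Q = (\<integral>x. cross_entropy_at n v Q x \<partial>P)"
  "integrable P (cross_entropy_at n v Q)"
proof -
  obtain A B where AB: "A \<ge> 0" "B \<ge> 0" "\<forall>y\<in>space (Rn n). \<bar>ln (out_density n v Q y)\<bar> \<le> A + B * (vnorm n y)\<^sup>2"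
    using Q.ln_out_density_bound[OF v] by blast
  have [measurable]: "(\<lambda>y. ln (out_density n v Q y)) \<in> borel_measurable (Rn n)"
    using Q.measurable_out_density[OF v] by measurable
  show "integrable (out_measure n v P) (\<lambda>y. ln (out_density n v Q y))"
    by (rule P.integrable_out_measure(2)[OF v, of _ A B]) (use AB in auto)
  show "cross_entropy n v P Q = (\<integral>x. cross_entropy_at n v Q x \<partial>P)" "integrable P (cross_entropy_at n v Q)"
    unfolding cross_entropy_def cross_entropy_at_def[abs_def]
    using P.integral_out_measure[OF v, of "\<lambda>y. ln (out_density n v Q y)" A B] AB by auto
qed

text \<open>Both output densities are positive everywhere, so the ratio transports the whole mass of
  one output law to the other.\<close>

lemma density_ratio:
  "has_bochner_integral (out_measure n v P) (\<lambda>y. out_density n v Q y / out_density n v P y) 1"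
proof (rule has_bochner_integral_nn_integral)
  note [measurable] = P.measurable_out_density[OF v] Q.measurable_out_density[OF v]
  show "AE y in out_measure n v P. 0 \<le> out_density n v Q y / out_density n v P y"
    using P.out_measure_ae[OF v] by eventually_elim (simp add: P.out_density_pos[OF v] Q.out_density_pos[OF v] less_imp_le)
  have "(\<integral>\<^sup>+y. ennreal (out_density n v Q y / out_density n v P y) \<partial>out_measure n v P)
    = (\<integral>\<^sup>+y. ennreal (out_density n v P y) * ennreal (out_density n v Q y / out_density n v P y) \<partial>Ln n)"
    unfolding P.out_measure_density[OF v] by (subst nn_integral_density) auto
  also have "\<dots> = (\<integral>\<^sup>+y. ennreal (out_density n v Q y) * 1 \<partial>Ln n)"
  proof (rule nn_integral_cong)
    fix y assume "y \<in> space (Ln n)"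
    then have y: "y \<in> space (Rn n)" by (simp add: space_Ln)
    show "ennreal (out_density n v P y) * ennreal (out_density n v Q y / out_density n v P y) = ennreal (out_density n v Q y) * 1"
      using P.out_density_pos[OF v y] Q.out_density_pos[OF v y] by (simp add: ennreal_mult[symmetric])
  qed
  also have "\<dots> = (\<integral>\<^sup>+y. 1 \<partial>out_measure n v Q)"
    unfolding Q.out_measure_density[OF v] by (subst nn_integral_density) auto
  also have "\<dots> = 1"
    using prob_space.emeasure_space_1[OF Q.prob_out_measure[OF v]] by simp
  finally show "(\<integral>\<^sup>+y. ennreal (out_density n v Q y / out_density n v P y) \<partial>out_measure n v P) = ennreal 1" by simp
qed (use P.measurable_out_density[OF v] Q.measurable_out_density[OF v] in auto)

end

end

lemma two_inputs_sym: "two_inputs n R P Q \<Longrightarrow> two_inputs n R Q P"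
  by (simp add: two_inputs_def)

lemma two_inputs_refl: "channel_input n R P \<Longrightarrow> two_inputs n R P P"
  by (simp add: two_inputs_def)

text \<open>Gibbs' inequality: ln t is at most t - 1, applied to a density ratio of mean 1.\<close>

lemma (in two_inputs) divergence_nonneg:
  assumes v: "v > 0"
  shows "cross_entropy n v P Q \<le> cross_entropy n v P P"
proof -
  interpret O: prob_space "out_measure n v P" by (rule P.prob_out_measure[OF v])
  note i = two_inputs.cross_entropy_int(1)[OF two_inputs_refl[OF P.channel_input_axioms] v]
  note r = density_ratio[OF v]
  have "0 = (\<integral>y. 1 - out_density n v Q y / out_density n v P y \<partial>out_measure n v P)"
    using r by (simp add: has_bochner_integral_iff O.prob_space)
  also have "\<dots> \<le> (\<integral>y. ln (out_density n v P y) - ln (out_density n v Q y) \<partial>out_measure n v P)"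
  proof (rule integral_mono_AE)
    show "AE y in out_measure n v P. 1 - out_density n v Q y / out_density n v P y \<le> ln (out_density n v P y) - ln (out_density n v Q y)"
      using P.out_measure_ae[OF v]
    proof eventually_elim
      case (elim y)
      have p: "out_density n v P y > 0" "out_density n v Q y > 0" using P.out_density_pos[OF v elim] Q.out_density_pos[OF v elim] by auto
      then have "ln (out_density n v Q y / out_density n v P y) \<le> out_density n v Q y / out_density n v P y - 1" by (intro ln_le_minus_one) auto
      then show ?case using p by (simp add: ln_div)
    qed
  qed (use r i cross_entropy_int(1)[OF v] in \<open>auto simp: has_bochner_integral_iff\<close>)
  also have "\<dots> = cross_entropy n v P P - cross_entropy n v P Q"
    unfolding cross_entropy_def using i cross_entropy_int(1)[OF v] by (rule Bochner_Integration.integral_diff)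
  finally show ?thesis by simp
qed

text \<open>Data processing: the likelihood ratio at the noisier output is a conditional average,
  so \<open>ln t \<ge> 1 - 1 / t\<close> applied to the quotient of the two ratios has mean at least \<open>0\<close>.\<close>

lemma (in two_inputs) data_processing:
  assumes v: "v > 0" and u: "u > 0"
  shows "cross_entropy n (v + u) P P - cross_entropy n (v + u) P Q \<le> cross_entropy n v P P - cross_entropy n v P Q"
proof -
  have w: "v + u > 0" using v u by simp
  let ?N = "out_measure n v P \<Otimes>\<^sub>M gaussM n u"
  interpret O: prob_space "out_measure n v P" by (rule P.prob_out_measure[OF v])
  interpret U: prob_space "gaussM n u" by (rule prob_space_gaussM[OF u])
  interpret N: pair_prob_space "out_measure n v P" "gaussM n u" ..
  note [measurable] = P.measurable_out_density[OF v] Q.measurable_out_density[OF v] P.measurable_out_density[OF w] Q.measurable_out_density[OF w]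
  interpret PP: two_inputs n R P P by (rule two_inputs_refl) (rule P.channel_input_axioms)
  interpret QP: two_inputs n R Q P by (rule two_inputs_sym) (rule two_inputs_axioms)
  define s1 where "s1 = (\<lambda>y. ln (out_density n v P y) - ln (out_density n v Q y))"
  define s2 where "s2 = (\<lambda>y. ln (out_density n (v + u) P y) - ln (out_density n (v + u) Q y))"
  have [measurable]: "s1 \<in> borel_measurable (Rn n)" "s2 \<in> borel_measurable (Rn n)"
    unfolding s1_def s2_def by measurable
  have i1: "integrable (out_measure n v P) s1" "integrable (out_measure n (v + u) P) s2"
    unfolding s1_def s2_def using cross_entropy_int(1) PP.cross_entropy_int(1) v w by auto
  have f1: "distr ?N (out_measure n v P) fst = out_measure n v P" by (rule U.distr_pair_fst)
  have I1: "integrable ?N (\<lambda>p. s1 (fst p))" "(\<integral>p. s1 (fst p) \<partial>?N) = (\<integral>y. s1 y \<partial>out_measure n v P)"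
  proof -
    have "integrable (distr ?N (out_measure n v P) fst) s1" using i1(1) f1 by simp
    then show "integrable ?N (\<lambda>p. s1 (fst p))" by (subst (asm) integrable_distr_eq) auto
    have "(\<integral>y. s1 y \<partial>out_measure n v P) = (\<integral>y. s1 y \<partial>distr ?N (out_measure n v P) fst)" using f1 by simp
    also have "\<dots> = (\<integral>p. s1 (fst p) \<partial>?N)" by (rule integral_distr) auto
    finally show "(\<integral>p. s1 (fst p) \<partial>?N) = (\<integral>y. s1 y \<partial>out_measure n v P)" by simp
  qed
  note f2 = out_measure_gauss_add[OF P.channel_input_axioms v u]
  have I2: "integrable ?N (\<lambda>p. s2 (vadd n (fst p) (snd p)))" "(\<integral>p. s2 (vadd n (fst p) (snd p)) \<partial>?N) = (\<integral>y. s2 y \<partial>out_measure n (v + u) P)"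
  proof -
    show "integrable ?N (\<lambda>p. s2 (vadd n (fst p) (snd p)))"
      using i1(2) unfolding f2[symmetric] by (subst (asm) integrable_distr_eq) auto
    show "(\<integral>p. s2 (vadd n (fst p) (snd p)) \<partial>?N) = (\<integral>y. s2 y \<partial>out_measure n (v + u) P)"
      unfolding f2[symmetric] by (rule integral_distr[symmetric]) auto
  qed
  \<comment> \<open>The ratio of \<open>Q\<close> to \<open>P\<close> before the additional noise,
    times the ratio of \<open>P\<close> to \<open>Q\<close> after it. The first factor changes the
    law of the first output to that of \<open>Q\<close>; under that law the second factor has mean
    1.\<close>
  define T where "T = (\<lambda>p. out_density n v Q (fst p) / out_density n v P (fst p) *
      (out_density n (v + u) P (vadd n (fst p) (snd p)) / out_density n (v + u) Q (vadd n (fst p) (snd p))))"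
  have [measurable]: "T \<in> borel_measurable ?N" unfolding T_def by measurable
  have fstsp: "fst p \<in> space (Rn n)" if "p \<in> space ?N" for p
    using that by (auto simp: space_pair_measure sets_eq_imp_space_eq[OF sets_out_measure])
  have TB: "has_bochner_integral ?N T 1"
  proof (rule has_bochner_integral_nn_integral)
    show "AE p in ?N. 0 \<le> T p"
      by (rule AE_I2) (use fstsp vadd_space in \<open>auto simp: T_def P.out_density_pos Q.out_density_pos v w less_imp_le intro!: mult_nonneg_nonneg divide_nonneg_nonneg\<close>)
    let ?q = "\<lambda>y. ennreal (out_density n (v + u) P y / out_density n (v + u) Q y)"
    have "(\<integral>\<^sup>+p. ennreal (T p) \<partial>?N) = (\<integral>\<^sup>+y. \<integral>\<^sup>+b. ennreal (T (y, b)) \<partial>gaussM n u \<partial>out_measure n v P)"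
      by (subst U.nn_integral_fst[symmetric]) auto
    also have "\<dots> = (\<integral>\<^sup>+y. ennreal (out_density n v Q y / out_density n v P y) * (\<integral>\<^sup>+b. ?q (vadd n y b) \<partial>gaussM n u) \<partial>out_measure n v P)"
    proof (rule nn_integral_cong)
      fix y assume "y \<in> space (out_measure n v P)"
      then have y[measurable]: "y \<in> space (Rn n)" by (simp add: sets_eq_imp_space_eq[OF sets_out_measure])
      have "(\<integral>\<^sup>+b. ennreal (T (y, b)) \<partial>gaussM n u) = (\<integral>\<^sup>+b. ennreal (out_density n v Q y / out_density n v P y) * ?q (vadd n y b) \<partial>gaussM n u)"
        unfolding T_def fst_conv snd_conv
        by (intro nn_integral_cong ennreal_mult) (simp_all add: P.out_density_pos Q.out_density_pos v w y vadd_space less_imp_le)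
      also have "\<dots> = ennreal (out_density n v Q y / out_density n v P y) * (\<integral>\<^sup>+b. ?q (vadd n y b) \<partial>gaussM n u)"
        by (rule nn_integral_cmult) measurable
      finally show "(\<integral>\<^sup>+b. ennreal (T (y, b)) \<partial>gaussM n u) = ennreal (out_density n v Q y / out_density n v P y) * (\<integral>\<^sup>+b. ?q (vadd n y b) \<partial>gaussM n u)" .
    qed
    also have "\<dots> = (\<integral>\<^sup>+y. ennreal (out_density n v P y) * (ennreal (out_density n v Q y / out_density n v P y) * (\<integral>\<^sup>+b. ?q (vadd n y b) \<partial>gaussM n u)) \<partial>Ln n)"
      unfolding P.out_measure_density[OF v] by (subst nn_integral_density) auto
    also have "\<dots> = (\<integral>\<^sup>+y. ennreal (out_density n v Q y) * (\<integral>\<^sup>+b. ?q (vadd n y b) \<partial>gaussM n u) \<partial>Ln n)"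
    proof (rule nn_integral_cong)
      fix y assume "y \<in> space (Ln n)"
      then have y: "y \<in> space (Rn n)" by (simp add: space_Ln)
      have "ennreal (out_density n v P y) * ennreal (out_density n v Q y / out_density n v P y) = ennreal (out_density n v Q y)"
        using P.out_density_pos[OF v y] Q.out_density_pos[OF v y] by (simp add: ennreal_mult[symmetric])
      then show "ennreal (out_density n v P y) * (ennreal (out_density n v Q y / out_density n v P y) * (\<integral>\<^sup>+b. ?q (vadd n y b) \<partial>gaussM n u)) = ennreal (out_density n v Q y) * (\<integral>\<^sup>+b. ?q (vadd n y b) \<partial>gaussM n u)"
        by (simp add: mult.assoc[symmetric])
    qed
    also have "\<dots> = (\<integral>\<^sup>+y. \<integral>\<^sup>+b. ?q (vadd n y b) \<partial>gaussM n u \<partial>out_measure n v Q)"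
      unfolding Q.out_measure_density[OF v] by (subst nn_integral_density) auto
    also have "\<dots> = (\<integral>\<^sup>+p. ?q (vadd n (fst p) (snd p)) \<partial>(out_measure n v Q \<Otimes>\<^sub>M gaussM n u))"
      by (subst U.nn_integral_fst[symmetric]) auto
    also have "\<dots> = (\<integral>\<^sup>+y. ?q y \<partial>out_measure n (v + u) Q)"
      unfolding out_measure_gauss_add[OF Q.channel_input_axioms v u, symmetric] by (subst nn_integral_distr) auto
    also have "\<dots> = ennreal 1"
      using QP.density_ratio[OF w] Q.out_measure_ae[OF w]
      by (subst nn_integral_eq_integral)
        (auto simp: has_bochner_integral_iff P.out_density_pos[OF w] Q.out_density_pos[OF w] less_imp_le elim!: eventually_mono)
    finally show "(\<integral>\<^sup>+p. ennreal (T p) \<partial>?N) = ennreal 1" .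
  qed simp_all
  have "0 = (\<integral>p. 1 - T p \<partial>?N)"
    using TB by (simp add: has_bochner_integral_iff N.prob_space)
  also have "\<dots> \<le> (\<integral>p. s1 (fst p) - s2 (vadd n (fst p) (snd p)) \<partial>?N)"
  proof (rule integral_mono)
    fix p assume "p \<in> space ?N"
    note y = fstsp[OF this]
    let ?y = "fst p" and ?z = "vadd n (fst p) (snd p)"
    have p: "out_density n v P ?y > 0" "out_density n v Q ?y > 0" "out_density n (v + u) P ?z > 0" "out_density n (v + u) Q ?z > 0"
      using P.out_density_pos[OF v y] Q.out_density_pos[OF v y] P.out_density_pos[OF w vadd_space] Q.out_density_pos[OF w vadd_space] by auto
    then have "ln (T p) \<le> T p - 1" unfolding T_def by (intro ln_le_minus_one) auto
    moreover have "ln (T p) = - (s1 ?y - s2 ?z)"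
      unfolding T_def s1_def s2_def using p by (subst ln_mult) (auto simp: ln_div)
    ultimately show "1 - T p \<le> s1 ?y - s2 ?z" by simp
  qed (use TB I1 I2 in \<open>auto simp: has_bochner_integral_iff\<close>)
  also have "\<dots> = (\<integral>y. s1 y \<partial>out_measure n v P) - (\<integral>y. s2 y \<partial>out_measure n (v + u) P)"
    using I1 I2 by (simp add: Bochner_Integration.integral_diff)
  also have "\<dots> = (cross_entropy n v P P - cross_entropy n v P Q) - (cross_entropy n (v + u) P P - cross_entropy n (v + u) P Q)"
    unfolding s1_def s2_def cross_entropy_def
    using PP.cross_entropy_int(1)[OF v] cross_entropy_int(1)[OF v] PP.cross_entropy_int(1)[OF w] cross_entropy_int(1)[OF w]
    by (simp add: Bochner_Integration.integral_diff)
  finally show ?thesis by simp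
qed

section \<open>The secrecy rate and its first-order conditions\<close>

definition xi :: "nat \<Rightarrow> real \<Rightarrow> real \<Rightarrow> (nat \<Rightarrow> real) measure \<Rightarrow> (nat \<Rightarrow> real) \<Rightarrow> real" where
  "xi n v1 v2 Q x = cross_entropy_at n v2 Q x - cross_entropy_at n v1 Q x"

definition hdiff :: "nat \<Rightarrow> real \<Rightarrow> real \<Rightarrow> real" where
  "hdiff n v1 v2 = (\<integral>w. ln (gauss_density n v1 w) \<partial>gaussM n v1) - (\<integral>w. ln (gauss_density n v2 w) \<partial>gaussM n v2)"

lemma (in channel_input) secrecy_rate_cross_entropy:
  assumes "v1 > 0" "v2 > 0"
  shows "secrecy_rate n v1 v2 P = hdiff n v1 v2 + (cross_entropy n v2 P P - cross_entropy n v1 P P)"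
  using assms by (simp add: secrecy_rate_def minfo_eq hdiff_def cross_entropy_def)

lemma (in two_inputs) integral_xi:
  assumes "v1 > 0" "v2 > 0"
  shows "(\<integral>x. xi n v1 v2 Q x \<partial>P) = cross_entropy n v2 P Q - cross_entropy n v1 P Q" "integrable P (xi n v1 v2 Q)"
  unfolding xi_def[abs_def] using assms cross_entropy_int by (auto simp: Bochner_Integration.integral_diff)

lemma (in channel_input) secrecy_rate_xi:
  assumes "v1 > 0" "v2 > 0"
  shows "secrecy_rate n v1 v2 P = hdiff n v1 v2 + (\<integral>x. xi n v1 v2 P x \<partial>P)"
  using two_inputs.integral_xi(1)[OF two_inputs_refl[OF channel_input_axioms] assms] secrecy_rate_cross_entropy[OF assms]
  by simp

text \<open>By data processing, \<open>hdiff\<close> plus the mean of \<open>xi n v1 v2 Q\<close>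
  under \<open>P\<close> is an upper bound for the secrecy rate of \<open>P\<close>, with equality
  at \<open>P = Q\<close>. This bound is linear in \<open>P\<close>, so a pointwise bound on
  \<open>xi\<close> settles the comparison.\<close>

lemma (in two_inputs) kkt_sufficient:
  assumes v: "0 < v1" "v1 < v2"
    and le: "\<And>x. x \<in> space (Rn n) \<Longrightarrow> vnorm n x \<le> R \<Longrightarrow> xi n v1 v2 Q x \<le> (\<integral>x. xi n v1 v2 Q x \<partial>Q)"
  shows "secrecy_rate n v1 v2 P \<le> secrecy_rate n v1 v2 Q"
proof -
  have v2: "v2 > 0" using v by simp
  have "cross_entropy n v2 P P - cross_entropy n v2 P Q \<le> cross_entropy n v1 P P - cross_entropy n v1 P Q"
    using data_processing[of v1 "v2 - v1"] v by simp
  then have "secrecy_rate n v1 v2 P \<le> hdiff n v1 v2 + (\<integral>x. xi n v1 v2 Q x \<partial>P)"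
    using P.secrecy_rate_cross_entropy[OF v(1) v2] integral_xi(1)[OF v(1) v2] by simp
  also have "(\<integral>x. xi n v1 v2 Q x \<partial>P) \<le> (\<integral>x. xi n v1 v2 Q x \<partial>Q)"
  proof (rule P.P.integral_le_const[OF integral_xi(2)[OF v(1) v2]])
    have "AE x in P. x \<in> space (Rn n)" by (rule AE_I2) (simp add: sets_eq_imp_space_eq[OF P.sets_P])
    with P.AE_P show "AE x in P. xi n v1 v2 Q x \<le> (\<integral>x. xi n v1 v2 Q x \<partial>Q)"
      by eventually_elim (rule le)
  qed
  finally show ?thesis using Q.secrecy_rate_xi[OF v(1) v2] by simp
qed

text \<open>The law (1 - e) Q + e \<delta>_z, realised by a coin toss that replaces the input by
  \<open>z\<close> with probability \<open>e\<close>.\<close>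

definition point_mixture :: "nat \<Rightarrow> real \<Rightarrow> (nat \<Rightarrow> real) \<Rightarrow> (nat \<Rightarrow> real) measure \<Rightarrow> (nat \<Rightarrow> real) measure" where
  "point_mixture n e z Q = distr (Q \<Otimes>\<^sub>M measure_pmf (bernoulli_pmf e)) (Rn n) (\<lambda>p. if snd p then z else fst p)"

context channel_input
begin

context
  fixes e :: real and z :: "nat \<Rightarrow> real"
  assumes e: "0 \<le> e" "e \<le> 1" and z: "z \<in> space (Rn n)" "vnorm n z \<le> R"
begin

lemma point_mixture_measurable: "(\<lambda>p. if snd p then z else fst p) \<in> P \<Otimes>\<^sub>M measure_pmf (bernoulli_pmf e) \<rightarrow>\<^sub>M Rn n"
  using z(1) by measurable

lemma pair_point_mixture: "pair_prob_space P (measure_pmf (bernoulli_pmf e))"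
  by (simp add: pair_prob_space_def pair_sigma_finite_def prob_P prob_space_imp_sigma_finite prob_space_measure_pmf)

lemma channel_input_point_mixture: "channel_input n R (point_mixture n e z P)"
proof
  interpret M: pair_prob_space P "measure_pmf (bernoulli_pmf e)" by (rule pair_point_mixture)
  have "AE x in point_mixture n e z P. vnorm n x \<le> R"
    unfolding point_mixture_def
  proof (subst AE_distr_iff[OF point_mixture_measurable])
    have "AE p in P \<Otimes>\<^sub>M measure_pmf (bernoulli_pmf e). vnorm n (fst p) \<le> R"
    proof -
      have "AE x in distr (P \<Otimes>\<^sub>M measure_pmf (bernoulli_pmf e)) P fst. vnorm n x \<le> R"
      proof -
        have "distr (P \<Otimes>\<^sub>M measure_pmf (bernoulli_pmf e)) P fst = P"
          by (rule prob_space.distr_pair_fst) (rule prob_space_measure_pmf)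
        then show ?thesis using AE_P by metis
      qed
      then show ?thesis by (subst (asm) AE_distr_iff) auto
    qed
    then show "AE p in P \<Otimes>\<^sub>M measure_pmf (bernoulli_pmf e). vnorm n (if snd p then z else fst p) \<le> R"
      by eventually_elim (use z in auto)
  qed measurable
  moreover have "prob_space (point_mixture n e z P)"
    unfolding point_mixture_def by (rule M.prob_space_distr[OF point_mixture_measurable])
  moreover have "sets (point_mixture n e z P) = sets (Rn n)" by (simp add: point_mixture_def)
  ultimately show "admissible n R (point_mixture n e z P)"
    by (simp only: admissible_def)
qed (use n R in auto)

lemma integral_point_mixture:
  fixes h :: "_ \<Rightarrow> real"
  assumes h[measurable]: "h \<in> borel_measurable (Rn n)" and i: "integrable P h"
  shows "(\<integral>x. h x \<partial>point_mixture n e z P) = e * h z + (1 - e) * (\<integral>x. h x \<partial>P)"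
proof -
  interpret M: pair_prob_space P "measure_pmf (bernoulli_pmf e)" by (rule pair_point_mixture)
  let ?k = "\<lambda>p. h (if snd p then z else fst p)"
  have km[measurable]: "?k \<in> borel_measurable (P \<Otimes>\<^sub>M measure_pmf (bernoulli_pmf e))"
    by (rule measurable_compose[OF point_mixture_measurable h])
  have "integrable (P \<Otimes>\<^sub>M measure_pmf (bernoulli_pmf e)) ?k"
  proof (rule M.Fubini_integrable)
    have "integrable P (\<lambda>x. norm (h z) * e + norm (h x) * (1 - e))"
      using i by auto
    then show "integrable P (\<lambda>x. \<integral>b. norm (h (if snd (x, b) then z else fst (x, b))) \<partial>measure_pmf (bernoulli_pmf e))"
      using e by simp
    show "AE x in P. integrable (measure_pmf (bernoulli_pmf e)) (\<lambda>b. h (if snd (x, b) then z else fst (x, b)))"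
      by (intro AE_I2 integrable_measure_pmf_finite) simp
  qed measurable
  from M.integral_fst'[OF this]
  have "(\<integral>p. ?k p \<partial>(P \<Otimes>\<^sub>M measure_pmf (bernoulli_pmf e))) = (\<integral>x. h z * e + h x * (1 - e) \<partial>P)"
    using e by simp
  also have "\<dots> = e * h z + (1 - e) * (\<integral>x. h x \<partial>P)"
    using i by (simp add: P.prob_space mult.commute)
  finally show ?thesis
    unfolding point_mixture_def by (subst integral_distr[OF point_mixture_measurable]) auto
qed

lemma out_density_point_mixture:
  assumes v: "v > 0" and y: "y \<in> space (Rn n)"
  shows "out_density n v (point_mixture n e z P) y = e * gauss_density n v (\<lambda>i. y i - z i) + (1 - e) * out_density n v P y"
  unfolding out_density_def using y
  by (intro integral_point_mixture integrable_gauss_diff v) measurable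

text \<open>A chi-square bound: with \<rho> the ratio of the Gaussian around \<open>z\<close> to the
  output density of \<open>P\<close>, the density ratio of the mixture to \<open>P\<close> is 1 + e
  (\<rho> - 1), and ln t is at most t - 1. The mean of \<rho> is 1 under the output law of
  \<open>P\<close> and at most \<open>M\<close> under the Gaussian around \<open>z\<close>, so a
  second factor \<open>e\<close> appears.\<close>

lemma divergence_point_mixture:
  assumes v: "v > 0" and M: "\<And>y. y \<in> space (Rn n) \<Longrightarrow> gauss_density n v (\<lambda>i. y i - z i) \<le> M * out_density n v P y"
  shows "cross_entropy n v (point_mixture n e z P) (point_mixture n e z P) - cross_entropy n v (point_mixture n e z P) P \<le> e\<^sup>2 * M"
proof -
  let ?P = "point_mixture n e z P"
  interpret X: channel_input n R ?P by (rule channel_input_point_mixture)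
  interpret XP: two_inputs n R ?P P by (simp add: two_inputs_def X.channel_input_axioms channel_input_axioms)
  interpret XX: two_inputs n R ?P ?P by (simp add: two_inputs_def X.channel_input_axioms)
  interpret O: prob_space "out_measure n v ?P" by (rule X.prob_out_measure[OF v])
  interpret OP: prob_space "out_measure n v P" by (rule prob_out_measure[OF v])
  interpret G: prob_space "gaussM n v" by (rule prob_G[OF v])
  define \<rho> where "\<rho> = (\<lambda>y. gauss_density n v (\<lambda>i. y i - z i) / out_density n v P y)"
  note [measurable] = measurable_out_density[OF v] X.measurable_out_density[OF v]
  have [measurable]: "\<rho> \<in> borel_measurable (Rn n)" unfolding \<rho>_def using z(1) by measurable
  have rb: "0 \<le> \<rho> y" "\<rho> y \<le> M" if "y \<in> space (Rn n)" for y
    using M[OF that] out_density_pos[OF v that] gauss_density_pos[OF v, of n "\<lambda>i. y i - z i"]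
    by (auto simp: \<rho>_def less_imp_le field_simps)
  have rb': "\<bar>\<rho> y\<bar> \<le> M + 0 * (vnorm n y)\<^sup>2" if "y \<in> space (Rn n)" for y using rb[OF that] by simp
  have e1: "(\<integral>y. \<rho> y \<partial>out_measure n v P) = 1"
  proof -
    have "has_bochner_integral (out_measure n v P) \<rho> 1"
    proof (rule has_bochner_integral_nn_integral)
      show "AE y in out_measure n v P. 0 \<le> \<rho> y" using out_measure_ae[OF v] by eventually_elim (rule rb)
      have "(\<integral>\<^sup>+y. ennreal (\<rho> y) \<partial>out_measure n v P) = (\<integral>\<^sup>+y. ennreal (out_density n v P y) * ennreal (\<rho> y) \<partial>Ln n)"
        unfolding out_measure_density[OF v] by (subst nn_integral_density) auto
      also have "\<dots> = (\<integral>\<^sup>+y. ennreal (gauss_density n v (\<lambda>i. y i - z i)) * 1 \<partial>Ln n)"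
      proof (rule nn_integral_cong)
        fix y assume "y \<in> space (Ln n)"
        then have y: "y \<in> space (Rn n)" by (simp add: space_Ln)
        show "ennreal (out_density n v P y) * ennreal (\<rho> y) = ennreal (gauss_density n v (\<lambda>i. y i - z i)) * 1"
          using out_density_pos[OF v y] rb(1)[OF y] by (simp add: ennreal_mult[symmetric]) (simp add: \<rho>_def)
      qed
      also have "\<dots> = (\<integral>\<^sup>+w. 1 \<partial>gaussM n v)"
        by (rule nn_integral_gaussM_shift[symmetric]) simp
      also have "\<dots> = 1" by (simp add: G.emeasure_space_1)
      finally show "(\<integral>\<^sup>+y. ennreal (\<rho> y) \<partial>out_measure n v P) = ennreal 1" by simp
    qed simp_all
    then show ?thesis by (simp add: has_bochner_integral_iff)
  qed
  have iM: "integrable (out_measure n v ?P) \<rho>"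
    by (rule X.integrable_out_measure(2)[OF v, of _ M 0]) (use rb' in auto)
  have "(\<integral>y. \<rho> y \<partial>out_measure n v ?P) = (\<integral>x. (\<integral>w. \<rho> (vadd n x w) \<partial>gaussM n v) \<partial>?P)"
    by (rule X.integral_out_measure(1)[OF v, of _ M 0]) (use rb' in auto)
  also have "\<dots> = e * (\<integral>w. \<rho> (vadd n z w) \<partial>gaussM n v) + (1 - e) * (\<integral>x. (\<integral>w. \<rho> (vadd n x w) \<partial>gaussM n v) \<partial>P)"
    by (rule integral_point_mixture) (use integral_out_measure(2)[OF v, of \<rho> M 0] rb' in auto)
  also have "(\<integral>x. (\<integral>w. \<rho> (vadd n x w) \<partial>gaussM n v) \<partial>P) = (\<integral>y. \<rho> y \<partial>out_measure n v P)"
    by (rule integral_out_measure(1)[OF v, of _ M 0, symmetric]) (use rb' in auto)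
  also have "(\<integral>w. \<rho> (vadd n z w) \<partial>gaussM n v) \<le> M"
  proof (rule G.integral_le_const)
    have [measurable]: "(\<lambda>w. \<rho> (vadd n z w)) \<in> borel_measurable (gaussM n v)" using z(1) by measurable
    show "integrable (gaussM n v) (\<lambda>w. \<rho> (vadd n z w))"
      by (rule G.integrable_const_bound[of _ M]) (use rb[OF vadd_space] in auto)
    show "AE w in gaussM n v. \<rho> (vadd n z w) \<le> M" using rb[OF vadd_space] by simp
  qed
  finally have rM: "(\<integral>y. \<rho> y \<partial>out_measure n v ?P) \<le> e * M + (1 - e)"
    using e by (simp add: e1 mult_left_mono)
  have "cross_entropy n v ?P ?P - cross_entropy n v ?P P = (\<integral>y. ln (out_density n v ?P y) - ln (out_density n v P y) \<partial>out_measure n v ?P)"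
    unfolding cross_entropy_def using XX.cross_entropy_int(1)[OF v] XP.cross_entropy_int(1)[OF v] by (rule Bochner_Integration.integral_diff[symmetric])
  also have "\<dots> \<le> (\<integral>y. e * (\<rho> y - 1) \<partial>out_measure n v ?P)"
  proof (rule integral_mono_AE)
    show "AE y in out_measure n v ?P. ln (out_density n v ?P y) - ln (out_density n v P y) \<le> e * (\<rho> y - 1)"
      using X.out_measure_ae[OF v]
    proof eventually_elim
      case (elim y)
      have p: "out_density n v ?P y > 0" "out_density n v P y > 0" using X.out_density_pos[OF v elim] out_density_pos[OF v elim] by auto
      then have "ln (out_density n v ?P y / out_density n v P y) \<le> out_density n v ?P y / out_density n v P y - 1" by (intro ln_le_minus_one) auto
      also have "out_density n v ?P y / out_density n v P y - 1 = e * (\<rho> y - 1)"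
        unfolding out_density_point_mixture[OF v elim] \<rho>_def using p by (simp add: field_simps)
      finally show ?case using p by (simp add: ln_div)
    qed
  qed (use XX.cross_entropy_int(1)[OF v] XP.cross_entropy_int(1)[OF v] iM in auto)
  also have "\<dots> = e * ((\<integral>y. \<rho> y \<partial>out_measure n v ?P) - 1)"
    using iM by (simp add: O.prob_space)
  also have "\<dots> \<le> e * ((e * M + (1 - e)) - 1)"
    using rM e by (intro mult_left_mono) auto
  also have "\<dots> \<le> e\<^sup>2 * M" by (simp add: power2_eq_square algebra_simps)
  finally show ?thesis .
qed

end

text \<open>If \<open>xi\<close> exceeded its mean at \<open>z\<close> by d > 0, moving mass e to
  \<open>z\<close> would gain e d in the linear part of the rate. The divergence at the first
  receiver costs at most e^2 M and the one at the second receiver has a favourable sign, so a small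
  e would improve the rate.\<close>

lemma kkt_necessary:
  assumes v: "0 < v1" "v1 < v2"
    and opt: "\<And>P'. admissible n R P' \<Longrightarrow> secrecy_rate n v1 v2 P' \<le> secrecy_rate n v1 v2 P"
    and z: "z \<in> space (Rn n)" "vnorm n z \<le> R"
    and M: "\<And>y. y \<in> space (Rn n) \<Longrightarrow> gauss_density n v1 (\<lambda>i. y i - z i) \<le> M * out_density n v1 P y"
  shows "xi n v1 v2 P z \<le> (\<integral>x. xi n v1 v2 P x \<partial>P)"
proof (rule ccontr)
  assume neg: "\<not> ?thesis"
  define d where "d = xi n v1 v2 P z - (\<integral>x. xi n v1 v2 P x \<partial>P)"
  have d: "d > 0" using neg by (simp add: d_def)
  have v2: "v2 > 0" using v by simp
  interpret PP: two_inputs n R P P by (rule two_inputs_refl) (rule channel_input_axioms)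
  have key: "e * d \<le> e\<^sup>2 * M" if e: "0 \<le> e" "e \<le> 1" for e
  proof -
    let ?P = "point_mixture n e z P"
    interpret X: channel_input n R ?P by (rule channel_input_point_mixture[OF e z])
    interpret XP: two_inputs n R ?P P by (simp add: two_inputs_def X.channel_input_axioms channel_input_axioms)
    have mx: "xi n v1 v2 P \<in> borel_measurable (Rn n)"
      using borel_measurable_integrable[OF PP.integral_xi(2)[OF v(1) v2]] by (simp add: measurable_cong_sets[OF sets_P refl])
    have "e * xi n v1 v2 P z + (1 - e) * (\<integral>x. xi n v1 v2 P x \<partial>P) = (\<integral>x. xi n v1 v2 P x \<partial>?P)"
      by (rule integral_point_mixture[OF e z mx PP.integral_xi(2)[OF v(1) v2], symmetric])
    also have "\<dots> = cross_entropy n v2 ?P P - cross_entropy n v1 ?P P" by (rule XP.integral_xi(1)[OF v(1) v2])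
    also have "\<dots> \<le> cross_entropy n v2 ?P ?P - cross_entropy n v1 ?P ?P + e\<^sup>2 * M"
      using XP.divergence_nonneg[OF v2] divergence_point_mixture[OF e z v(1) M] by simp
    also have "cross_entropy n v2 ?P ?P - cross_entropy n v1 ?P ?P = secrecy_rate n v1 v2 ?P - hdiff n v1 v2"
      using X.secrecy_rate_cross_entropy[OF v(1) v2] by simp
    also have "\<dots> \<le> (\<integral>x. xi n v1 v2 P x \<partial>P)"
      using opt[OF X.adm] secrecy_rate_xi[OF v(1) v2] by simp
    finally show ?thesis by (simp add: d_def algebra_simps)
  qed
  \<comment> \<open>Small enough for e M to be at most d / 2, whatever the sign of M.\<close>
  define e where "e = min 1 (d / (2 * (\<bar>M\<bar> + 1)))"
  have e: "0 < e" "e \<le> 1" "e \<le> d / (2 * (\<bar>M\<bar> + 1))" using d by (auto simp: e_def)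
  have "d \<le> e * M" using key[of e] e by (simp add: power2_eq_square)
  also have "\<dots> \<le> e * (\<bar>M\<bar> + 1)" using e by (intro mult_left_mono) auto
  also have "\<dots> \<le> d / (2 * (\<bar>M\<bar> + 1)) * (\<bar>M\<bar> + 1)"
    using e d by (intro mult_right_mono) auto
  also have "\<dots> = d / 2" by (simp add: field_simps)
  finally show False using d by simp
qed

end

subsection \<open>Concentration and sign changes of radial means\<close>

lemma poisson_weight_sums: "poisson_weight l sums 1"
proof -
  have "(\<lambda>j. exp (- l) * (l ^ j /\<^sub>R fact j)) sums (exp (- l) * exp l)"
    by (intro sums_mult exp_converges)
  then show ?thesis by (simp add: poisson_weight_def[abs_def] exp_minus divide_inverse mult_ac)
qed

lemma growth_const: "growth (\<lambda>_. c)"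
  by (rule growthI[of _ "\<bar>c\<bar>" 0]) auto

lemma growth_cmult:
  assumes "growth f"
  shows "growth (\<lambda>r. c * f r)"
proof -
  obtain A where A: "\<And>r. r \<ge> 0 \<Longrightarrow> \<bar>f r\<bar> \<le> A * (1 + r ^ 4)" using assms growthE by blast
  have "\<bar>c * f r\<bar> \<le> (\<bar>c\<bar> * A) * (1 + r ^ 4)" if "r \<ge> 0" for r
    using mult_left_mono[OF A[OF that], of "\<bar>c\<bar>"] by (simp add: abs_mult mult.assoc)
  moreover have "(\<lambda>r. c * f r) \<in> borel_measurable borel" using growthD[OF assms] by measurable
  ultimately show ?thesis unfolding growth_def by blast
qed

lemma growth_add:
  assumes "growth f" "growth g"
  shows "growth (\<lambda>r. f r + g r)"
  using growth_diff[OF assms(1) growth_uminus[OF assms(2)]] by simp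

lemma growth_sq: "growth (\<lambda>r. r\<^sup>2)"
  by (rule growthI[of _ 0 1]) auto

lemma growth_pow4: "growth (\<lambda>r. r ^ 4)"
  unfolding growth_def by (intro conjI exI[of _ 1]) auto

context
  fixes n :: nat and v :: real
  assumes n: "n \<ge> 1" and v: "v > 0"
begin

lemma chi_mean_const: "chi_mean n v (\<lambda>_. c) = c"
  using prob_space.prob_space[OF prob_space_chiM[OF n v]] by (simp add: chi_mean_def)

lemma chi_mean_sq: "chi_mean n v (\<lambda>r. r\<^sup>2) = real n * v"
  unfolding chi_mean_def using chiM_moment4(2)[OF n v] v by (intro integral_eq_nn_integral[THEN trans]) auto

lemma chi_mean_pow4: "chi_mean n v (\<lambda>r. r ^ 4) = real n * (real n + 2) * v\<^sup>2"
  unfolding chi_mean_def using chiM_moment4(1)[OF n v] v by (intro integral_eq_nn_integral[THEN trans]) auto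

lemma radial_mean_0: "radial_mean n v f 0 = chi_mean n v f"
proof -
  have "(\<lambda>j. poisson_weight (0\<^sup>2 / (2 * v)) j * chi_mean (n + 2 * j) v f) = (\<lambda>j. if j = 0 then chi_mean n v f else 0)"
    by (auto simp: poisson_weight_def fun_eq_iff power_0_left)
  then show ?thesis
    unfolding radial_mean_def using sums_single[of 0 "\<lambda>_. chi_mean n v f"] by (simp only: sums_iff)
qed

end

context
  fixes n :: nat and v :: real
  assumes n: "n \<ge> 1" and v: "v > 0"
begin

lemma radial_mean_diff:
  assumes f: "growth f" and g: "growth g"
  shows "radial_mean n v (\<lambda>r. f r - g r) y = radial_mean n v f y - radial_mean n v g y"
proof -
  have "chi_mean (n + 2 * j) v (\<lambda>r. f r - g r) = chi_mean (n + 2 * j) v f - chi_mean (n + 2 * j) v g" for j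
    unfolding chi_mean_def using n by (intro Bochner_Integration.integral_diff integrable_chiM v f g) auto
  then show ?thesis
    unfolding radial_mean_def suminf_diff[OF summable_poisson_weight_chi_mean[OF n v f] summable_poisson_weight_chi_mean[OF n v g]]
    by (simp add: right_diff_distrib)
qed

lemma radial_mean_cmult:
  assumes f: "growth f"
  shows "radial_mean n v (\<lambda>r. c * f r) y = c * radial_mean n v f y"
  unfolding radial_mean_def chi_mean_def suminf_mult[OF summable_poisson_weight_chi_mean[OF n v f, unfolded chi_mean_def], symmetric]
  by (simp add: mult_ac)

lemma radial_mean_const: "radial_mean n v (\<lambda>_. c) y = c"
proof -
  have "chi_mean (n + 2 * j) v (\<lambda>_. c) = c" for j using chi_mean_const[of "n + 2 * j" v c] n v by simp
  then have "radial_mean n v (\<lambda>_. c) y = (\<Sum>j. poisson_weight (y\<^sup>2 / (2 * v)) j * c)" by (simp add: radial_mean_def)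
  also have "\<dots> = c" using sums_mult2[OF poisson_weight_sums, of _ c] by (simp add: sums_iff)
  finally show ?thesis .
qed

lemma radial_mean_add:
  assumes f: "growth f" and g: "growth g"
  shows "radial_mean n v (\<lambda>r. f r + g r) y = radial_mean n v f y + radial_mean n v g y"
  using radial_mean_diff[OF f growth_uminus[OF g]] radial_mean_cmult[OF g, of "-1"] by simp

lemma radial_mean_mono:
  assumes f: "growth f" and g: "growth g" and le: "\<And>r. r > 0 \<Longrightarrow> f r \<le> g r"
  shows "radial_mean n v f y \<le> radial_mean n v g y"
  unfolding radial_mean_def
proof (intro suminf_le mult_left_mono summable_poisson_weight_chi_mean n v f g)
  fix j
  show "chi_mean (n + 2 * j) v f \<le> chi_mean (n + 2 * j) v g"
    unfolding chi_mean_def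
  proof (intro integral_mono_AE integrable_chiM v f g)
    show "AE r in chiM (n + 2 * j) v. f r \<le> g r" using AE_chiM by eventually_elim (rule le)
  qed (use n in auto)
  show "0 \<le> poisson_weight (y\<^sup>2 / (2 * v)) j" using v by (intro poisson_weight_nonneg) simp
qed

lemma isCont_radial_mean:
  assumes f: "growth f"
  shows "isCont (radial_mean n v f) y"
proof -
  define a where "a = (\<lambda>j. chi_mean (n + 2 * j) v f / fact j)"
  define P where "P = (\<lambda>l. \<Sum>j. a j * l ^ j)"
  have sa: "summable (\<lambda>j. a j * l ^ j)" for l
    unfolding a_def by (rule summable_chi_mean_pow[OF n v f])
  have radial_mean_P: "radial_mean n v f = (\<lambda>y. exp (- (y\<^sup>2 / (2 * v))) * P (y\<^sup>2 / (2 * v)))"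
    unfolding P_def a_def by (rule ext) (rule radial_mean_power_series[OF n v f])
  have "isCont P l" for l
    unfolding P_def using termdiffs_strong_converges_everywhere[OF sa] by (rule DERIV_isCont)
  moreover have c: "isCont (\<lambda>y. y\<^sup>2 / (2 * v)) y" using v by (intro continuous_intros) auto
  ultimately have "isCont (\<lambda>y. P (y\<^sup>2 / (2 * v))) y"
    by (intro isCont_o2[OF c])
  moreover have "isCont (\<lambda>y. exp (- (y\<^sup>2 / (2 * v)))) y"
    by (intro isCont_exp' isCont_minus c)
  ultimately show ?thesis
    unfolding radial_mean_P by (rule isCont_mult[rotated])
qed

lemma borel_radial_mean: "growth f \<Longrightarrow> radial_mean n v f \<in> borel_measurable borel"
  by (intro borel_measurable_continuous_onI continuous_at_imp_continuous_on ballI isCont_radial_mean)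

end

text \<open>Integrates the derivative rule from the centre, where the mean is a chi moment: for f r
  = r^2 the function \<open>g\<close> is the constant 2.\<close>

lemma radial_mean_sq:
  assumes n: "n \<ge> 1" and v: "v > 0"
  shows "radial_mean n v (\<lambda>r. r\<^sup>2) y = y\<^sup>2 + real n * v"
proof -
  have "((\<lambda>y. radial_mean n v (\<lambda>r. r\<^sup>2) y - y\<^sup>2) has_real_derivative 0) (at y)" for y
  proof -
    have "(radial_mean n v (\<lambda>r. r\<^sup>2) has_real_derivative y * radial_mean (n + 2) v (\<lambda>_. 2) y) (at y)"
      by (rule DERIV_radial_mean[OF n v growth_sq growth_const]) (auto intro!: derivative_eq_intros)
    then show ?thesis
      using n v by (auto intro!: derivative_eq_intros simp: radial_mean_const)
  qed
  then have "radial_mean n v (\<lambda>r. r\<^sup>2) y - y\<^sup>2 = radial_mean n v (\<lambda>r. r\<^sup>2) 0 - 0\<^sup>2"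
    by (intro DERIV_isconst_all) auto
  then show ?thesis by (simp add: radial_mean_0[OF n v] chi_mean_sq[OF n v])
qed

lemma radial_mean_pow4:
  assumes n: "n \<ge> 1" and v: "v > 0"
  shows "radial_mean n v (\<lambda>r. r ^ 4) y = y ^ 4 + 2 * (real n + 2) * v * y\<^sup>2 + real n * (real n + 2) * v\<^sup>2"
proof -
  have "((\<lambda>y. radial_mean n v (\<lambda>r. r ^ 4) y - (y ^ 4 + 2 * (real n + 2) * v * y\<^sup>2)) has_real_derivative 0) (at y)" for y
  proof -
    have "(radial_mean n v (\<lambda>r. r ^ 4) has_real_derivative y * radial_mean (n + 2) v (\<lambda>r. 4 * r\<^sup>2) y) (at y)"
      by (rule DERIV_radial_mean[OF n v growth_pow4 growth_cmult[OF growth_sq]])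
         (auto intro!: derivative_eq_intros simp: eval_nat_numeral)
    moreover have "radial_mean (n + 2) v (\<lambda>r. 4 * r\<^sup>2) y = 4 * (y\<^sup>2 + real (n + 2) * v)"
      using v by (simp add: radial_mean_cmult growth_sq radial_mean_sq)
    ultimately show ?thesis
      by (auto intro!: derivative_eq_intros simp: algebra_simps eval_nat_numeral)
  qed
  then have "radial_mean n v (\<lambda>r. r ^ 4) y - (y ^ 4 + 2 * (real n + 2) * v * y\<^sup>2)
    = radial_mean n v (\<lambda>r. r ^ 4) 0 - (0 ^ 4 + 2 * (real n + 2) * v * 0\<^sup>2)"
    by (intro DERIV_isconst_all) auto
  then show ?thesis by (simp add: radial_mean_0[OF n v] chi_mean_pow4[OF n v])
qed

text \<open>The mean deviation of the norm from \<open>sqrt (y\<^sup>2 + n v)\<close> is bounded through its second and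
  fourth moments, with AM-GM in place of the Cauchy-Schwarz inequality.\<close>

lemma radial_mean_concentration:
  assumes n: "n \<ge> 1" and v: "v > 0" and f: "growth f" and y: "y \<ge> 0" and c: "c \<ge> 0"
    and lip: "\<And>r s. r \<ge> 0 \<Longrightarrow> s \<ge> 0 \<Longrightarrow> \<bar>f r - f s\<bar> \<le> c * \<bar>r - s\<bar>"
  shows "\<bar>radial_mean n v f y - f (sqrt (y\<^sup>2 + real n * v))\<bar> \<le> c * (2 * sqrt v)"
proof -
  define m where "m = sqrt (y\<^sup>2 + real n * v)"
  have nv: "real n * v > 0" using n v by simp
  have m2: "m\<^sup>2 = y\<^sup>2 + real n * v" unfolding m_def using nv by simp
  have m: "m > 0" unfolding m_def using nv by (simp add: add_nonneg_pos)
  define s where "s = sqrt v"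
  have s: "s > 0" "s\<^sup>2 = v" using v by (auto simp: s_def)
  \<comment> \<open>A polynomial majorant of |r - m|. This distance is at most d = |r^2 - m^2| / m,
    and d is at most d^2 / (4 s) + s by AM-GM. The weight s = sqrt v balances the two terms in the
    mean.\<close>
  define q where "q = (\<lambda>r. 1 / (4 * m\<^sup>2 * s) * (r ^ 4 - 2 * m\<^sup>2 * r\<^sup>2 + m ^ 4) + s)"
  have gq1: "growth (\<lambda>r. r ^ 4 - 2 * m\<^sup>2 * r\<^sup>2 + m ^ 4)"
    by (intro growth_add growth_diff growth_pow4 growth_cmult growth_sq growth_const)
  have gq: "growth q" unfolding q_def by (intro growth_add growth_cmult gq1 growth_const)
  have q: "\<bar>r - m\<bar> \<le> q r" if r: "r > 0" for r
  proof -
    define d where "d = \<bar>r\<^sup>2 - m\<^sup>2\<bar> / m"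
    have "\<bar>r - m\<bar> * m \<le> \<bar>r - m\<bar> * (r + m)" using r m by (intro mult_left_mono) auto
    also have "\<dots> = \<bar>(r - m) * (r + m)\<bar>" using r m by (simp add: abs_mult)
    also have "(r - m) * (r + m) = r\<^sup>2 - m\<^sup>2" by (simp add: power2_eq_square algebra_simps)
    finally have "\<bar>r - m\<bar> \<le> d" using m by (simp add: d_def field_simps)
    also have "d \<le> d\<^sup>2 / (4 * s) + s"
    proof -
      have "0 \<le> (d - 2 * s)\<^sup>2 / (4 * s)" using s by simp
      also have "\<dots> = d\<^sup>2 / (4 * s) - d + s" using s by (simp add: power2_eq_square field_simps)
      finally show ?thesis by simp
    qed
    also have "d\<^sup>2 / (4 * s) = 1 / (4 * m\<^sup>2 * s) * (r\<^sup>2 - m\<^sup>2)\<^sup>2"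
      using m by (simp add: d_def power_divide)
    also have "(r\<^sup>2 - m\<^sup>2)\<^sup>2 = r ^ 4 - 2 * m\<^sup>2 * r\<^sup>2 + m ^ 4"
      by (simp add: power2_eq_square power4_eq_xxxx algebra_simps)
    finally show ?thesis by (simp add: q_def)
  qed
  have Tq: "radial_mean n v q y \<le> 2 * s"
  proof -
    have "radial_mean n v (\<lambda>r. r ^ 4 - 2 * m\<^sup>2 * r\<^sup>2 + m ^ 4) y
      = radial_mean n v (\<lambda>r. r ^ 4) y - 2 * m\<^sup>2 * radial_mean n v (\<lambda>r. r\<^sup>2) y + m ^ 4"
      unfolding radial_mean_add[OF n v growth_diff[OF growth_pow4 growth_cmult[OF growth_sq]] growth_const]
        radial_mean_diff[OF n v growth_pow4 growth_cmult[OF growth_sq]] radial_mean_cmult[OF n v growth_sq] radial_mean_const[OF n v] ..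
    \<comment> \<open>The variance of the squared norm. It is at most 4 v m^2, so the mean of
      \<open>q\<close> is at most 2 s, a bound free of the dimension.\<close>
    also have "\<dots> = 4 * v * y\<^sup>2 + 2 * real n * v\<^sup>2"
    proof -
      have "m ^ 4 = (y\<^sup>2 + real n * v)\<^sup>2" unfolding m2[symmetric] by simp
      then show ?thesis unfolding radial_mean_pow4[OF n v] radial_mean_sq[OF n v] m2
        by (simp add: power2_eq_square power4_eq_xxxx algebra_simps)
    qed
    also have "\<dots> \<le> 4 * v * m\<^sup>2"
      unfolding m2 using n v by (simp add: power2_eq_square algebra_simps)
    finally have "1 / (4 * m\<^sup>2 * s) * radial_mean n v (\<lambda>r. r ^ 4 - 2 * m\<^sup>2 * r\<^sup>2 + m ^ 4) y \<le> 1 / (4 * m\<^sup>2 * s) * (4 * v * m\<^sup>2)"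
      using m s by (intro mult_left_mono) auto
    also have "\<dots> = s" using m s by (simp add: power2_eq_square field_simps s(2)[symmetric])
    finally show ?thesis
      unfolding q_def radial_mean_add[OF n v growth_cmult[OF gq1] growth_const] radial_mean_cmult[OF n v gq1] radial_mean_const[OF n v]
      by simp
  qed
  have up: "f r \<le> f m + c * q r" and lo: "f m - c * q r \<le> f r" if r: "r > 0" for r
  proof -
    have "\<bar>f r - f m\<bar> \<le> c * q r"
      using lip[of r m] mult_left_mono[OF q[OF r] c] r m by linarith
    then show "f r \<le> f m + c * q r" "f m - c * q r \<le> f r" by linarith+
  qed
  have "radial_mean n v f y \<le> radial_mean n v (\<lambda>r. f m + c * q r) y"
    by (intro radial_mean_mono n v f growth_add growth_const growth_cmult gq up)
  moreover have "radial_mean n v (\<lambda>r. f m - c * q r) y \<le> radial_mean n v f y"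
    by (intro radial_mean_mono n v f growth_diff growth_const growth_cmult gq lo)
  moreover have "radial_mean n v (\<lambda>r. f m + c * q r) y = f m + c * radial_mean n v q y" "radial_mean n v (\<lambda>r. f m - c * q r) y = f m - c * radial_mean n v q y"
    unfolding radial_mean_add[OF n v growth_const growth_cmult[OF gq]] radial_mean_diff[OF n v growth_const growth_cmult[OF gq]]
      radial_mean_cmult[OF n v gq] radial_mean_const[OF n v] by simp_all
  moreover have "c * radial_mean n v q y \<le> c * (2 * s)" using Tq c by (intro mult_left_mono)
  ultimately show ?thesis unfolding m_def[symmetric] s_def[symmetric] by linarith
qed

text \<open>Sign changes: multiplying the chi density by \<open>r\<^sup>2\<close> and then mixing with Poisson weights
  preserves the pattern of first negative, then positive values.\<close>

lemma chi_mean_sign: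
  assumes m: "m \<ge> 1" and v: "v > 0" and g: "growth g" and z: "z \<ge> 0"
    and neg: "\<And>r. 0 < r \<Longrightarrow> r < z \<Longrightarrow> g r \<le> 0" and pos: "\<And>r. r > z \<Longrightarrow> g r \<ge> 0"
    and d: "chi_mean m v g \<ge> 0"
  shows "chi_mean (m + 2) v g \<ge> 0"
proof -
  note I = integral_chi_density[OF _ v g]
  have m2: "m + 2 \<ge> 1" by simp
  \<comment> \<open>The shift identity turns the integrand into the chi density times (r^2 - z^2) g
    r, where both factors pass from negative to positive at z.\<close>
  have "0 \<le> (\<integral>r. (real m * v) * (chi_density (m + 2) v r * g r) - z\<^sup>2 * (chi_density m v r * g r) \<partial>lborel)"
  proof (rule Bochner_Integration.integral_nonneg)
    fix r :: real
    have "(real m * v) * (chi_density (m + 2) v r * g r) - z\<^sup>2 * (chi_density m v r * g r)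
       = chi_density m v r * ((r\<^sup>2 - z\<^sup>2) * g r)"
      using chi_density_shift[OF m v, of r] by (simp add: mult.assoc[symmetric]) (simp add: algebra_simps)
    also have "\<dots> \<ge> 0"
    proof (cases "r > 0")
      case True
      have "(r\<^sup>2 - z\<^sup>2) * g r \<ge> 0"
      proof (cases r z rule: linorder_cases)
        case less
        then have "r\<^sup>2 \<le> z\<^sup>2" using True by (intro power_mono) auto
        then show ?thesis using neg[OF True less] by (intro mult_nonpos_nonpos) auto
      next
        case greater
        then have "z\<^sup>2 \<le> r\<^sup>2" using z by (intro power_mono) auto
        then show ?thesis using pos[OF greater] by (intro mult_nonneg_nonneg) auto
      qed simp
      then show ?thesis using chi_density_nonneg[OF m v, of r] by simp
    qed (simp add: chi_density_def)
    finally show "0 \<le> (real m * v) * (chi_density (m + 2) v r * g r) - z\<^sup>2 * (chi_density m v r * g r)" .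
  qed
  also have "\<dots> = (real m * v) * chi_mean (m + 2) v g - z\<^sup>2 * chi_mean m v g"
    using I[OF m] I[OF m2] by (simp add: Bochner_Integration.integral_diff)
  finally have "(real m * v) * chi_mean (m + 2) v g \<ge> z\<^sup>2 * chi_mean m v g" by simp
  moreover have "z\<^sup>2 * chi_mean m v g \<ge> 0" using d by simp
  moreover have "real m * v > 0" using m v by simp
  ultimately show ?thesis by (metis mult_less_cancel_left_pos mult_zero_right not_le order_trans)
qed

text \<open>The coefficients of the power series pass from negative to nonnegative once, at an index
  J. Enlarging the argument by a factor t \<ge> 1 multiplies term j by t^j, which is at least t^J on
  the nonnegative terms and at most t^J on the negative ones; hence the new sum is at least t^J
  times the old one.\<close>

lemma radial_mean_sign:
  assumes m: "m \<ge> 1" and v: "v > 0" and g: "growth g" and z: "z \<ge> 0"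
    and neg: "\<And>r. 0 < r \<Longrightarrow> r < z \<Longrightarrow> g r \<le> 0" and pos: "\<And>r. r > z \<Longrightarrow> g r \<ge> 0"
    and y: "0 < y1" "y1 < y2" and T: "radial_mean m v g y1 \<ge> 0"
  shows "radial_mean m v g y2 \<ge> 0"
proof -
  define d where "d = (\<lambda>j. chi_mean (m + 2 * j) v g / fact j)"
  define P where "P = (\<lambda>l. \<Sum>j. d j * l ^ j)"
  have sd: "summable (\<lambda>j. d j * l ^ j)" for l
    unfolding d_def by (rule summable_chi_mean_pow[OF m v g])
  have radial_mean_P: "radial_mean m v g y = exp (- (y\<^sup>2 / (2 * v))) * P (y\<^sup>2 / (2 * v))" for y
    unfolding P_def d_def by (rule radial_mean_power_series[OF m v g])
  have step: "d (Suc j) \<ge> 0" if "d j \<ge> 0" for j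
  proof -
    have "chi_mean (m + 2 * j) v g = d j * fact j" by (simp add: d_def)
    then have "chi_mean (m + 2 * j) v g \<ge> 0" using that by simp
    then have "chi_mean (m + 2 * j + 2) v g \<ge> 0"
      by (intro chi_mean_sign[OF _ v g z]) (use m neg pos in auto)
    then show ?thesis by (simp add: d_def)
  qed
  define a where "a = y1\<^sup>2 / (2 * v)"
  define b where "b = y2\<^sup>2 / (2 * v)"
  have ab: "0 < a" "a \<le> b" using y v by (auto simp: a_def b_def intro!: divide_right_mono power_mono)
  have Pa: "P a \<ge> 0" using T by (simp add: radial_mean_P a_def zero_le_mult_iff)
  have "P b \<ge> 0"
  proof (cases "\<exists>j. d j \<ge> 0")
    case True
    define J where "J = (LEAST j. d j \<ge> 0)"
    have J: "d J \<ge> 0" unfolding J_def using True by (rule LeastI_ex)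
    have dn: "d j \<ge> 0" if "j \<ge> J" for j
      using that J step by (induction j rule: dec_induct) auto
    have dl: "d j < 0" if "j < J" for j
      using not_less_Least[of j "\<lambda>j. d j \<ge> 0"] that by (simp add: J_def)
    define t where "t = b / a"
    have t: "t \<ge> 1" and bt: "b = t * a" using ab by (auto simp: t_def)
    have "t ^ J * P a = (\<Sum>j. t ^ J * (d j * a ^ j))"
      unfolding P_def by (rule suminf_mult[OF sd, symmetric])
    also have "\<dots> \<le> P b"
      unfolding P_def
    proof (intro suminf_le summable_mult sd)
      fix j
      show "t ^ J * (d j * a ^ j) \<le> d j * b ^ j"
      proof (cases "j < J")
        case True
        then have "t ^ j \<le> t ^ J" using t by (intro power_increasing) auto
        then have "t ^ J * (d j * a ^ j) \<le> t ^ j * (d j * a ^ j)"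
          using dl[OF True] ab by (intro mult_right_mono_neg) (auto intro!: mult_nonpos_nonneg)
        then show ?thesis by (simp add: bt power_mult_distrib mult_ac)
      next
        case False
        then have "t ^ J \<le> t ^ j" using t by (intro power_increasing) auto
        then have "t ^ J * (d j * a ^ j) \<le> t ^ j * (d j * a ^ j)"
          using dn[of j] False ab by (intro mult_right_mono) auto
        then show ?thesis by (simp add: bt power_mult_distrib mult_ac)
      qed
    qed
    finally have "t ^ J * P a \<le> P b" .
    moreover have "t ^ J * P a \<ge> 0" using Pa t by simp
    ultimately show ?thesis by simp
  next
    case False
    then have "d j < 0" for j by (simp add: not_le)
    then have "0 < (\<Sum>j. - (d j * a ^ j))"
      using ab by (intro suminf_pos summable_minus sd) (simp add: mult_neg_pos)
    also have "\<dots> = - P a" unfolding P_def by (rule suminf_minus[OF sd])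
    finally show ?thesis using Pa by simp
  qed
  then show ?thesis by (simp add: radial_mean_P b_def)
qed

text \<open>Since \<tau> stays nonnegative once it is so, its sign at \<open>r\<close> decides:
  either \<open>F\<close> is nondecreasing on [r, R] or it is nonincreasing on [0, r].\<close>

lemma max_at_endpoints:
  fixes F \<tau> :: "real \<Rightarrow> real"
  assumes D: "\<And>y. (F has_real_derivative y * \<tau> y) (at y)"
    and s: "\<And>y1 y2. 0 < y1 \<Longrightarrow> y1 < y2 \<Longrightarrow> \<tau> y1 \<ge> 0 \<Longrightarrow> \<tau> y2 \<ge> 0"
    and r: "0 \<le> r" "r \<le> R"
  shows "F r \<le> max (F 0) (F R)"
proof (cases "r = 0")
  case False
  then have r0: "r > 0" using r by simp
  show ?thesis
  proof (cases "\<tau> r \<ge> 0")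
    case True
    have "F r \<le> F R"
    proof (rule DERIV_nonneg_imp_nondecreasing[OF r(2)])
      fix y assume y: "r \<le> y" "y \<le> R"
      have "\<tau> y \<ge> 0" using s[OF r0, of y] True y by (cases "y = r") auto
      then show "\<exists>d. (F has_real_derivative d) (at y) \<and> 0 \<le> d" using D[of y] y r0 by (intro exI[of _ "y * \<tau> y"]) auto
    qed
    then show ?thesis by simp
  next
    case False
    have "F r \<le> F 0"
    proof (rule DERIV_nonpos_imp_nonincreasing[OF r(1)])
      fix y assume y: "0 \<le> y" "y \<le> r"
      have "y * \<tau> y \<le> 0"
      proof (cases "y = 0 \<or> y = r")
        case True
        then show ?thesis using False r0 by (auto simp: mult_le_0_iff)
      next
        case nt: False
        then have "\<not> \<tau> y \<ge> 0" using s[of y r] False y by auto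
        then show ?thesis using y by (simp add: mult_le_0_iff)
      qed
      then show "\<exists>d. (F has_real_derivative d) (at y) \<and> d \<le> 0" using D[of y] by blast
    qed
    then show ?thesis by simp
  qed
qed simp

subsection \<open>The uniform law on a sphere\<close>

definition sphere_proj :: "nat \<Rightarrow> real \<Rightarrow> (nat \<Rightarrow> real) \<Rightarrow> (nat \<Rightarrow> real)" where
  "sphere_proj n R w = (\<lambda>i\<in>{..<n}. R * w i / vnorm n w)"

lemma measurable_sphere_proj[measurable]: "sphere_proj n R \<in> Rn n \<rightarrow>\<^sub>M Rn n"
proof -
  have [measurable]: "(\<lambda>x. x i) \<in> borel_measurable (Rn n)" if "i < n" for i
    using that by (rule measurable_coord)
  show ?thesis
    unfolding sphere_proj_def[abs_def] by (subst (2) Rn_def, intro measurable_restrict) measurable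
qed

lemma dotp_sphere_proj: "dotp n y (sphere_proj n R w) = R / vnorm n w * dotp n y w"
  by (simp add: dotp_def sphere_proj_def sum_distrib_left mult_ac)

lemma vnorm_sphere_proj:
  assumes "vnorm n w \<noteq> 0" "R \<ge> 0"
  shows "vnorm n (sphere_proj n R w) = R"
proof -
  have "(vnorm n (sphere_proj n R w))\<^sup>2 = (R / vnorm n w)\<^sup>2 * (vnorm n w)\<^sup>2"
    by (simp add: vnorm_sq sphere_proj_def sum_distrib_left power_mult_distrib power_divide)
  also have "\<dots> = R\<^sup>2" using assms by (simp add: power_divide)
  finally show ?thesis using assms by simp
qed

context
  fixes n :: nat and R :: real
  assumes n: "n \<ge> 1" and R: "R > 0"
begin

lemma nn_integral_ball:
  assumes c: "c \<ge> 0"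
  shows "(\<integral>\<^sup>+r. ennreal (c * r ^ (n - 1)) * indicator {0<..} r * indicator {..1} r \<partial>lborel) = ennreal (c / real n)"
proof -
  have "(\<integral>\<^sup>+r. ennreal (c * r ^ (n - 1)) * indicator {0<..} r * indicator {..1} r \<partial>lborel)
    = (\<integral>\<^sup>+r. ennreal (c * r ^ (n - 1)) * indicator {0..1} r \<partial>lborel)"
    by (rule nn_integral_cong_AE, use AE_lborel_singleton[of "0::real"] in eventually_elim) (auto simp: indicator_def)
  also have "\<dots> = ennreal (c / real n * 1 ^ n - c / real n * 0 ^ n)"
  proof (rule nn_integral_FTC_Icc)
    show "((\<lambda>r. c / real n * r ^ n) has_real_derivative c * x ^ (n - 1)) (at x)" for x
      using n by (auto intro!: derivative_eq_intros)
  qed (use c in auto)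
  finally show ?thesis using n by (simp add: power_0_left)
qed

abbreviation "uball \<equiv> {x \<in> space (Ln n). vnorm n x \<le> 1}"

text \<open>The coefficient t R / r of the scalar product cancels the radius in the Bessel argument,
  so the radial integral is merely that of r^(n - 1) over the unit interval.\<close>

lemma nn_integral_uball_exp:
  "(\<integral>\<^sup>+w. ennreal (exp (t * (R / vnorm n w * dotp n y w))) * indicator {..1} (vnorm n w) \<partial>Ln n)
    = ennreal (2 * pi powr (real n / 2) * bessel_ser (real n / 2) ((vnorm n y * R * t)\<^sup>2 / 4) / real n)"
proof -
  let ?c = "2 * pi powr (real n / 2) * bessel_ser (real n / 2) ((vnorm n y * R * t)\<^sup>2 / 4)"
  have c: "?c \<ge> 0" using n by (intro mult_nonneg_nonneg less_imp_le[OF bessel_ser_pos]) auto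
  have "(\<integral>\<^sup>+w. ennreal (exp ((\<lambda>r. t * R / r) (vnorm n w) * dotp n y w)) * indicator {..1} (vnorm n w) \<partial>Ln n)
    = (\<integral>\<^sup>+r. ennreal (2 * pi powr (real n / 2) * bessel_ser (real n / 2) ((vnorm n y * r * (t * R / r))\<^sup>2 / 4) * r ^ (n - 1))
        * indicator {0<..} r * indicator {..1} r \<partial>lborel)"
    by (rule nn_integral_Ln_exp[OF n]) auto
  also have "\<dots> = (\<integral>\<^sup>+r. ennreal (?c * r ^ (n - 1)) * indicator {0<..} r * indicator {..1} r \<partial>lborel)"
    by (intro nn_integral_cong) (auto simp: indicator_def mult_ac)
  also have "\<dots> = ennreal (?c / real n)" by (rule nn_integral_ball[OF c])
  finally show ?thesis by (simp add: mult.assoc)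
qed

lemma emeasure_uball: "emeasure (Ln n) uball = ennreal (2 * pi powr (real n / 2) * rGamma (real n / 2) / real n)"
proof -
  have "emeasure (Ln n) uball = (\<integral>\<^sup>+w. indicator uball w \<partial>Ln n)" by simp
  also have "\<dots> = (\<integral>\<^sup>+w. ennreal (exp (0 * (R / vnorm n w * dotp n (\<lambda>_. 0) w))) * indicator {..1} (vnorm n w) \<partial>Ln n)"
    by (intro nn_integral_cong) (auto simp: indicator_def)
  also have "\<dots> = ennreal (2 * pi powr (real n / 2) * rGamma (real n / 2) / real n)"
    unfolding nn_integral_uball_exp by (simp add: bessel_ser_0)
  finally show ?thesis .
qed

lemma rGamma_pos: "rGamma (real n / 2) > 0"
  using n by (simp add: rGamma_inverse_Gamma Gamma_real_pos)

lemma vol_pos: "2 * pi powr (real n / 2) * rGamma (real n / 2) / real n > 0"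
  using rGamma_pos n by simp

lemma prob_uball: "prob_space (uniform_measure (Ln n) uball)"
proof (rule prob_space_uniform_measure)
  show "emeasure (Ln n) uball \<noteq> 0"
    unfolding emeasure_uball using vol_pos by (metis ennreal_eq_0_iff not_le)
  show "emeasure (Ln n) uball \<noteq> \<infinity>"
    unfolding emeasure_uball by simp
qed

lemma sphere_unif_sphere_proj: "sphere_unif n R = distr (uniform_measure (Ln n) uball) (Rn n) (sphere_proj n R)"
  by (simp add: sphere_unif_def sphere_proj_def[abs_def])

lemma sphere_proj_measurable_uniform[measurable]: "sphere_proj n R \<in> uniform_measure (Ln n) uball \<rightarrow>\<^sub>M Rn n"
  by measurable

text \<open>The projection reaches norm \<open>R\<close> from every point except the origin, where
  division by 0 yields the zero vector. The origin is a null set, by the radial formula with zero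
  exponent.\<close>

lemma AE_sphere: "AE x in sphere_unif n R. vnorm n x = R"
  unfolding sphere_unif_sphere_proj
proof (subst AE_distr_iff[OF sphere_proj_measurable_uniform])
  have "(\<integral>\<^sup>+w. indicator {0} (vnorm n w) \<partial>Ln n) = (\<integral>\<^sup>+w. ennreal (exp ((\<lambda>_. 0) (vnorm n w) * dotp n (\<lambda>_. 0) w)) * indicator {0} (vnorm n w) \<partial>Ln n)"
    by simp
  also have "\<dots> = (\<integral>\<^sup>+r. ennreal (2 * pi powr (real n / 2) * bessel_ser (real n / 2) ((vnorm n (\<lambda>_. 0) * r * 0)\<^sup>2 / 4) * r ^ (n - 1)) * indicator {0<..} r * indicator {0} r \<partial>lborel)"
    by (rule nn_integral_Ln_exp[OF n]) auto
  also have "\<dots> = (\<integral>\<^sup>+r. 0 \<partial>(lborel :: real measure))"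
    by (intro nn_integral_cong) (auto simp: indicator_def)
  finally have "(\<integral>\<^sup>+w. indicator {0::real} (vnorm n w) \<partial>Ln n) = 0" by simp
  then have "AE w in Ln n. (indicator {0::real} (vnorm n w) :: ennreal) = 0"
    by (subst (asm) nn_integral_0_iff_AE) auto
  then have "AE w in Ln n. vnorm n w \<noteq> 0"
    by eventually_elim (auto simp: indicator_def split: if_splits)
  then have "AE w in Ln n. w \<in> uball \<longrightarrow> vnorm n (sphere_proj n R w) = R"
    by eventually_elim (use R in \<open>auto simp: vnorm_sphere_proj\<close>)
  then show "AE w in uniform_measure (Ln n) uball. vnorm n (sphere_proj n R w) = R"
    by (intro AE_uniform_measureI) auto
qed measurable

lemma prob_sphere: "prob_space (sphere_unif n R)"
  unfolding sphere_unif_sphere_proj by (rule prob_space.prob_space_distr[OF prob_uball]) measurable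

lemma channel_input_sphere: "channel_input n R (sphere_unif n R)"
proof
  have "AE x in sphere_unif n R. vnorm n x \<le> R"
    using AE_sphere by eventually_elim simp
  moreover have "sets (sphere_unif n R) = sets (Rn n)" by (simp add: sphere_unif_sphere_proj)
  ultimately show "admissible n R (sphere_unif n R)"
    using prob_sphere by (simp only: admissible_def)
qed (use n R in auto)

text \<open>A quotient of two ball integrals, the volume being the case of exponent 0. This moment
  generating function makes the output density of the sphere law explicit.\<close>

lemma sphere_exp:
  "has_bochner_integral (sphere_unif n R) (\<lambda>x. exp (t * dotp n y x))
     (bessel_ser (real n / 2) ((vnorm n y * R * t)\<^sup>2 / 4) / rGamma (real n / 2))"
proof (rule has_bochner_integral_nn_integral)
  have s: "bessel_ser (real n / 2) ((vnorm n y * R * t)\<^sup>2 / 4) > 0" using n by (intro bessel_ser_pos) auto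
  then show "0 \<le> bessel_ser (real n / 2) ((vnorm n y * R * t)\<^sup>2 / 4) / rGamma (real n / 2)"
    using rGamma_pos by simp
  have "(\<integral>\<^sup>+x. ennreal (exp (t * dotp n y x)) \<partial>sphere_unif n R)
    = (\<integral>\<^sup>+w. ennreal (exp (t * dotp n y (sphere_proj n R w))) \<partial>uniform_measure (Ln n) uball)"
    unfolding sphere_unif_sphere_proj by (rule nn_integral_distr[OF sphere_proj_measurable_uniform]) measurable
  also have "\<dots> = (\<integral>\<^sup>+w. ennreal (exp (t * dotp n y (sphere_proj n R w))) * indicator uball w \<partial>Ln n) / emeasure (Ln n) uball"
    by (rule nn_integral_uniform_measure) measurable
  also have "(\<integral>\<^sup>+w. ennreal (exp (t * dotp n y (sphere_proj n R w))) * indicator uball w \<partial>Ln n)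
    = (\<integral>\<^sup>+w. ennreal (exp (t * (R / vnorm n w * dotp n y w))) * indicator {..1} (vnorm n w) \<partial>Ln n)"
    unfolding dotp_sphere_proj by (intro nn_integral_cong) (auto simp: indicator_def)
  also have "\<dots> / emeasure (Ln n) uball = ennreal (bessel_ser (real n / 2) ((vnorm n y * R * t)\<^sup>2 / 4) / rGamma (real n / 2))"
    unfolding emeasure_uball nn_integral_uball_exp
  proof (subst divide_ennreal)
    have alg: "(2 * p * b / m) / (2 * p * g / m) = b / g" if "p > 0" "m > 0" for p b m g :: real
      using that by simp
    have p: "pi powr (real n / 2) > 0" "real n > 0" using n by auto
    show "ennreal (2 * pi powr (real n / 2) * bessel_ser (real n / 2) ((vnorm n y * R * t)\<^sup>2 / 4) / real n /
      (2 * pi powr (real n / 2) * rGamma (real n / 2) / real n)) = ennreal (bessel_ser (real n / 2) ((vnorm n y * R * t)\<^sup>2 / 4) / rGamma (real n / 2))"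
      unfolding alg[OF p] ..
  qed (use s vol_pos in auto)
  finally show "(\<integral>\<^sup>+x. ennreal (exp (t * dotp n y x)) \<partial>sphere_unif n R) = ennreal (bessel_ser (real n / 2) ((vnorm n y * R * t)\<^sup>2 / 4) / rGamma (real n / 2))" .
  show "(\<lambda>x. exp (t * dotp n y x)) \<in> borel_measurable (sphere_unif n R)"
    by (simp add: sphere_unif_sphere_proj)
qed simp

end

section \<open>The logarithm of the output density of the sphere law as a function of the
  radius\<close>

definition psi :: "nat \<Rightarrow> real \<Rightarrow> real \<Rightarrow> real \<Rightarrow> real" where
  "psi n R v r = ln ((2 * pi * v) powr (- real n / 2)) - (r\<^sup>2 + R\<^sup>2) / (2 * v) + log_bessel (real n / 2) (R / v * r)"

text \<open>The derivative of \<open>psi\<close> divided by the radius, the form asked for by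
  \<open>DERIV_radial_mean\<close>. Up to the factor 1/v it is the expression inside Assumption
  (A).\<close>

definition psi_slope :: "nat \<Rightarrow> real \<Rightarrow> real \<Rightarrow> real \<Rightarrow> real" where
  "psi_slope n R v r = 1 / v * (R / r * bessel_ratio (real n / 2) (R / v * r) - 1)"

lemma isCont_bessel_ratio:
  assumes "\<nu> > 0"
  shows "isCont (bessel_ratio \<nu>) t"
proof -
  have c: "isCont (\<lambda>t::real. t\<^sup>2 / 4) t" by (intro continuous_intros) auto
  have 1: "isCont (\<lambda>t. bessel_ser \<nu> (t\<^sup>2 / 4)) t" "isCont (\<lambda>t. bessel_ser (\<nu> + 1) (t\<^sup>2 / 4)) t"
    using assms by (auto intro!: isCont_o2[OF c] DERIV_isCont[OF DERIV_bessel_ser])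
  moreover have "bessel_ser \<nu> (t\<^sup>2 / 4) \<noteq> 0" using bessel_ser_pos[OF assms, of "t\<^sup>2 / 4"] by simp
  ultimately show ?thesis
    unfolding bessel_ratio_def[abs_def] by (intro continuous_intros) auto
qed

lemma borel_bessel_ratio[measurable]: "\<nu> > 0 \<Longrightarrow> bessel_ratio \<nu> \<in> borel_measurable borel"
  by (intro borel_measurable_continuous_onI continuous_at_imp_continuous_on ballI isCont_bessel_ratio)

lemma borel_log_bessel: "\<nu> > 0 \<Longrightarrow> log_bessel \<nu> \<in> borel_measurable borel"
  by (intro borel_measurable_continuous_onI continuous_at_imp_continuous_on ballI DERIV_isCont[OF DERIV_log_bessel])

text \<open>Quadratic bounds survive averaging, because the mean of r^2 is again quadratic in the
  distance. This permits a radial mean to be averaged a second time.\<close>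

lemma growth_radial_mean:
  assumes n: "n \<ge> 1" and v: "v > 0" and f: "f \<in> borel_measurable borel"
    and b: "\<And>r. r \<ge> 0 \<Longrightarrow> \<bar>f r\<bar> \<le> A + B * r\<^sup>2" and AB: "A \<ge> 0" "B \<ge> 0"
  shows "growth (radial_mean n v f)"
proof -
  have gf: "growth f" by (rule growthI[OF f b AB])
  have gb: "growth (\<lambda>r. A + B * r\<^sup>2)" by (intro growth_add growth_const growth_cmult growth_sq)
  have Tb: "radial_mean n v (\<lambda>r. A + B * r\<^sup>2) y = A + B * (y\<^sup>2 + real n * v)" for y
    unfolding radial_mean_add[OF n v growth_const growth_cmult[OF growth_sq]] radial_mean_cmult[OF n v growth_sq]
      radial_mean_const[OF n v] radial_mean_sq[OF n v] ..
  have "radial_mean n v f y \<le> A + B * (y\<^sup>2 + real n * v)" for y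
  proof -
    have "radial_mean n v f y \<le> radial_mean n v (\<lambda>r. A + B * r\<^sup>2) y"
    proof (rule radial_mean_mono[OF n v gf gb])
      show "f r \<le> A + B * r\<^sup>2" if "r > 0" for r using b[of r] that by linarith
    qed
    then show ?thesis by (simp only: Tb)
  qed
  note up = this
  have lo: "- (A + B * (y\<^sup>2 + real n * v)) \<le> radial_mean n v f y" for y
  proof -
    have "radial_mean n v (\<lambda>r. (-1) * (A + B * r\<^sup>2)) y \<le> radial_mean n v f y"
    proof (rule radial_mean_mono[OF n v growth_cmult[OF gb] gf])
      show "(-1) * (A + B * r\<^sup>2) \<le> f r" if "r > 0" for r using b[of r] that unfolding mult_minus1 by linarith
    qed
    then show ?thesis unfolding radial_mean_cmult[OF n v gb] Tb by simp
  qed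
  have "\<bar>radial_mean n v f y\<bar> \<le> (A + B * (real n * v)) + B * y\<^sup>2" for y
  proof -
    have "\<bar>radial_mean n v f y\<bar> \<le> A + B * (y\<^sup>2 + real n * v)"
      using up[of y] lo[of y] by linarith
    then show ?thesis by (simp only: distrib_left add_ac)
  qed
  then show ?thesis
    using AB n v by (intro growthI[of _ "A + B * (real n * v)" B] borel_radial_mean n v gf) auto
qed

context
  fixes n :: nat and R v :: real
  assumes n: "n > 2" and R: "R > 0" and v: "v > 0"
begin

lemma half_dim_gt_1: "real n / 2 > 1" using n by simp

lemma n1: "n \<ge> 1" using n by simp

lemma log_bessel_bound: "r \<ge> 0 \<Longrightarrow> \<bar>log_bessel (real n / 2) (R / v * r)\<bar> \<le> R / v + R / v * r\<^sup>2"
proof -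
  assume r: "r \<ge> 0"
  have "\<bar>log_bessel (real n / 2) (R / v * r)\<bar> \<le> R / v * r"
    using log_bessel_lipschitz[OF half_dim_gt_1, of "R / v * r" 0] R v r by (simp add: log_bessel_0)
  also have "\<dots> \<le> R / v * (1 + r\<^sup>2)"
  proof (rule mult_left_mono)
    show "r \<le> 1 + r\<^sup>2" using zero_le_power2[of "r - 1"] r by (simp add: power2_eq_square algebra_simps)
  qed (use R v in auto)
  finally show ?thesis by (simp only: distrib_left mult_1_right)
qed

lemma growth_log_bessel: "growth (\<lambda>r. log_bessel (real n / 2) (R / v * r))"
proof (rule growthI[OF _ log_bessel_bound])
  have [measurable]: "log_bessel (real n / 2) \<in> borel_measurable borel" using n by (intro borel_log_bessel) simp
  show "(\<lambda>r. log_bessel (real n / 2) (R / v * r)) \<in> borel_measurable borel" by measurable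
qed (use R v in auto)

lemma psi_bound: "\<exists>A B. A \<ge> 0 \<and> B \<ge> 0 \<and> (\<forall>r\<ge>0. \<bar>psi n R v r\<bar> \<le> A + B * r\<^sup>2)"
proof (intro exI conjI allI impI)
  let ?c = "ln ((2 * pi * v) powr (- real n / 2))"
  show "0 \<le> \<bar>?c\<bar> + R\<^sup>2 / (2 * v) + R / v" "0 \<le> 1 / (2 * v) + R / v" using R v by auto
  fix r :: real assume r: "r \<ge> 0"
  have "(r\<^sup>2 + R\<^sup>2) / (2 * v) = 1 / (2 * v) * r\<^sup>2 + R\<^sup>2 / (2 * v)" by (simp add: add_divide_distrib)
  moreover have "0 \<le> 1 / (2 * v) * r\<^sup>2" "0 \<le> R\<^sup>2 / (2 * v)" using v by auto
  ultimately have "\<bar>psi n R v r\<bar> \<le> (\<bar>?c\<bar> + R\<^sup>2 / (2 * v) + R / v) + (1 / (2 * v) * r\<^sup>2 + R / v * r\<^sup>2)"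
    using log_bessel_bound[OF r] unfolding psi_def by linarith
  then show "\<bar>psi n R v r\<bar> \<le> \<bar>?c\<bar> + R\<^sup>2 / (2 * v) + R / v + (1 / (2 * v) + R / v) * r\<^sup>2"
    by (simp add: algebra_simps)
qed

lemma borel_psi: "psi n R v \<in> borel_measurable borel"
proof -
  have [measurable]: "log_bessel (real n / 2) \<in> borel_measurable borel" using n by (intro borel_log_bessel) simp
  show ?thesis unfolding psi_def[abs_def] by measurable
qed

lemma growth_psi: "growth (psi n R v)"
proof -
  obtain A B where "A \<ge> 0" "B \<ge> 0" "\<forall>r\<ge>0. \<bar>psi n R v r\<bar> \<le> A + B * r\<^sup>2" using psi_bound by blast
  then show ?thesis by (intro growthI[OF borel_psi, of A B]) auto
qed

lemma psi_slope_ge: "r \<ge> 0 \<Longrightarrow> psi_slope n R v r \<ge> - (1 / v)"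
proof -
  assume r: "r \<ge> 0"
  have "0 \<le> R / r * bessel_ratio (real n / 2) (R / v * r)"
    using bessel_ratio_nonneg[of "real n / 2" "R / v * r"] R v r n by (intro mult_nonneg_nonneg) auto
  then have "1 / v * (-1) \<le> psi_slope n R v r" unfolding psi_slope_def using v by (intro mult_left_mono) auto
  then show ?thesis by simp
qed

lemma psi_slope_le: "r > 0 \<Longrightarrow> psi_slope n R v r \<le> 1 / v * (R / r - 1)"
proof -
  assume r: "r > 0"
  have "R / r * bessel_ratio (real n / 2) (R / v * r) \<le> R / r * 1"
    using bessel_ratio_le_1[OF half_dim_gt_1, of "R / v * r"] R v r by (intro mult_left_mono) auto
  then show ?thesis unfolding psi_slope_def using v by (intro mult_left_mono) auto
qed

text \<open>The linear bound on the Bessel quotient cancels the factor R / r, so there is no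
  singularity at radius 0. The zero quadratic term fits the premise of
  \<open>growthI\<close>.\<close>

lemma psi_slope_bounded: "r \<ge> 0 \<Longrightarrow> \<bar>psi_slope n R v r\<bar> \<le> (1 / v * (R\<^sup>2 / v / real n) + 1 / v) + 0 * r\<^sup>2"
proof -
  assume r: "r \<ge> 0"
  have "R / r * bessel_ratio (real n / 2) (R / v * r) \<le> R\<^sup>2 / v / real n"
  proof (cases "r = 0")
    case False
    have "real n * bessel_ratio (real n / 2) (R / v * r) \<le> R / v * r"
      using bessel_ratio_le_lin[of "real n / 2" "R / v * r"] n R v r by simp
    then have "bessel_ratio (real n / 2) (R / v * r) \<le> R / v * r / real n"
      by (subst pos_le_divide_eq) (use n in \<open>auto simp: mult.commute\<close>)
    then have "R / r * bessel_ratio (real n / 2) (R / v * r) \<le> R / r * (R / v * r / real n)"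
      using R r by (intro mult_left_mono) auto
    also have "\<dots> = R\<^sup>2 / v / real n" using False by (simp add: power2_eq_square)
    finally show ?thesis .
  qed (use v in simp)
  then have "psi_slope n R v r \<le> 1 / v * (R\<^sup>2 / v / real n)" unfolding psi_slope_def using v by (intro mult_left_mono) auto
  moreover have "0 \<le> 1 / v * (R\<^sup>2 / v / real n)" "0 \<le> 1 / v" using v by auto
  ultimately show ?thesis using psi_slope_ge[OF r] by linarith
qed

lemma borel_psi_slope: "psi_slope n R v \<in> borel_measurable borel"
proof -
  have [measurable]: "bessel_ratio (real n / 2) \<in> borel_measurable borel" using n by (intro borel_bessel_ratio) simp
  show ?thesis unfolding psi_slope_def[abs_def] by measurable
qed

lemma growth_psi_slope: "growth (psi_slope n R v)"
  by (rule growthI[OF borel_psi_slope psi_slope_bounded]) (use v in auto)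

lemma DERIV_psi:
  assumes r: "r > 0"
  shows "(psi n R v has_real_derivative r * psi_slope n R v r) (at r)"
proof -
  have nu: "real n / 2 > 0" using n by simp
  have "(psi n R v has_real_derivative 0 - 2 * r / (2 * v) + bessel_ratio (real n / 2) (R / v * r) * (R / v)) (at r)"
  proof -
    have "((\<lambda>r. log_bessel (real n / 2) (R / v * r)) has_real_derivative bessel_ratio (real n / 2) (R / v * r) * (R / v)) (at r)"
      by (rule DERIV_chain2[OF DERIV_log_bessel[OF nu] DERIV_cmult_Id])
    moreover have "((\<lambda>r. ln ((2 * pi * v) powr (- real n / 2)) - (r\<^sup>2 + R\<^sup>2) / (2 * v)) has_real_derivative 0 - 2 * r / (2 * v)) (at r)"
    proof -
      have "v \<noteq> 0" using v by simp
      then show ?thesis by (auto intro!: derivative_eq_intros)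
    qed
    ultimately show ?thesis
      unfolding psi_def[abs_def] by (intro DERIV_add)
  qed
  moreover have "0 - 2 * r / (2 * v) + bessel_ratio (real n / 2) (R / v * r) * (R / v) = r * psi_slope n R v r"
  proof -
    have "r * psi_slope n R v r = (r * (R / r)) * bessel_ratio (real n / 2) (R / v * r) / v - r / v"
      unfolding psi_slope_def using v by (simp add: diff_divide_distrib right_diff_distrib)
    then show ?thesis using r v by simp
  qed
  ultimately show ?thesis by simp
qed

lemma isCont_psi_slope:
  assumes r: "r > 0"
  shows "isCont (psi_slope n R v) r"
proof -
  have c: "isCont (\<lambda>r. R / v * r) r" by (intro continuous_intros)
  have "isCont (\<lambda>r. bessel_ratio (real n / 2) (R / v * r)) r"
    by (rule isCont_o2[OF c isCont_bessel_ratio]) (use n in simp)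
  then show ?thesis unfolding psi_slope_def[abs_def] using r by (intro continuous_intros) auto
qed

lemma exp_psi:
  "exp (psi n R v r) = (2 * pi * v) powr (- real n / 2) * exp (- (r\<^sup>2 + R\<^sup>2) / (2 * v)) * exp (log_bessel (real n / 2) (R / v * r))"
proof -
  define c where "c = (2 * pi * v) powr (- real n / 2)"
  have c: "c > 0" using v by (simp add: c_def)
  have "psi n R v r = ln c + (- (r\<^sup>2 + R\<^sup>2) / (2 * v)) + log_bessel (real n / 2) (R / v * r)"
    unfolding psi_def c_def[symmetric] by (simp only: diff_conv_add_uminus minus_divide_left)
  then show ?thesis by (simp only: exp_add exp_ln[OF c, unfolded c_def] c_def)
qed

text \<open>Almost every input has norm \<open>R\<close>, so the Gaussian exponent separates into a
  function of |y| and a scalar product; the latter averages to the moment generating function of the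
  sphere law.\<close>

lemma out_density_sphere:
  assumes y: "y \<in> space (Rn n)"
  shows "out_density n v (sphere_unif n R) y = exp (psi n R v (vnorm n y))"
proof -
  let ?C = "(2 * pi * v) powr (- real n / 2) * exp (- ((vnorm n y)\<^sup>2 + R\<^sup>2) / (2 * v))"
  interpret S: channel_input n R "sphere_unif n R" by (rule channel_input_sphere[OF n1 R])
  have "out_density n v (sphere_unif n R) y = (\<integral>x. ?C * exp (1 / v * dotp n y x) \<partial>sphere_unif n R)"
    unfolding out_density_def
  proof (rule integral_cong_AE)
    show "(\<lambda>x. gauss_density n v (\<lambda>i. y i - x i)) \<in> borel_measurable (sphere_unif n R)"
      using S.integrable_gauss_diff[OF v y] by (rule borel_measurable_integrable)
    show "AE x in sphere_unif n R. gauss_density n v (\<lambda>i. y i - x i) = ?C * exp (1 / v * dotp n y x)"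
      using AE_sphere[OF n1 R]
    proof eventually_elim
      case (elim x)
      have "(vnorm n (\<lambda>i. y i - x i))\<^sup>2 = (vnorm n y)\<^sup>2 - 2 * dotp n y x + (vnorm n x)\<^sup>2"
        unfolding vnorm_sq dotp_def
        by (simp add: power2_diff sum.distrib sum_subtractf sum_distrib_left algebra_simps)
      then have "- (vnorm n (\<lambda>i. y i - x i))\<^sup>2 / (2 * v) = - ((vnorm n y)\<^sup>2 + R\<^sup>2) / (2 * v) + 1 / v * dotp n y x"
        unfolding elim using v by (simp only:) (simp add: field_simps)
      then show ?case by (simp only: gauss_density_def exp_add mult.assoc)
    qed
  qed (use sphere_exp[OF n1 R, of "1 / v" y] in \<open>auto simp: has_bochner_integral_iff\<close>)
  also have "\<dots> = ?C * (bessel_ser (real n / 2) ((vnorm n y * R * (1 / v))\<^sup>2 / 4) / rGamma (real n / 2))"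
    using sphere_exp[OF n1 R, of "1 / v" y] by (simp add: has_bochner_integral_iff)
  also have "\<dots> = exp (psi n R v (vnorm n y))"
  proof -
    have e: "exp (log_bessel (real n / 2) (R / v * vnorm n y)) = bessel_ser (real n / 2) ((R / v * vnorm n y)\<^sup>2 / 4) / rGamma (real n / 2)"
    proof -
      have "bessel_ser (real n / 2) ((R / v * vnorm n y)\<^sup>2 / 4) > 0" using n by (intro bessel_ser_pos) auto
      then show ?thesis unfolding log_bessel_def using rGamma_pos[OF n1 R] by (simp add: exp_diff)
    qed
    have "(R / v * vnorm n y)\<^sup>2 / 4 = (vnorm n y * R * (1 / v))\<^sup>2 / 4" by (simp add: mult_ac)
    then show ?thesis
      unfolding exp_psi e by (simp only:)
  qed
  finally show ?thesis .
qed

lemma cross_entropy_at_sphere: "cross_entropy_at n v (sphere_unif n R) x = radial_mean n v (psi n R v) (vnorm n x)"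
proof -
  have "cross_entropy_at n v (sphere_unif n R) x = (\<integral>w. psi n R v (vnorm n (vadd n x w)) \<partial>gaussM n v)"
    unfolding cross_entropy_at_def by (simp add: out_density_sphere[OF vadd_space])
  also have "\<dots> = radial_mean n v (psi n R v) (vnorm n x)"
    by (rule gaussM_radial(2)[OF n1 v growth_psi])
  finally show ?thesis .
qed

text \<open>As \<open>log_bessel\<close> is nonnegative, passing from the Gaussian centred at the
  origin to the output density loses at most the factor exp (- R^2 / (2 v)). This is the domination
  with which the first-order condition is tested at the origin.\<close>

lemma gauss_le_out_density_sphere:
  assumes y: "y \<in> space (Rn n)"
  shows "gauss_density n v (\<lambda>i. y i - (\<lambda>i\<in>{..<n}. 0) i) \<le> exp (R\<^sup>2 / (2 * v)) * out_density n v (sphere_unif n R) y"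
proof -
  have e: "log_bessel (real n / 2) (R / v * vnorm n y) \<ge> 0"
    using n R v by (intro log_bessel_nonneg) auto
  have "gauss_density n v (\<lambda>i. y i - (\<lambda>i\<in>{..<n}. 0) i) = (2 * pi * v) powr (- real n / 2) * exp (- (vnorm n y)\<^sup>2 / (2 * v))"
    by (simp add: gauss_density_def vnorm_def)
  also have "\<dots> \<le> (2 * pi * v) powr (- real n / 2) * exp (R\<^sup>2 / (2 * v) + (- ((vnorm n y)\<^sup>2 + R\<^sup>2) / (2 * v) + log_bessel (real n / 2) (R / v * vnorm n y)))"
  proof (intro mult_left_mono)
    have "- ((vnorm n y)\<^sup>2 + R\<^sup>2) / (2 * v) = - (vnorm n y)\<^sup>2 / (2 * v) - R\<^sup>2 / (2 * v)"
      by (simp add: diff_divide_distrib)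
    then show "exp (- (vnorm n y)\<^sup>2 / (2 * v)) \<le> exp (R\<^sup>2 / (2 * v) + (- ((vnorm n y)\<^sup>2 + R\<^sup>2) / (2 * v) + log_bessel (real n / 2) (R / v * vnorm n y)))"
      unfolding exp_le_cancel_iff using e by linarith
  qed simp
  also have "\<dots> = exp (R\<^sup>2 / (2 * v)) * exp (psi n R v (vnorm n y))"
    unfolding exp_psi by (simp only: exp_add mult_ac)
  finally show ?thesis by (simp add: out_density_sphere[OF y])
qed

end

subsection \<open>The limit\<close>

definition axis :: "real \<Rightarrow> nat \<Rightarrow> real" where
  "axis y = (\<lambda>i. if i = 0 then y else 0)"

lemma vnorm_axis: "n \<ge> 1 \<Longrightarrow> y \<ge> 0 \<Longrightarrow> vnorm n (axis y) = y"
proof -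
  assume n: "n \<ge> 1" and y: "y \<ge> 0"
  have "(\<Sum>i<n. (axis y i)\<^sup>2) = (\<Sum>i\<in>{0}. (axis y i)\<^sup>2)"
    by (rule sum.mono_neutral_right) (use n in \<open>auto simp: axis_def\<close>)
  then show ?thesis using y by (simp add: vnorm_def axis_def)
qed

text \<open>The noise of variance \<open>v + u\<close> is a sum of two independent parts;
  integrating out the second part leaves a function of the norm alone.\<close>

lemma radial_mean_semigroup:
  assumes n: "n \<ge> 1" and v: "v > 0" and u: "u > 0" and f: "growth f" and Tf: "growth (radial_mean n u f)" and y: "y \<ge> 0"
  shows "radial_mean n (v + u) f y = radial_mean n v (radial_mean n u f) y"
proof -
  interpret V: prob_space "gaussM n v" by (rule prob_space_gaussM[OF v])
  interpret U: prob_space "gaussM n u" by (rule prob_space_gaussM[OF u])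
  interpret VU: pair_prob_space "gaussM n v" "gaussM n u" ..
  have vu: "v + u > 0" using v u by simp
  \<comment> \<open>Adding the zero vector restricts the axis point to the indices below
    \<open>n\<close>, which places it in the space of \<open>Rn n\<close> without changing its
    norm.\<close>
  let ?x = "vadd n (axis y) (\<lambda>_. 0)"
  let ?a = "\<lambda>p. vadd n (fst p) (snd p)"
  have x[measurable]: "?x \<in> space (Rn n)" by (rule vadd_space)
  have nx: "vnorm n ?x = y"
    using vnorm_axis[OF n y] by (simp add: vnorm_def vadd_def)
  have [measurable]: "f \<in> borel_measurable borel" using f by (rule growthD)
  note d = distr_gaussM_add[OF v u, symmetric]
  have m: "(\<lambda>c. f (vnorm n (vadd n ?x c))) \<in> borel_measurable (Rn n)" by measurable
  have i: "integrable (gaussM n v \<Otimes>\<^sub>M gaussM n u) (\<lambda>p. f (vnorm n (vadd n ?x (?a p))))"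
    using gaussM_radial(1)[OF n vu f, of ?x] unfolding d by (subst (asm) integrable_distr_eq) (use m in auto)
  have "radial_mean n (v + u) f y = (\<integral>c. f (vnorm n (vadd n ?x c)) \<partial>gaussM n (v + u))"
    using gaussM_radial(2)[OF n vu f, of ?x] by (simp add: nx)
  also have "\<dots> = (\<integral>p. f (vnorm n (vadd n ?x (?a p))) \<partial>(gaussM n v \<Otimes>\<^sub>M gaussM n u))"
    unfolding d by (rule integral_distr) (use m in auto)
  also have "\<dots> = (\<integral>a. (\<integral>b. f (vnorm n (vadd n (vadd n ?x a) b)) \<partial>gaussM n u) \<partial>gaussM n v)"
    using VU.integral_fst'[OF i] by (simp add: vadd_assoc)
  also have "\<dots> = (\<integral>a. radial_mean n u f (vnorm n (vadd n ?x a)) \<partial>gaussM n v)"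
    by (simp only: gaussM_radial(2)[OF n u f])
  also have "\<dots> = radial_mean n v (radial_mean n u f) y"
    using gaussM_radial(2)[OF n v Tf, of ?x] by (simp add: nx)
  finally show ?thesis .
qed

text \<open>Because \<open>G\<close> is positive beyond \<open>K\<close>, a positive value to the
  left of a negative one would produce the excluded pattern + - +. Thus the supremum of the set
  where \<open>G\<close> is negative separates the signs; for an empty set the threshold is
  0.\<close>

lemma sign_threshold:
  fixes G :: "real \<Rightarrow> real"
  assumes s: "at_most_one_sign_change G" and K: "\<And>y. y > K \<Longrightarrow> G y > 0"
  shows "\<exists>z\<ge>0. (\<forall>r. 0 < r \<and> r < z \<longrightarrow> G r \<le> 0) \<and> (\<forall>r>z. G r \<ge> 0)"
proof (cases "\<exists>y>0. G y < 0")
  case False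
  then have "G r \<ge> 0" if "r > 0" for r using that by (meson not_less)
  then show ?thesis by (intro exI[of _ 0]) auto
next
  case True
  define N where "N = {y. y > 0 \<and> G y < 0}"
  have ne: "N \<noteq> {}" using True by (auto simp: N_def)
  have bd: "bdd_above N"
    by (rule bdd_aboveI[of _ K]) (use K in \<open>force simp: N_def not_less[symmetric]\<close>)
  show ?thesis
  proof (intro exI[of _ "Sup N"] conjI allI impI)
    obtain y where y: "y \<in> N" using ne by blast
    then show "0 \<le> Sup N" using cSup_upper[OF y bd] by (simp add: N_def)
  next
    fix r assume r: "0 < r \<and> r < Sup N"
    then obtain b where b: "b \<in> N" "r < b" using less_cSup_iff[OF ne bd] by blast
    \<comment> \<open>A point beyond both b and K, supplying the last positive value of the excluded
      pattern.\<close>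
    define c where "c = max b K + 1"
    have c: "b < c" "G c > 0" using K[of c] by (auto simp: c_def)
    show "G r \<le> 0"
    proof (rule ccontr)
      assume "\<not> G r \<le> 0"
      then have "0 < r \<and> r < b \<and> b < c \<and> (G r > 0 \<and> G b < 0 \<and> G c > 0)"
        using r b c by (auto simp: N_def)
      then show False using s unfolding at_most_one_sign_change_def by blast
    qed
  next
    fix r assume r: "Sup N < r"
    obtain y where y: "y \<in> N" using ne by blast
    have "0 < r" using cSup_upper[OF y bd] r y by (simp add: N_def)
    then show "0 \<le> G r" using cSup_upper[OF _ bd, of r] r by (force simp: N_def not_less[symmetric])
  qed
qed

section \<open>The first-order function along a ray and the optimality criterion\<close>

definition xi_radial :: "nat \<Rightarrow> real \<Rightarrow> real \<Rightarrow> real \<Rightarrow> real \<Rightarrow> real" where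
  "xi_radial n R v1 v2 r = radial_mean n v2 (psi n R v2) r - radial_mean n v1 (psi n R v1) r"

context
  fixes n :: nat and R v1 v2 :: real
  assumes n: "n > 2" and R: "R > 0" and v: "0 < v1" "v1 < v2"
begin

text \<open>The inner function left when the noise of variance \<open>v1\<close>, common to both
  receivers, is taken out: \<open>xi_radial\<close> is its mean at variance
  \<open>v1\<close>.\<close>

definition Phi :: "real \<Rightarrow> real" where
  "Phi r = radial_mean n (v2 - v1) (psi n R v2) r - psi n R v1 r"

definition Phi_slope :: "real \<Rightarrow> real" where
  "Phi_slope r = radial_mean (n + 2) (v2 - v1) (psi_slope n R v2) r - psi_slope n R v1 r"

lemma dim_ge_1: "n \<ge> 1" and dim2_ge_1: "n + 2 \<ge> 1" and v2: "v2 > 0" and u: "v2 - v1 > 0"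
  using n v by auto

lemma growth_T_psi: "growth (radial_mean n (v2 - v1) (psi n R v2))"
proof -
  obtain A B where "A \<ge> 0" "B \<ge> 0" "\<forall>r\<ge>0. \<bar>psi n R v2 r\<bar> \<le> A + B * r\<^sup>2" using psi_bound[OF n R v2] by blast
  then show ?thesis by (intro growth_radial_mean[OF dim_ge_1 u borel_psi[OF n R v2], of A B]) auto
qed

lemma growth_Phi: "growth Phi"
  unfolding Phi_def[abs_def] by (intro growth_diff growth_T_psi growth_psi n R v)

lemma growth_Phi_slope: "growth Phi_slope"
  unfolding Phi_slope_def[abs_def]
proof (intro growth_diff growth_psi_slope n R v)
  show "growth (radial_mean (n + 2) (v2 - v1) (psi_slope n R v2))"
    by (rule growth_radial_mean[OF dim2_ge_1 u borel_psi_slope[OF n R v2] psi_slope_bounded[OF n R v2]]) (use v2 in auto)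
qed

lemma xi_radial_Phi:
  assumes y: "y \<ge> 0"
  shows "xi_radial n R v1 v2 y = radial_mean n v1 Phi y"
proof -
  have "radial_mean n v2 (psi n R v2) y = radial_mean n v1 (radial_mean n (v2 - v1) (psi n R v2)) y"
    using radial_mean_semigroup[OF dim_ge_1 v(1) u growth_psi[OF n R v2] growth_T_psi y] by simp
  then show ?thesis
    unfolding xi_radial_def Phi_def[abs_def]
    by (simp only: radial_mean_diff[OF dim_ge_1 v(1) growth_T_psi growth_psi[OF n R v(1)]])
qed

lemma DERIV_Phi:
  assumes r: "r > 0"
  shows "(Phi has_real_derivative r * Phi_slope r) (at r)"
proof -
  have "(Phi has_real_derivative r * radial_mean (n + 2) (v2 - v1) (psi_slope n R v2) r - r * psi_slope n R v1 r) (at r)"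
    unfolding Phi_def[abs_def]
    by (intro DERIV_diff DERIV_radial_mean DERIV_psi isCont_psi_slope growth_psi growth_psi_slope dim_ge_1 u n R v v2 r)
  then show ?thesis by (simp add: Phi_slope_def right_diff_distrib)
qed

lemma isCont_Phi_slope: "r > 0 \<Longrightarrow> isCont Phi_slope r"
  unfolding Phi_slope_def[abs_def]
  by (intro isCont_diff isCont_radial_mean isCont_psi_slope growth_psi_slope dim2_ge_1 u n R v v2)

text \<open>The first term is at least -1/v2, while the slope at \<open>v1\<close> is at most (R / y
  - 1) / v1. The threshold is the radius at which (R / y) / v1 equals 1/v1 - 1/v2.\<close>

lemma Phi_slope_pos:
  assumes y: "y > R / (v1 * (1 / v1 - 1 / v2))"
  shows "Phi_slope y > 0"
proof -
  have d: "1 / v1 - 1 / v2 > 0" using v by (simp add: frac_less2)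
  have "R / (v1 * (1 / v1 - 1 / v2)) > 0" using R v d by (intro divide_pos_pos mult_pos_pos) auto
  then have y0: "y > 0" using y by linarith
  have "- (1 / v2) = radial_mean (n + 2) (v2 - v1) (\<lambda>_. - (1 / v2)) y" by (rule radial_mean_const[OF dim2_ge_1 u, symmetric])
  also have "\<dots> \<le> radial_mean (n + 2) (v2 - v1) (psi_slope n R v2) y"
    by (rule radial_mean_mono[OF dim2_ge_1 u growth_const growth_psi_slope[OF n R v2]]) (use psi_slope_ge[OF n R v2] in auto)
  finally have 1: "- (1 / v2) \<le> radial_mean (n + 2) (v2 - v1) (psi_slope n R v2) y" .
  have 2: "psi_slope n R v1 y \<le> 1 / v1 * (R / y - 1)" by (rule psi_slope_le[OF n R v(1) y0])
  have "R < y * (v1 * (1 / v1 - 1 / v2))"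
    using y d v by (subst (asm) pos_divide_less_eq) auto
  then have "R / y < v1 * (1 / v1 - 1 / v2)"
    using y0 by (simp add: pos_divide_less_eq mult.commute)
  then have "1 / v1 * (R / y) < 1 / v1 * (v1 * (1 / v1 - 1 / v2))"
    using v by (intro mult_strict_left_mono) auto
  also have "\<dots> = 1 / v1 - 1 / v2" using v by simp
  finally have "1 / v1 * (R / y - 1) < - (1 / v2)" by (simp add: right_diff_distrib)
  then show ?thesis using 1 2 unfolding Phi_slope_def by linarith
qed

lemma assumptionA_fun_Phi_slope:
  assumes y: "y > 0"
  shows "assumptionA_fun R v1 v2 n y = Phi_slope y"
proof -
  \<comment> \<open>At r = 0 division by zero makes both sides equal to -1, so the identity holds
    for all radii and the integrands can be rewritten pointwise.\<close>
  have eq: "R / r * besselh (real n / 2) (R / w * r) - 1 = w * psi_slope n R w r" if "r \<ge> 0" "w > 0" for r w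
    using that R n by (cases "r = 0") (simp_all add: psi_slope_def besselh_eq_bessel_ratio)
  have "(\<integral>w. (let r = vnorm (n + 2) (\<lambda>i. (if i = 0 then y else 0) + w i) in R / r * besselh (real n / 2) (R / v2 * r) - 1) \<partial>gaussM (n + 2) (v2 - v1))
     = (\<integral>w. v2 * psi_slope n R v2 (vnorm (n + 2) (vadd (n + 2) (axis y) w)) \<partial>gaussM (n + 2) (v2 - v1))"
  proof (rule Bochner_Integration.integral_cong)
    fix w
    have "vnorm (n + 2) (\<lambda>i. (if i = 0 then y else 0) + w i) = vnorm (n + 2) (vadd (n + 2) (axis y) w)"
      by (simp add: vnorm_def vadd_def axis_def)
    then show "(let r = vnorm (n + 2) (\<lambda>i. (if i = 0 then y else 0) + w i) in R / r * besselh (real n / 2) (R / v2 * r) - 1)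
      = v2 * psi_slope n R v2 (vnorm (n + 2) (vadd (n + 2) (axis y) w))"
      unfolding Let_def by (simp only: eq[OF vnorm_nonneg v2])
  qed simp
  also have "\<dots> = v2 * radial_mean (n + 2) (v2 - v1) (psi_slope n R v2) y"
    using gaussM_radial(2)[OF dim2_ge_1 u growth_psi_slope[OF n R v2], of "axis y"] vnorm_axis[OF dim2_ge_1, of y] y by simp
  finally have "gauss_expect (n + 2) (v2 - v1)
      (\<lambda>w. let r = vnorm (n + 2) (\<lambda>i. (if i = 0 then y else 0) + w i) in R / r * besselh (real n / 2) (R / v2 * r) - 1)
    = v2 * radial_mean (n + 2) (v2 - v1) (psi_slope n R v2) y"
    using u by (simp only: gauss_expect_def) simp
  then show ?thesis
    unfolding assumptionA_fun_def Phi_slope_def using eq[of y v1] y v v2 by simp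
qed

lemma xi_radial_le_max:
  assumes A: "assumptionA" and r: "0 \<le> r" "r \<le> R"
  shows "xi_radial n R v1 v2 r \<le> max (xi_radial n R v1 v2 0) (xi_radial n R v1 v2 R)"
proof -
  have one: "at_most_one_sign_change (assumptionA_fun R v1 v2 n)"
    using A R v n unfolding assumptionA_def by auto
  have "at_most_one_sign_change Phi_slope"
    unfolding at_most_one_sign_change_def
  proof (rule notI, elim exE)
    fix a b c
    assume abc: "0 < a \<and> a < b \<and> b < c \<and> (Phi_slope a > 0 \<and> Phi_slope b < 0 \<and> Phi_slope c > 0 \<or> Phi_slope a < 0 \<and> Phi_slope b > 0 \<and> Phi_slope c < 0)"
    then have "assumptionA_fun R v1 v2 n a = Phi_slope a" "assumptionA_fun R v1 v2 n b = Phi_slope b" "assumptionA_fun R v1 v2 n c = Phi_slope c"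
      using assumptionA_fun_Phi_slope[of a] assumptionA_fun_Phi_slope[of b] assumptionA_fun_Phi_slope[of c] by linarith+
    then show False using one abc unfolding at_most_one_sign_change_def by metis
  qed
  from sign_threshold[OF this Phi_slope_pos]
  obtain z where z: "z \<ge> 0" "\<And>r. 0 < r \<Longrightarrow> r < z \<Longrightarrow> Phi_slope r \<le> 0" "\<And>r. r > z \<Longrightarrow> Phi_slope r \<ge> 0" by blast
  have "radial_mean n v1 Phi r \<le> max (radial_mean n v1 Phi 0) (radial_mean n v1 Phi R)"
  proof (rule max_at_endpoints[OF _ _ r])
    show "(radial_mean n v1 Phi has_real_derivative y * radial_mean (n + 2) v1 Phi_slope y) (at y)" for y
      by (intro DERIV_radial_mean dim_ge_1 v growth_Phi growth_Phi_slope DERIV_Phi isCont_Phi_slope)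
    show "radial_mean (n + 2) v1 Phi_slope y2 \<ge> 0" if "0 < y1" "y1 < y2" "radial_mean (n + 2) v1 Phi_slope y1 \<ge> 0" for y1 y2
      by (rule radial_mean_sign[OF dim2_ge_1 v(1) growth_Phi_slope z that])
  qed
  then show ?thesis using r R by (simp add: xi_radial_Phi)
qed

lemma xi_sphere: "xi n v1 v2 (sphere_unif n R) x = xi_radial n R v1 v2 (vnorm n x)"
  unfolding xi_def xi_radial_def by (simp add: cross_entropy_at_sphere n R v v2)

lemma integral_xi_sphere: "(\<integral>x. xi n v1 v2 (sphere_unif n R) x \<partial>sphere_unif n R) = xi_radial n R v1 v2 R"
proof -
  interpret S: channel_input n R "sphere_unif n R" by (rule channel_input_sphere[OF dim_ge_1 R])
  have i: "integrable (sphere_unif n R) (xi n v1 v2 (sphere_unif n R))"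
    by (rule two_inputs.integral_xi(2)[OF two_inputs_refl[OF S.channel_input_axioms] v(1) v2])
  have "(\<integral>x. xi n v1 v2 (sphere_unif n R) x \<partial>sphere_unif n R) = (\<integral>x. xi_radial n R v1 v2 R \<partial>sphere_unif n R)"
  proof (rule integral_cong_AE)
    show "AE x in sphere_unif n R. xi n v1 v2 (sphere_unif n R) x = xi_radial n R v1 v2 R"
      using AE_sphere[OF dim_ge_1 R] by eventually_elim (simp add: xi_sphere)
  qed (use i in auto)
  also have "\<dots> = xi_radial n R v1 v2 R" by (simp add: S.P.prob_space)
  finally show ?thesis .
qed

text \<open>The mean of \<open>xi\<close> under the sphere law is its value at radius
  \<open>R\<close>, so the endpoint inequality together with \<open>xi_radial_le_max\<close> gives
  the first-order condition on the whole ball.\<close>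

lemma attainsI:
  assumes A: "assumptionA" and le: "xi_radial n R v1 v2 0 \<le> xi_radial n R v1 v2 R"
  shows "attains n v1 v2 R"
  unfolding attains_def
proof (intro conjI allI impI)
  interpret S: channel_input n R "sphere_unif n R" by (rule channel_input_sphere[OF dim_ge_1 R])
  show "admissible n R (sphere_unif n R)" by (rule S.adm)
  fix P assume P: "admissible n R P"
  interpret P: channel_input n R P using n R P by unfold_locales auto
  interpret PS: two_inputs n R P "sphere_unif n R" ..
  show "secrecy_rate n v1 v2 P \<le> secrecy_rate n v1 v2 (sphere_unif n R)"
  proof (rule PS.kkt_sufficient[OF v])
    fix x assume "vnorm n x \<le> R"
    then have "xi_radial n R v1 v2 (vnorm n x) \<le> max (xi_radial n R v1 v2 0) (xi_radial n R v1 v2 R)"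
      by (intro xi_radial_le_max[OF A]) auto
    then show "xi n v1 v2 (sphere_unif n R) x \<le> (\<integral>x. xi n v1 v2 (sphere_unif n R) x \<partial>sphere_unif n R)"
      unfolding integral_xi_sphere unfolding xi_sphere using le by simp
  qed
qed

lemma attainsD:
  assumes a: "attains n v1 v2 R"
  shows "xi_radial n R v1 v2 0 \<le> xi_radial n R v1 v2 R"
proof -
  interpret S: channel_input n R "sphere_unif n R" by (rule channel_input_sphere[OF dim_ge_1 R])
  let ?z = "\<lambda>i\<in>{..<n}. 0 :: real"
  have z: "vnorm n ?z = 0" by (simp add: vnorm_def)
  have "xi n v1 v2 (sphere_unif n R) ?z \<le> (\<integral>x. xi n v1 v2 (sphere_unif n R) x \<partial>sphere_unif n R)"
  proof (rule S.kkt_necessary[OF v])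
    show "secrecy_rate n v1 v2 P \<le> secrecy_rate n v1 v2 (sphere_unif n R)" if "admissible n R P" for P
      using a that by (simp add: attains_def)
    show "?z \<in> space (Rn n)" by (simp add: space_Rn)
    show "vnorm n ?z \<le> R" using R z by simp
    show "gauss_density n v1 (\<lambda>i. y i - ?z i) \<le> exp (R\<^sup>2 / (2 * v1)) * out_density n v1 (sphere_unif n R) y" if "y \<in> space (Rn n)" for y
      by (rule gauss_le_out_density_sphere[OF n R v(1) that])
  qed
  then show ?thesis unfolding integral_xi_sphere unfolding xi_sphere z .
qed

end

section \<open>Endpoint values in high dimension\<close>

definition beta_lim :: "real \<Rightarrow> real" where
  "beta_lim x = x / 2 - ln (1 + x) / 2 - kappa_lim (sqrt x)"

definition endpoint_gain :: "nat \<Rightarrow> real \<Rightarrow> real \<Rightarrow> real" where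
  "endpoint_gain n R v = radial_mean n v (psi n R v) R - radial_mean n v (psi n R v) 0"

lemma xi_radial_endpoint_gain: "xi_radial n R v1 v2 R - xi_radial n R v1 v2 0 = endpoint_gain n R v2 - endpoint_gain n R v1"
  by (simp add: xi_radial_def endpoint_gain_def)

text \<open>The radicand 1 + 4 x (x + 1) is the square of 2 x + 1. The contribution of the sphere is
  thus elementary, and \<open>beta_lim\<close> contains \<open>kappa_lim\<close> only for the
  centre.\<close>

lemma kappa_lim_sqrt_prod:
  assumes "x \<ge> 0"
  shows "kappa_lim (sqrt (x * (x + 1))) = x - ln (1 + x) / 2"
proof -
  have "1 + 4 * (sqrt (x * (x + 1)))\<^sup>2 = (2 * x + 1)\<^sup>2"
    using assms by (simp add: power2_eq_square algebra_simps)
  then have "sqrt (1 + 4 * (sqrt (x * (x + 1)))\<^sup>2) = 2 * x + 1"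
    using assms by simp
  then show ?thesis by (simp add: kappa_lim_def add_divide_distrib)
qed

text \<open>The quadratic terms of \<open>psi\<close> have exact means, and of their difference only
  - R^2 / (2 v) survives, which is - x / 2 per dimension. The Bessel term concentrates at the radii
  sqrt (R^2 + n v) and sqrt (n v), and \<open>log_bessel_kappa_lim\<close> evaluates it
  there.\<close>

lemma endpoint_gain_asymp:
  assumes n: "n > 2" and R: "R > 0" and v: "v > 0"
  defines "x \<equiv> R\<^sup>2 / (real n * v)"
  shows "\<bar>endpoint_gain n R v / real n - beta_lim x\<bar> \<le> 8 / sqrt (real n) * (sqrt x + x)"
proof -
  have n1: "n \<ge> 1" using n by simp
  have x: "x > 0" unfolding x_def using n R v by simp
  have nu: "real n / 2 > 1" using n by simp
  define L where "L = (\<lambda>r. log_bessel (real n / 2) (R / v * r))"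
  have gL: "growth L" unfolding L_def by (rule growth_log_bessel[OF n R v])
  have lip: "\<bar>L r - L s\<bar> \<le> R / v * \<bar>r - s\<bar>" if "r \<ge> 0" "s \<ge> 0" for r s
  proof -
    have "\<bar>L r - L s\<bar> \<le> \<bar>R / v * r - R / v * s\<bar>"
      unfolding L_def using that R v by (intro log_bessel_lipschitz nu) auto
    also have "\<dots> = R / v * \<bar>r - s\<bar>"
      using R v by (simp only: right_diff_distrib[symmetric] abs_mult) simp
    finally show ?thesis .
  qed
  have Tpsi: "radial_mean n v (psi n R v) y = ln ((2 * pi * v) powr (- real n / 2)) - R\<^sup>2 / (2 * v) - 1 / (2 * v) * (y\<^sup>2 + real n * v) + radial_mean n v L y" for y
  proof -
    have "psi n R v = (\<lambda>r. (ln ((2 * pi * v) powr (- real n / 2)) - R\<^sup>2 / (2 * v) - 1 / (2 * v) * r\<^sup>2) + L r)"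
      by (rule ext) (simp add: psi_def L_def add_divide_distrib)
    then show ?thesis
      by (simp only: radial_mean_add[OF n1 v growth_diff[OF growth_const growth_cmult[OF growth_sq]] gL]
        radial_mean_diff[OF n1 v growth_const growth_cmult[OF growth_sq]] radial_mean_cmult[OF n1 v growth_sq]
        radial_mean_const[OF n1 v] radial_mean_sq[OF n1 v])
  qed
  have B: "endpoint_gain n R v = - (R\<^sup>2 / (2 * v)) + (radial_mean n v L R - radial_mean n v L 0)"
    unfolding endpoint_gain_def Tpsi by (simp add: algebra_simps add_divide_distrib)
  have Rv: "R / v \<ge> 0" using R v by simp
  have c1: "\<bar>radial_mean n v L R - L (sqrt (R\<^sup>2 + real n * v))\<bar> \<le> R / v * (2 * sqrt v)"
    by (rule radial_mean_concentration[OF n1 v gL _ Rv lip]) (use R in auto)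
  have c2: "\<bar>radial_mean n v L 0 - L (sqrt (0\<^sup>2 + real n * v))\<bar> \<le> R / v * (2 * sqrt v)"
    by (rule radial_mean_concentration[OF n1 v gL _ Rv lip]) auto
  \<comment> \<open>The Bessel arguments at the two concentration radii, divided by n, are t1 for
    the sphere and t2 for the centre.\<close>
  define t1 where "t1 = sqrt (x * (x + 1))"
  define t2 where "t2 = sqrt x"
  have t: "t1 \<ge> 0" "t2 \<ge> 0" using x by (auto simp: t1_def t2_def)
  have a1: "R / v * sqrt (R\<^sup>2 + real n * v) = real n * t1"
  proof (rule power2_eq_imp_eq)
    have "(real n * t1)\<^sup>2 = (real n)\<^sup>2 * (x * (x + 1))"
      unfolding t1_def power_mult_distrib using x by simp
    also have "\<dots> = (R / v)\<^sup>2 * (R\<^sup>2 + real n * v)"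
      unfolding x_def using n v by (simp add: power2_eq_square divide_simps)
    finally show "(R / v * sqrt (R\<^sup>2 + real n * v))\<^sup>2 = (real n * t1)\<^sup>2"
      unfolding power_mult_distrib using v by simp
    show "0 \<le> R / v * sqrt (R\<^sup>2 + real n * v)" by (intro mult_nonneg_nonneg Rv) (use v in simp)
  qed (use t in simp)
  have a2: "R / v * sqrt (0\<^sup>2 + real n * v) = real n * t2"
  proof (rule power2_eq_imp_eq)
    have "(real n * t2)\<^sup>2 = (real n)\<^sup>2 * x"
      unfolding t2_def power_mult_distrib using x by simp
    also have "\<dots> = (R / v)\<^sup>2 * (0\<^sup>2 + real n * v)"
      unfolding x_def using n v by (simp add: power2_eq_square divide_simps)
    finally show "(R / v * sqrt (0\<^sup>2 + real n * v))\<^sup>2 = (real n * t2)\<^sup>2"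
      unfolding power_mult_distrib using v by simp
    show "0 \<le> R / v * sqrt (0\<^sup>2 + real n * v)" by (intro mult_nonneg_nonneg Rv) (use v in simp)
  qed (use t in simp)
  have L1: "L (sqrt (R\<^sup>2 + real n * v)) = log_bessel (real n / 2) (real n * t1)"
    unfolding L_def a1 ..
  have L2: "L (sqrt (0\<^sup>2 + real n * v)) = log_bessel (real n / 2) (real n * t2)"
    unfolding L_def a2 ..
  have k1: "\<bar>log_bessel (real n / 2) (real n * t1) / real n - kappa_lim t1\<bar> \<le> 2 / real n * t1"
    by (rule log_bessel_kappa_lim) (use n t in auto)
  have k2: "\<bar>log_bessel (real n / 2) (real n * t2) / real n - kappa_lim t2\<bar> \<le> 2 / real n * t2"
    by (rule log_bessel_kappa_lim) (use n t in auto)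
  have sq: "sqrt (real n) > 0" using n by simp
  \<comment> \<open>The concentration error per dimension: the Lipschitz constant R / v times the
    deviation 2 sqrt v, divided by n.\<close>
  have Rx: "R / v * (2 * sqrt v) / real n = 2 / sqrt (real n) * t2"
  proof -
    have "R = sqrt (real n) * sqrt v * t2"
      unfolding t2_def x_def using R n v by (simp add: real_sqrt_divide real_sqrt_mult)
    then have "R / v * (2 * sqrt v) / real n = (sqrt (real n) * sqrt v * t2) / v * (2 * sqrt v) / real n" by simp
    also have "\<dots> = 2 * t2 * (sqrt v * sqrt v / v) * (sqrt (real n) / real n)" by simp
    also have "sqrt v * sqrt v / v = 1" using v by simp
    also have "sqrt (real n) / real n = 1 / sqrt (real n)" using n by (simp add: real_div_sqrt field_simps)
    finally show ?thesis by simp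
  qed
  have d1: "\<bar>radial_mean n v L R / real n - kappa_lim t1\<bar> \<le> 2 / sqrt (real n) * t2 + 2 / real n * t1"
  proof -
    have "\<bar>radial_mean n v L R / real n - log_bessel (real n / 2) (real n * t1) / real n\<bar> \<le> R / v * (2 * sqrt v) / real n"
    proof -
      have "\<bar>radial_mean n v L R - log_bessel (real n / 2) (real n * t1)\<bar> / real n \<le> R / v * (2 * sqrt v) / real n"
        using c1 unfolding L1 by (rule divide_right_mono) simp
      then show ?thesis by (simp only: diff_divide_distrib[symmetric] abs_divide abs_of_nat)
    qed
    then show ?thesis using k1 unfolding Rx by linarith
  qed
  have d2: "\<bar>radial_mean n v L 0 / real n - kappa_lim t2\<bar> \<le> 2 / sqrt (real n) * t2 + 2 / real n * t2"
  proof -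
    have "\<bar>radial_mean n v L 0 / real n - log_bessel (real n / 2) (real n * t2) / real n\<bar> \<le> R / v * (2 * sqrt v) / real n"
    proof -
      have "\<bar>radial_mean n v L 0 - log_bessel (real n / 2) (real n * t2)\<bar> / real n \<le> R / v * (2 * sqrt v) / real n"
        using c2 unfolding L2 by (rule divide_right_mono) simp
      then show ?thesis by (simp only: diff_divide_distrib[symmetric] abs_divide abs_of_nat)
    qed
    then show ?thesis using k2 unfolding Rx by linarith
  qed
  have bx: "beta_lim x = - (x / 2) + kappa_lim t1 - kappa_lim t2"
    unfolding beta_lim_def t1_def t2_def kappa_lim_sqrt_prod[OF less_imp_le[OF x]] by simp
  have Bn: "endpoint_gain n R v / real n = - (x / 2) + radial_mean n v L R / real n - radial_mean n v L 0 / real n"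
    unfolding B x_def by (simp add: add_divide_distrib diff_divide_distrib mult.commute)
  \<comment> \<open>Two concentration errors give 4 t2 and the two Bessel errors 2 (t1 + t2). With
    1/n at most 1 / sqrt n and t1 at most x + t2, the total is 8 t2 + 2 x over sqrt n, whence the
    constant 8.\<close>
  have "\<bar>endpoint_gain n R v / real n - beta_lim x\<bar> \<le> 4 / sqrt (real n) * t2 + 2 / real n * (t1 + t2)"
    unfolding bx Bn using d1 d2 by (simp add: distrib_left)
  also have "\<dots> \<le> 4 / sqrt (real n) * t2 + 2 / sqrt (real n) * ((x + t2) + t2)"
  proof (intro add_mono mult_mono order_refl)
    have "sqrt (real n) \<le> real n" by (rule real_le_lsqrt) (use n in \<open>auto simp: power2_eq_square\<close>)
    then show "2 / real n \<le> 2 / sqrt (real n)" using sq by (intro divide_left_mono) auto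
    show "t1 \<le> x + t2"
      unfolding t1_def
    proof (rule real_le_lsqrt)
      have "t2\<^sup>2 = x" using x by (simp add: t2_def)
      then show "x * (x + 1) \<le> (x + t2)\<^sup>2"
        using x t by (simp add: power2_eq_square algebra_simps)
    qed (use x t in auto)
  qed (use x t sq in auto)
  also have "\<dots> = 1 / sqrt (real n) * (8 * t2 + 2 * x)" by (simp add: divide_inverse algebra_simps)
  also have "\<dots> \<le> 1 / sqrt (real n) * (8 * (t2 + x))"
    using x by (intro mult_left_mono) auto
  finally show ?thesis by (simp add: t2_def)
qed

section \<open>The limiting equation for c\<close>

definition beta_deriv :: "real \<Rightarrow> real" where
  "beta_deriv x = x / (x + 1) / 2 - 1 / (1 + sqrt (1 + 4 * x))"

lemma DERIV_beta_lim:
  assumes x: "x > 0"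
  shows "(beta_lim has_real_derivative beta_deriv x) (at x)"
proof -
  have s: "sqrt x > 0" using x by simp
  have "((\<lambda>x. kappa_lim (sqrt x)) has_real_derivative (2 * sqrt x / (1 + sqrt (1 + 4 * (sqrt x)\<^sup>2))) * (inverse (sqrt x) / 2)) (at x)"
    by (rule DERIV_chain2[OF DERIV_kappa_lim DERIV_real_sqrt[OF x]])
  moreover have "(2 * sqrt x / (1 + sqrt (1 + 4 * (sqrt x)\<^sup>2))) * (inverse (sqrt x) / 2) = 1 / (1 + sqrt (1 + 4 * x))"
    using s x by (simp add: field_simps)
  ultimately have k: "((\<lambda>x. kappa_lim (sqrt x)) has_real_derivative 1 / (1 + sqrt (1 + 4 * x))) (at x)" by simp
  have "((\<lambda>x. x / 2 - ln (1 + x) / 2) has_real_derivative 1 / 2 - 1 / (1 + x) / 2) (at x)"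
  proof -
    have "((\<lambda>x. ln (1 + x)) has_real_derivative 1 / (1 + x)) (at x)"
      using x by (auto intro!: derivative_eq_intros)
    from DERIV_diff[OF DERIV_cdivide[OF DERIV_ident, of 2] DERIV_cdivide[OF this, of 2]] show ?thesis .
  qed
  from DERIV_diff[OF this k] have "(beta_lim has_real_derivative 1 / 2 - 1 / (1 + x) / 2 - 1 / (1 + sqrt (1 + 4 * x))) (at x)"
    unfolding beta_lim_def[abs_def] .
  moreover have "1 / 2 - 1 / (1 + x) / 2 = x / (x + 1) / 2"
  proof -
    have "1 / 2 - 1 / (1 + x) / 2 = (1 - 1 / (1 + x)) / 2" by (rule diff_divide_distrib[symmetric])
    also have "1 - 1 / (1 + x) = x / (x + 1)" using x by (simp add: field_simps)
    finally show ?thesis .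
  qed
  ultimately show ?thesis by (simp add: beta_deriv_def)
qed

text \<open>Strict convexity of \<open>beta_lim\<close> on the positive axis, the source of the
  uniqueness of the root.\<close>

lemma beta_deriv_strict_mono:
  assumes "0 < x" "x < y"
  shows "beta_deriv x < beta_deriv y"
proof -
  have "x / (x + 1) < y / (y + 1)" using assms by (simp add: field_simps)
  moreover have "1 / (1 + sqrt (1 + 4 * y)) \<le> 1 / (1 + sqrt (1 + 4 * x))"
    using assms by (intro divide_left_mono) (auto intro!: add_pos_nonneg mult_pos_pos)
  moreover have "p / 2 - s < q / 2 - r" if "p < q" "r \<le> s" for p q r s :: real
    using that by simp
  ultimately show ?thesis unfolding beta_deriv_def by blast
qed

text \<open>The points 1/2 and 2 are convenient arguments with opposite signs of
  \<open>beta_deriv\<close>; they supply the bracket in \<open>cfun_root\<close>.\<close>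

lemma beta_deriv_half: "beta_deriv (1 / 2) < 0"
proof -
  have "sqrt 3 < 2" by (rule real_less_lsqrt) auto
  then have "1 / 3 < 1 / (1 + sqrt 3)" by (intro divide_strict_left_mono) (auto intro!: add_pos_nonneg)
  then show ?thesis by (simp add: beta_deriv_def)
qed

lemma beta_deriv_two: "beta_deriv 2 > 0"
proof -
  have "sqrt 9 = (3::real)" by (rule real_sqrt_unique) auto
  then show ?thesis by (simp add: beta_deriv_def)
qed

text \<open>A primitive in \<open>s\<close>: the derivative of c^2 / s is - c^2 / s^2, and the
  prefactor - 2 / c^2 removes the constant and the sign.\<close>

definition cfun_primitive :: "real \<Rightarrow> real \<Rightarrow> real" where
  "cfun_primitive c s = - (2 / c\<^sup>2) * beta_lim (c\<^sup>2 / s)"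

lemma DERIV_cfun_primitive:
  assumes c: "c > 0" and s: "s > 0"
  shows "(cfun_primitive c has_real_derivative 2 * beta_deriv (c\<^sup>2 / s) / s\<^sup>2) (at s)"
proof -
  have x: "c\<^sup>2 / s > 0" using c s by simp
  have "((\<lambda>s. c\<^sup>2 / s) has_real_derivative - (c\<^sup>2 / s\<^sup>2)) (at s)"
    using s by (auto intro!: derivative_eq_intros simp: power2_eq_square)
  from DERIV_cmult[OF DERIV_chain2[OF DERIV_beta_lim[OF x] this], of "- (2 / c\<^sup>2)"]
  have "(cfun_primitive c has_real_derivative - (2 / c\<^sup>2) * (beta_deriv (c\<^sup>2 / s) * - (c\<^sup>2 / s\<^sup>2))) (at s)"
    unfolding cfun_primitive_def[abs_def] .
  moreover have "- (2 / c\<^sup>2) * (beta_deriv (c\<^sup>2 / s) * - (c\<^sup>2 / s\<^sup>2)) = 2 * beta_deriv (c\<^sup>2 / s) / s\<^sup>2"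
    using c by simp
  ultimately show ?thesis by (simp only:)
qed

text \<open>With x = c^2 / s and w = sqrt (1 + 4 x), the first denominator is s (1 + w)^2 / 4 and 4
  x factors as (w - 1) (w + 1). The second radicand is the square of c^2 + s / 2, so that fraction
  collapses to x / (x + 1).\<close>

lemma cfun_integrand:
  assumes c: "c > 0" and s: "s > 0"
  shows "c\<^sup>2 / (sqrt s / 2 + sqrt (s / 4 + c\<^sup>2))\<^sup>2
       + c\<^sup>2 * (c\<^sup>2 + s) / (s / 2 + sqrt (s\<^sup>2 / 4 + c\<^sup>2 * (c\<^sup>2 + s)))\<^sup>2 - 1 = 2 * beta_deriv (c\<^sup>2 / s)"
proof -
  define x where "x = c\<^sup>2 / s"
  have x: "x > 0" using c s by (simp add: x_def)
  have cx: "c\<^sup>2 = s * x" using s by (simp add: x_def)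
  define w where "w = sqrt (1 + 4 * x)"
  have w: "w > 1" "w\<^sup>2 = 1 + 4 * x" using x by (auto simp: w_def)
  have "s / 4 + c\<^sup>2 = s / 4 * (1 + 4 * x)" unfolding cx by (simp add: algebra_simps)
  then have "sqrt (s / 4 + c\<^sup>2) = sqrt (s / 4) * w"
    unfolding w_def by (simp only: real_sqrt_mult)
  then have "sqrt (s / 4 + c\<^sup>2) = sqrt s / 2 * w"
    by (simp add: real_sqrt_divide)
  then have "(sqrt s / 2 + sqrt (s / 4 + c\<^sup>2))\<^sup>2 = (sqrt s / 2 + sqrt s / 2 * w)\<^sup>2" by (simp only:)
  also have "\<dots> = (sqrt s / 2 * (1 + w))\<^sup>2" by (simp only: distrib_left mult_1_right)
  also have "\<dots> = s / 4 * (1 + w)\<^sup>2" using s by (simp add: power_mult_distrib power_divide)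
  finally have "c\<^sup>2 / (sqrt s / 2 + sqrt (s / 4 + c\<^sup>2))\<^sup>2 = c\<^sup>2 / (s / 4 * (1 + w)\<^sup>2)"
    by (simp only:)
  also have "\<dots> = 4 * x / (1 + w)\<^sup>2" using s by (simp add: cx)
  also have "4 * x = (w - 1) * (1 + w)" using w by (simp add: power2_eq_square algebra_simps)
  also have "(w - 1) * (1 + w) / (1 + w)\<^sup>2 = (w - 1) / (1 + w)" using w by (simp add: power2_eq_square)
  also have "\<dots> = 1 - 2 / (1 + w)" using w by (simp add: field_simps)
  finally have 1: "c\<^sup>2 / (sqrt s / 2 + sqrt (s / 4 + c\<^sup>2))\<^sup>2 = 1 - 2 / (1 + w)" .
  have "s\<^sup>2 / 4 + c\<^sup>2 * (c\<^sup>2 + s) = (c\<^sup>2 + s / 2)\<^sup>2" by (simp add: power2_eq_square algebra_simps)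
  then have "sqrt (s\<^sup>2 / 4 + c\<^sup>2 * (c\<^sup>2 + s)) = c\<^sup>2 + s / 2" using s by simp
  then have "(s / 2 + sqrt (s\<^sup>2 / 4 + c\<^sup>2 * (c\<^sup>2 + s)))\<^sup>2 = (c\<^sup>2 + s)\<^sup>2" by (simp add: add.commute)
  moreover have "c\<^sup>2 + s > 0" using s by (simp add: add_nonneg_pos)
  ultimately have "c\<^sup>2 * (c\<^sup>2 + s) / (s / 2 + sqrt (s\<^sup>2 / 4 + c\<^sup>2 * (c\<^sup>2 + s)))\<^sup>2 = c\<^sup>2 / (c\<^sup>2 + s)"
    by (simp add: power2_eq_square)
  also have "\<dots> = s * x / (s * (x + 1))" unfolding cx by (simp add: algebra_simps)
  also have "\<dots> = x / (x + 1)" using s by simp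
  finally have 2: "c\<^sup>2 * (c\<^sup>2 + s) / (s / 2 + sqrt (s\<^sup>2 / 4 + c\<^sup>2 * (c\<^sup>2 + s)))\<^sup>2 = x / (x + 1)" .
  have "1 - 2 / q + p - 1 = 2 * (p / 2 - 1 / q)" for p q :: real by simp
  then show ?thesis unfolding 1 2 x_def[symmetric] beta_deriv_def w_def by blast
qed

context
  fixes v1 v2 :: real
  assumes v: "0 < v1" "v1 < v2"
begin

lemma cfun_eq:
  assumes c: "c > 0"
  shows "cfun v1 v2 c = cfun_primitive c v2 - cfun_primitive c v1"
proof -
  have "((\<lambda>s. (c\<^sup>2 / (sqrt s / 2 + sqrt (s / 4 + c\<^sup>2))\<^sup>2
       + c\<^sup>2 * (c\<^sup>2 + s) / (s / 2 + sqrt (s\<^sup>2 / 4 + c\<^sup>2 * (c\<^sup>2 + s)))\<^sup>2 - 1) / s\<^sup>2) has_integral cfun_primitive c v2 - cfun_primitive c v1) {v1..v2}"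
  proof (rule fundamental_theorem_of_calculus)
    fix s assume "s \<in> {v1..v2}"
    then have s: "s > 0" using v by auto
    show "(cfun_primitive c has_vector_derivative (c\<^sup>2 / (sqrt s / 2 + sqrt (s / 4 + c\<^sup>2))\<^sup>2
       + c\<^sup>2 * (c\<^sup>2 + s) / (s / 2 + sqrt (s\<^sup>2 / 4 + c\<^sup>2 * (c\<^sup>2 + s)))\<^sup>2 - 1) / s\<^sup>2) (at s within {v1..v2})"
      unfolding cfun_integrand[OF c s] has_real_derivative_iff_has_vector_derivative[symmetric]
      by (rule DERIV_subset[OF DERIV_cfun_primitive[OF c s]]) simp
  qed (use v in simp)
  then show ?thesis unfolding cfun_def by (rule integral_unique)
qed

lemma cfun_strict_mono:
  assumes c: "0 < c" "c < d"
  shows "cfun v1 v2 c < cfun v1 v2 d"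
proof -
  have d: "d > 0" using c by simp
  \<comment> \<open>The difference of the primitives for d and c is strictly increasing in s,
    because its derivative is the difference of the integrands.\<close>
  have "cfun_primitive d v1 - cfun_primitive c v1 < cfun_primitive d v2 - cfun_primitive c v2"
  proof (rule DERIV_pos_imp_increasing[OF v(2)])
    fix s assume "v1 \<le> s" "s \<le> v2"
    then have s: "s > 0" using v by simp
    have "c\<^sup>2 < d\<^sup>2" using c by (intro power_strict_mono) auto
    then have "beta_deriv (c\<^sup>2 / s) < beta_deriv (d\<^sup>2 / s)"
      using c s by (intro beta_deriv_strict_mono) (auto simp: divide_strict_right_mono)
    then have "0 < 2 * beta_deriv (d\<^sup>2 / s) / s\<^sup>2 - 2 * beta_deriv (c\<^sup>2 / s) / s\<^sup>2"
      using s by (simp add: diff_divide_distrib[symmetric])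
    then show "\<exists>y. ((\<lambda>s. cfun_primitive d s - cfun_primitive c s) has_real_derivative y) (at s) \<and> 0 < y"
      using DERIV_diff[OF DERIV_cfun_primitive[OF d s] DERIV_cfun_primitive[OF c(1) s]] by blast
  qed
  then show ?thesis using cfun_eq[OF c(1)] cfun_eq[OF d] by simp
qed

text \<open>With c0^2 = v1 / 2 the ratio c0^2 / s is at most 1/2 on the whole interval, and with
  c1^2 = 2 v2 the ratio c1^2 / s is at least 2. The integrand therefore has a constant sign at each
  end of the bracket.\<close>

lemma cfun_root: "\<exists>c>0. cfun v1 v2 c = 0"
proof -
  define c0 where "c0 = sqrt (v1 / 2)"
  define c1 where "c1 = sqrt (2 * v2)"
  have c0: "c0 > 0" "c0\<^sup>2 = v1 / 2" using v by (auto simp: c0_def)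
  have c1: "c1 > 0" "c1\<^sup>2 = 2 * v2" using v by (auto simp: c1_def)
  have c01: "c0 \<le> c1" unfolding c0_def c1_def using v by (intro real_sqrt_le_mono) auto
  have "cfun_primitive c0 v2 < cfun_primitive c0 v1"
  proof (rule DERIV_neg_imp_decreasing[OF v(2)])
    fix s assume s: "v1 \<le> s" "s \<le> v2"
    then have s0: "s > 0" using v by simp
    have le: "c0\<^sup>2 / s \<le> 1 / 2" unfolding c0 using s s0 by (simp add: field_simps)
    have "beta_deriv (c0\<^sup>2 / s) \<le> beta_deriv (1 / 2)"
    proof (cases "c0\<^sup>2 / s = 1 / 2")
      case False
      then have "c0\<^sup>2 / s < 1 / 2" using le by linarith
      moreover have "0 < c0\<^sup>2 / s" using c0(1) s0 by simp
      ultimately show ?thesis by (intro less_imp_le beta_deriv_strict_mono)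
    qed (simp only: order_refl)
    then have "beta_deriv (c0\<^sup>2 / s) < 0" using beta_deriv_half by linarith
    then have "2 * beta_deriv (c0\<^sup>2 / s) / s\<^sup>2 < 0" using s0 by (simp add: divide_neg_pos)
    then show "\<exists>y. (cfun_primitive c0 has_real_derivative y) (at s) \<and> y < 0" using DERIV_cfun_primitive[OF c0(1) s0] by blast
  qed
  then have lo: "cfun v1 v2 c0 \<le> 0" using cfun_eq[OF c0(1)] by simp
  have "cfun_primitive c1 v1 < cfun_primitive c1 v2"
  proof (rule DERIV_pos_imp_increasing[OF v(2)])
    fix s assume s: "v1 \<le> s" "s \<le> v2"
    then have s0: "s > 0" using v by simp
    have ge: "2 \<le> c1\<^sup>2 / s" unfolding c1 using s s0 by (simp add: field_simps)
    have "beta_deriv 2 \<le> beta_deriv (c1\<^sup>2 / s)"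
    proof (cases "c1\<^sup>2 / s = 2")
      case False
      then have "2 < c1\<^sup>2 / s" using ge by linarith
      then show ?thesis by (intro less_imp_le beta_deriv_strict_mono) auto
    qed (simp only: order_refl)
    then have "beta_deriv (c1\<^sup>2 / s) > 0" using beta_deriv_two by linarith
    then have "2 * beta_deriv (c1\<^sup>2 / s) / s\<^sup>2 > 0" using s0 by simp
    then show "\<exists>y. (cfun_primitive c1 has_real_derivative y) (at s) \<and> 0 < y" using DERIV_cfun_primitive[OF c1(1) s0] by blast
  qed
  then have hi: "0 \<le> cfun v1 v2 c1" using cfun_eq[OF c1(1)] by simp
  have cont: "continuous_on {c0..c1} (cfun v1 v2)"
  proof -
    have "continuous_on {c0..c1} (\<lambda>c. cfun_primitive c s)" if s: "s > 0" for s
    proof (intro continuous_at_imp_continuous_on ballI)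
      fix c assume "c \<in> {c0..c1}"
      then have c: "c > 0" using c0 by auto
      have i: "isCont (\<lambda>c. c\<^sup>2 / s) c" using s by (intro continuous_intros) auto
      have "isCont beta_lim (c\<^sup>2 / s)" using c s by (intro DERIV_isCont[OF DERIV_beta_lim]) simp
      from isCont_o2[OF i this] show "isCont (\<lambda>c. cfun_primitive c s) c"
        unfolding cfun_primitive_def using c by (intro continuous_intros) auto
    qed
    then have "continuous_on {c0..c1} (\<lambda>c. cfun_primitive c v2 - cfun_primitive c v1)"
      using v by (intro continuous_on_diff) auto
    then show ?thesis
      by (rule continuous_on_cong[THEN iffD1, rotated 2]) (use c0 cfun_eq in auto)
  qed
  obtain c where "c0 \<le> c" "c \<le> c1" "cfun v1 v2 c = 0"
    using IVT'[OF lo hi c01 cont] by blast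
  then show ?thesis using c0 by (intro exI[of _ c]) auto
qed

text \<open>At radius c sqrt n the parameter x = c^2 / v no longer involves n, and the two values of
  \<open>beta_lim\<close> form the primitive at the ends of the interval. The difference is taken as
  \<open>v1\<close> minus \<open>v2\<close>, so a positive value rules out attainment.\<close>

lemma endpoint_gain_diff:
  assumes n: "n > 2" and c: "c > 0"
  shows "\<bar>(endpoint_gain n (c * sqrt (real n)) v1 - endpoint_gain n (c * sqrt (real n)) v2) / real n - c\<^sup>2 / 2 * cfun v1 v2 c\<bar>
    \<le> 8 / sqrt (real n) * (c * (1 / sqrt v1 + 1 / sqrt v2) + c\<^sup>2 * (1 / v1 + 1 / v2))"
proof -
  have sn: "sqrt (real n) > 0" using n by simp
  have R: "c * sqrt (real n) > 0" using c sn by simp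
  have v2: "v2 > 0" using v by simp
  have x: "(c * sqrt (real n))\<^sup>2 / (real n * v) = c\<^sup>2 / v" for v
    using n by (simp add: power_mult_distrib)
  have sx: "sqrt (c\<^sup>2 / v) = c * (1 / sqrt v)" for v
    using c by (simp add: real_sqrt_divide)
  note beta_deriv = endpoint_gain_asymp[OF n R v(1), unfolded x sx] and b2 = endpoint_gain_asymp[OF n R v2, unfolded x sx]
  have "c\<^sup>2 / 2 * cfun v1 v2 c = beta_lim (c\<^sup>2 / v1) - beta_lim (c\<^sup>2 / v2)"
    unfolding cfun_eq[OF c] cfun_primitive_def using c by (simp add: field_simps)
  moreover have "8 / sqrt (real n) * (c * (1 / sqrt v1 + 1 / sqrt v2) + c\<^sup>2 * (1 / v1 + 1 / v2))
     = 8 / sqrt (real n) * (c * (1 / sqrt v1) + c\<^sup>2 / v1) + 8 / sqrt (real n) * (c * (1 / sqrt v2) + c\<^sup>2 / v2)"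
    by (simp add: algebra_simps)
  ultimately show ?thesis
    unfolding diff_divide_distrib using beta_deriv b2 by linarith
qed

end

theorem theorem3:
  fixes v1 v2 :: real
  assumes "0 < v1" and "v1 < v2" and "assumptionA"
  shows "\<exists>c>0. cfun v1 v2 c = 0 \<and> (\<forall>c'>0. cfun v1 v2 c' = 0 \<longrightarrow> c' = c) \<and>
           (\<lambda>n. Rbar n v1 v2 / sqrt (real n)) \<longlonglongrightarrow> c"
proof -
  note v = assms(1,2)
  obtain c where c: "c > 0" "cfun v1 v2 c = 0" using cfun_root[OF v] by blast
  have uniq: "c' = c" if "c' > 0" "cfun v1 v2 c' = 0" for c'
    using cfun_strict_mono[OF v that(1), of c] cfun_strict_mono[OF v c(1), of c'] c that by (cases c c' rule: linorder_cases) auto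
  have inv: "(\<lambda>n. 8 / sqrt (real n) * K) \<longlonglongrightarrow> 0" for K :: real
  proof -
    have "filterlim (\<lambda>n. sqrt (real n)) at_top sequentially"
      by (rule filterlim_compose[OF sqrt_at_top filterlim_real_sequentially])
    then have "(\<lambda>n. 8 / sqrt (real n)) \<longlonglongrightarrow> 0"
      by (intro tendsto_divide_0[OF tendsto_const] filterlim_at_top_imp_at_infinity)
    then show ?thesis using tendsto_mult_left_zero by blast
  qed
  have "(\<lambda>n. Rbar n v1 v2 / sqrt (real n)) \<longlonglongrightarrow> c"
  proof (rule metric_LIMSEQ_I)
    fix e :: real assume e: "e > 0"
    \<comment> \<open>Halving keeps the final deviation strictly below e and the lower factor c - d
      positive.\<close>
    define d where "d = min (e / 2) (c / 2)"
    have d: "d > 0" "d < e" "d < c" using e c by (auto simp: d_def)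
    define a where "a = c - d"
    define b where "b = c + d"
    have ab: "a > 0" "b > 0" "a < c" "c < b" using d c by (auto simp: a_def b_def)
    have fa: "cfun v1 v2 a < 0" using cfun_strict_mono[OF v ab(1,3)] c by simp
    have fb: "cfun v1 v2 b > 0" using cfun_strict_mono[OF v c(1) ab(4)] c by simp
    define Ka where "Ka = a * (1 / sqrt v1 + 1 / sqrt v2) + a\<^sup>2 * (1 / v1 + 1 / v2)"
    \<comment> \<open>Bounds the error coefficient of \<open>endpoint_gain_diff\<close> at every
      factor t > b after division by t^2, since t / t^2 is at most 1/b. The main term divided by t^2
      is at least \<open>cfun v1 v2 b / 2\<close>, so one condition on n handles all such t.\<close>
    define Kb where "Kb = 1 / b * (1 / sqrt v1 + 1 / sqrt v2) + (1 / v1 + 1 / v2)"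
    have "eventually (\<lambda>n. 8 / sqrt (real n) * Ka < - (a\<^sup>2 / 2 * cfun v1 v2 a)) sequentially"
      by (rule order_tendstoD(2)[OF inv]) (use fa ab in \<open>simp add: mult_pos_neg\<close>)
    moreover have "eventually (\<lambda>n. 8 / sqrt (real n) * Kb < cfun v1 v2 b / 2) sequentially"
      by (rule order_tendstoD(2)[OF inv]) (use fb in simp)
    moreover have "eventually (\<lambda>n::nat. n > 2) sequentially" by (rule eventually_gt_at_top)
    ultimately have "eventually (\<lambda>n. dist (Rbar n v1 v2 / sqrt (real n)) c < e) sequentially"
    proof eventually_elim
      case (elim n)
      have n: "n > 2" by fact
      have sn: "sqrt (real n) > 0" using n by simp
      define S where "S = {R. 0 \<le> R \<and> attains n v1 v2 R}"
      \<comment> \<open>A single attaining radius bounds the supremum from below, whatever happens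
        at smaller radii.\<close>
      have inS: "a * sqrt (real n) \<in> S"
      proof -
        have R: "a * sqrt (real n) > 0" using ab sn by simp
        have "(endpoint_gain n (a * sqrt (real n)) v1 - endpoint_gain n (a * sqrt (real n)) v2) / real n < 0"
          using endpoint_gain_diff[OF v n ab(1)] elim(1) unfolding Ka_def by linarith
        then have "endpoint_gain n (a * sqrt (real n)) v1 - endpoint_gain n (a * sqrt (real n)) v2 < 0"
          using n by (simp add: divide_less_0_iff)
        then have "xi_radial n (a * sqrt (real n)) v1 v2 0 \<le> xi_radial n (a * sqrt (real n)) v1 v2 (a * sqrt (real n))"
          using xi_radial_endpoint_gain[of n "a * sqrt (real n)" v1 v2] by linarith
        then have "attains n v1 v2 (a * sqrt (real n))"
          by (rule attainsI[OF n R v assms(3)])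
        then show ?thesis using R by (simp add: S_def)
      qed
      \<comment> \<open>Every larger radius is written as t sqrt n with t > b and excluded by the
        necessary condition at the centre. This also makes the set bounded, so that its supremum is
        meaningful.\<close>
      have upS: "R \<le> b * sqrt (real n)" if "R \<in> S" for R
      proof (rule ccontr)
        assume nle: "\<not> R \<le> b * sqrt (real n)"
        define t where "t = R / sqrt (real n)"
        have Rt: "R = t * sqrt (real n)" using sn by (simp add: t_def)
        have t: "t > b" using nle sn unfolding Rt by simp
        then have t0: "t > 0" using ab by simp
        have R0: "R > 0" unfolding Rt using t0 sn by simp
        have "cfun v1 v2 b / 2 \<le> cfun v1 v2 t / 2" using cfun_strict_mono[OF v ab(2) t] by simp
        then have m1: "t\<^sup>2 * (cfun v1 v2 b / 2) \<le> t\<^sup>2 / 2 * cfun v1 v2 t"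
          using mult_left_mono[of "cfun v1 v2 b / 2" "cfun v1 v2 t / 2" "t\<^sup>2"] by simp
        have "t * (1 / sqrt v1 + 1 / sqrt v2) + t\<^sup>2 * (1 / v1 + 1 / v2) \<le> t\<^sup>2 * Kb"
        proof -
          \<comment> \<open>Brings the linear part of the error to the order t^2 of the main
            term.\<close>
          have "t \<le> t\<^sup>2 * (1 / b)" using t t0 ab by (simp add: field_simps power2_eq_square)
          then have "t * (1 / sqrt v1 + 1 / sqrt v2) \<le> t\<^sup>2 * (1 / b) * (1 / sqrt v1 + 1 / sqrt v2)"
            using v by (intro mult_right_mono) auto
          then show ?thesis unfolding Kb_def by (simp add: algebra_simps)
        qed
        then have "8 / sqrt (real n) * (t * (1 / sqrt v1 + 1 / sqrt v2) + t\<^sup>2 * (1 / v1 + 1 / v2)) \<le> 8 / sqrt (real n) * (t\<^sup>2 * Kb)"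
          using sn by (intro mult_left_mono) auto
        also have "\<dots> = t\<^sup>2 * (8 / sqrt (real n) * Kb)" by simp
        also have "\<dots> < t\<^sup>2 * (cfun v1 v2 b / 2)"
          using elim(2) t0 by (intro mult_strict_left_mono) auto
        finally have m2: "8 / sqrt (real n) * (t * (1 / sqrt v1 + 1 / sqrt v2) + t\<^sup>2 * (1 / v1 + 1 / v2)) < t\<^sup>2 * (cfun v1 v2 b / 2)" .
        have "(endpoint_gain n R v1 - endpoint_gain n R v2) / real n > 0"
          using endpoint_gain_diff[OF v n t0] m1 m2 unfolding Rt by linarith
        then have "endpoint_gain n R v1 - endpoint_gain n R v2 > 0"
          using n by (simp add: zero_less_divide_iff)
        moreover have "xi_radial n R v1 v2 0 \<le> xi_radial n R v1 v2 R"
          using attainsD[OF n R0 v] that by (simp add: S_def)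
        ultimately show False using xi_radial_endpoint_gain[of n R v1 v2] by linarith
      qed
      have ne: "S \<noteq> {}" using inS by blast
      have bd: "bdd_above S" using upS by (rule bdd_aboveI)
      have Rb: "Rbar n v1 v2 = Sup S" using ne unfolding Rbar_def S_def by (simp only: if_False)
      have "a * sqrt (real n) \<le> Rbar n v1 v2" unfolding Rb by (rule cSup_upper[OF inS bd])
      moreover have "Rbar n v1 v2 \<le> b * sqrt (real n)" unfolding Rb using upS by (rule cSup_least[OF ne])
      ultimately have "a \<le> Rbar n v1 v2 / sqrt (real n)" "Rbar n v1 v2 / sqrt (real n) \<le> b"
        using sn by (simp_all add: pos_le_divide_eq pos_divide_le_eq)
      then show ?case using d unfolding a_def b_def dist_real_def by linarith
    qed
    then show "\<exists>N. \<forall>n\<ge>N. dist (Rbar n v1 v2 / sqrt (real n)) c < e"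
      by (simp add: eventually_sequentially)
  qed
  then show ?thesis using c uniq by blast
qed

end
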